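(* Let $L$ be either the lattice $L_{13}$ or the lattice $L_{15}$ defined in the context (the intersection lattices of a certain family of arrangements of $13$ planes, respectively $15$ planes). Then the moduli space $\mathcal{V}(L)$ over $\mathbb{C}$ is one-dimensional (hence its members are not rigid), and every arrangement in it is free but not inductively free. In particular, the inclusion $$\{\text{free arrangements}\}\subset\{\text{inductively free arrangements}\}\cup\{\text{rigid arrangements}\}$$ does not hold for central arrangements in $\mathbb{C}^3$.
   Context: A central arrangement $\mathcal{A}$ in $K^3$ ($K$ a field) is a finite set of linear planes; for $H\in\mathcal{A}$ let $\alpha_H$ be a defining linear form. With $S=K[x_1,x_2,x_3]$, $\mathcal{A}$ is free if $D(\mathcal{A})=\{\theta\in\bigoplus_{i=1}^3 S\,\partial/\partial x_i \mid \theta(\alpha_H)\in S\alpha_H\ \forall H\in\mathcal{A}\}$ is a free $S$-module. $\mathcal{A}$ is inductively free if there is a filtration of subarrangements $\mathcal{A}_1\subset\cdots\subset\mathcal{A}_\ell=\mathcal{A}$ with $|\mathcal{A}_i|=i$ and every $\mathcal{A}_i$ free. The intersection lattice $L(\mathcal{A})$ is the set of all intersections of subfamilies of $\mathcal{A}$, ordered by reverse inclusion; it is graded by codimension. For a graded lattice $L$ with rank-$k$ part $L_k$ and maximal rank $r$, let $\mathcal{U}(L)$ be the set of arrangements $\mathcal{A}$ with $|L_1|$ hyperplanes in $K^r$ such that there is a poset isomorphism $\varphi:L(\mathcal{A})\to L$ with $\varphi(\mathcal{A})=L_1$. The moduli space is $\mathcal{V}(L)=\mathcal{U}(L)/\mathrm{PGL}_r(K)$;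 here $K=\mathbb{C}$, $r=3$. An arrangement is called rigid if the moduli space of its intersection lattice is zero-dimensional and all elements of that moduli space are Galois conjugates of each other. The lattice $L_{13}$: the graded lattice of rank $3$ with minimum, maximum, $13$ atoms $1,\ldots,13$, and whose rank-$2$ elements, identified with the sets of atoms below them, are $\{1,6,8\},\{2,4,9\},\{3,5,7\}$; $\{1,5,9,13\},\{2,6,7,13\},\{3,4,8,13\}$; $\{1,4,7,10,11\},\{2,5,8,11,12\},\{3,6,9,10,12\}$; together with all two-element subsets of $\{1,\ldots,13\}$ not contained in any of these nine sets. The lattice $L_{15}$: the intersection lattice $L(\mathcal{A}_t)$ of the arrangement $\mathcal{A}_t=\{\ker\alpha\mid\alpha\in R\}$ in $\mathbb{Q}(t)^3$ ($t$ an indeterminate, a vector $(a,b,c)$ being regarded as the linear form $ax+by+cz$), where $R=\{(1,0,0),(1,1,0),(1,0,1),(1,1,1),(1,t,1),(0,1,0),(2,1,1),(t+1,t,1),(t+1,1,1),(2t,t,1),(1,-t+1,1),(-3t+1,t^2-3t+1,-t),(3t-1,t,t),(-3t+1,-t^2,-t),(3t-1,2t-1,t)\}$. *)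

theory Defs
  imports
    "HOL-Analysis.Analysis"
    "HOL-Library.Poly_Mapping"
    "HOL-Computational_Algebra.Polynomial"
    "HOL-Computational_Algebra.Fraction_Field"
begin

section \<open>Polynomials in several variables\<close>

text \<open>A monomial is a finitely supported exponent vector, a polynomial a finitely supported
  coefficient function on monomials; the ring structure is that of \<^theory>\<open>HOL-Library.Poly_Mapping\<close>.\<close>

type_synonym ('v, 'a) mpoly = "('v \<Rightarrow>\<^sub>0 nat) \<Rightarrow>\<^sub>0 'a"

definition mpoly_eval :: "('v, 'a::comm_semiring_1) mpoly \<Rightarrow> ('v \<Rightarrow> 'a) \<Rightarrow> 'a" where
  "mpoly_eval p x =
     (\<Sum>m\<in>Poly_Mapping.keys p. Poly_Mapping.lookup p m *
        (\<Prod>v\<in>Poly_Mapping.keys m. x v ^ Poly_Mapping.lookup m v))"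

definition mpoly_diff :: "'v \<Rightarrow> ('v, 'a::comm_semiring_1) mpoly \<Rightarrow> ('v, 'a) mpoly" where
  "mpoly_diff v p =
     (\<Sum>m\<in>Poly_Mapping.keys p. Poly_Mapping.single (m - Poly_Mapping.single v 1)
        (of_nat (Poly_Mapping.lookup m v) * Poly_Mapping.lookup p m))"

section \<open>Central arrangements of planes in a three-dimensional space\<close>

type_synonym 'a arrangement = "('a ^ 3) set set"

definition kernel_plane :: "'a::field ^ 3 \<Rightarrow> ('a ^ 3) set" where
  "kernel_plane a = {x. (\<Sum>i\<in>UNIV. a $ i * x $ i) = 0}"

definition arrangement :: "'a::field arrangement \<Rightarrow> bool" where
  "arrangement A \<longleftrightarrow> finite A \<and> (\<forall>H\<in>A. vec.subspace H \<and> vec.dim H = 2)"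

lemma plane_is_kernel:
  fixes H :: "('a::field ^ 3) set"
  assumes H: "vec.subspace H" "vec.dim H = 2"
  obtains a where "a \<noteq> 0" "H = kernel_plane a"
proof -
  obtain B where B: "B \<subseteq> H" "vec.independent B" "H \<subseteq> vec.span B" "card B = vec.dim H"
    by (rule vec.basis_exists)
  have spanB: "vec.span B = H"
    using B H by (metis vec.span_minimal subset_antisym)
  define C where "C = vec.extend_basis B"
  have C: "B \<subseteq> C" "vec.independent C" "vec.span C = UNIV"
    using B(2) vec.extend_basis_superset vec.independent_extend_basis vec.span_extend_basis
    by (auto simp: C_def)
  have "card C = 3"
    using C vec.dim_eq_card[of C UNIV] by (simp only: vec.dim_UNIV card_cart_basis) (simp add: card_cart_basis)
  moreover have "finite C" "finite B"
    using C(2) B(2) vec.independent_bound_general by (auto intro: vec.finiteI_independent)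
  ultimately have "card (C - B) = 1"
    using C(1) B(4) H(2) by (simp add: card_Diff_subset)
  then obtain w where w: "C - B = {w}"
    by (auto simp: card_1_singleton_iff)
  then have Cw: "C = insert w B" "w \<notin> B" using C(1) by auto
  obtain f where f: "Vector_Spaces.linear (*s) (*s) f"
      "\<forall>x\<in>C. f x = (if x = w then axis 1 1 else 0 :: 'a^3)"
    using vec.linear_independent_extend[OF C(2), of "\<lambda>x. if x = w then axis 1 1 else 0 :: 'a^3"]
    by blast
  interpret f: Vector_Spaces.linear "(*s)" "(*s)" f by (rule f(1))
  define a where "a = row 1 (matrix f)"
  have fa: "(\<Sum>i\<in>UNIV. a $ i * x $ i) = f x $ 1" for x
    using matrix_works[OF f(1), of x, symmetric]
    by (simp add: a_def row_def matrix_vector_mult_def)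
  have f0: "f x = 0" if "x \<in> H" for x
  proof -
    have "x \<in> vec.span B" using that spanB by simp
    then show ?thesis
      by (rule f.eq_0_on_span[rotated]) (use f(2) Cw in auto)
  qed
  have "x \<in> H" if "f x $ 1 = 0" for x
  proof -
    have "x \<in> vec.span (insert w B)" using C(3) Cw by auto
    then obtain k where k: "x - k *s w \<in> vec.span B"
      by (auto simp: vec.span_insert)
    then have "f (x - k *s w) = 0" using f0 spanB by simp
    then have "f x = k *s axis 1 1" using f(2) Cw by (simp add: f.diff f.scale)
    then have "k = 0" using that by (simp add: axis_def)
    then show ?thesis using k spanB by simp
  qed
  then have "H = kernel_plane a"
    using f0 by (auto simp: kernel_plane_def fa)
  moreover have "a \<noteq> 0"
  proof
    assume "a = 0"
    then have "f w $ 1 = 0" using fa[of w] by simp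
    then show False using f(2) Cw by (simp add: axis_def)
  qed
  ultimately show thesis using that by blast
qed

definition linear_form :: "'a::field ^ 3 \<Rightarrow> (3, 'a) mpoly" where
  "linear_form a = (\<Sum>i\<in>UNIV. Poly_Mapping.single (Poly_Mapping.single i 1) (a $ i))"

text \<open>An element of the free module on the partial derivatives is given by its coefficient vector.\<close>

definition apply_derivation :: "(3, 'a::field) mpoly ^ 3 \<Rightarrow> (3, 'a) mpoly \<Rightarrow> (3, 'a) mpoly" where
  "apply_derivation \<theta> f = (\<Sum>i\<in>UNIV. \<theta> $ i * mpoly_diff i f)"

text \<open>The condition is imposed for every defining form of each plane; two such forms differ by
  a nonzero scalar, so choosing one form per plane gives the same module.\<close>

definition derivation_module :: "'a::field arrangement \<Rightarrow> ((3, 'a) mpoly ^ 3) set" where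
  "derivation_module A =
     {\<theta>. \<forall>H\<in>A. \<forall>a. a \<noteq> 0 \<and> H = kernel_plane a \<longrightarrow>
            linear_form a dvd apply_derivation \<theta> (linear_form a)}"

definition free_arrangement :: "'a::field arrangement \<Rightarrow> bool" where
  "free_arrangement A \<longleftrightarrow>
     (\<exists>B. \<not> module.dependent ((*s) :: (3, 'a) mpoly \<Rightarrow> _) B \<and>
          module.span ((*s) :: (3, 'a) mpoly \<Rightarrow> _) B = derivation_module A)"

definition inductively_free :: "'a::field arrangement \<Rightarrow> bool" where
  "inductively_free A \<longleftrightarrow>
     (\<exists>F :: nat \<Rightarrow> 'a arrangement.
        (\<forall>i\<in>{1..card A}. F i \<subseteq> A \<and> card (F i) = i \<and> free_arrangement (F i)) \<and>
        (\<forall>i\<in>{1..<card A}. F i \<subset> F (Suc i)) \<and>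
        F (card A) = A)"

section \<open>Intersection lattices\<close>

text \<open>A poset is given by its reflexive order relation; its underlying set is the field of that
  relation.  The empty intersection is the whole space, the minimum of the lattice.\<close>

definition intersection_lattice :: "'a::field arrangement \<Rightarrow> ('a ^ 3) set rel" where
  "intersection_lattice A = relation_of (\<lambda>X Y. Y \<subseteq> X) {\<Inter>B | B. B \<subseteq> A}"

definition poset_iso :: "'b rel \<Rightarrow> 'c rel \<Rightarrow> ('b \<Rightarrow> 'c) \<Rightarrow> bool" where
  "poset_iso r s \<phi> \<longleftrightarrow> bij_betw \<phi> (Field r) (Field s) \<and>
     (\<forall>x\<in>Field r. \<forall>y\<in>Field r. (x, y) \<in> r \<longleftrightarrow> (\<phi> x, \<phi> y) \<in> s)"

text \<open>The rank of an element of a finite graded poset is the largest size of a chain strictly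
  below it.\<close>

definition poset_rank :: "'b rel \<Rightarrow> 'b \<Rightarrow> nat" where
  "poset_rank r x = Max {card C | C. C \<in> Chains r \<and> C \<subseteq> underS r x}"

definition rank_part :: "'b rel \<Rightarrow> nat \<Rightarrow> 'b set" where
  "rank_part r k = {x \<in> Field r. poset_rank r x = k}"

section \<open>Moduli spaces\<close>

definition realizations :: "'b rel \<Rightarrow> 'a::field arrangement set" where
  "realizations L =
     {A. arrangement A \<and> card A = card (rank_part L 1) \<and>
         (\<exists>\<phi>. poset_iso (intersection_lattice A) L \<phi> \<and> \<phi> ` A = rank_part L 1)}"

text \<open>Scalar matrices fix every plane, so the orbits of invertible matrices are the orbits of
  the projective linear group.\<close>

definition proj_equiv :: "'a::field arrangement rel" where
  "proj_equiv = {(A, B). \<exists>g :: 'a ^ 3 ^ 3. invertible g \<and> B = (\<lambda>H. (*v) g ` H) ` A}"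

definition moduli_space :: "'b rel \<Rightarrow> 'a::field arrangement set set" where
  "moduli_space L = realizations L // Restr proj_equiv (realizations L)"

subsection \<open>The Zariski topology on a moduli space, and its dimension\<close>

definition zariski_topology :: "('v \<Rightarrow> 'a::field) topology" where
  "zariski_topology =
     topology_generated_by (range (\<lambda>p :: ('v, 'a) mpoly. {x. mpoly_eval p x \<noteq> 0}))"

lemma topspace_zariski [simp]: "topspace (zariski_topology :: ('v \<Rightarrow> 'a::field) topology) = UNIV"
proof -
  have "{x. mpoly_eval (1 :: ('v, 'a) mpoly) x \<noteq> 0} = UNIV"
    by (simp add: mpoly_eval_def)
  then show ?thesis
    unfolding zariski_topology_def topology_generated_by_topspace by blast
qed

definition quotient_topology :: "'b topology \<Rightarrow> ('b \<Rightarrow> 'c) \<Rightarrow> 'c topology" where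
  "quotient_topology X f =
     topology (\<lambda>U. U \<subseteq> f ` topspace X \<and> openin X {x \<in> topspace X. f x \<in> U})"

lemma openin_quotient_topology:
  "openin (quotient_topology X f) U \<longleftrightarrow>
     U \<subseteq> f ` topspace X \<and> openin X {x \<in> topspace X. f x \<in> U}"
proof -
  have "istopology (\<lambda>U. U \<subseteq> f ` topspace X \<and> openin X {x \<in> topspace X. f x \<in> U})"
    unfolding istopology_def
  proof (intro conjI allI impI)
    fix S T
    assume "S \<subseteq> f ` topspace X \<and> openin X {x \<in> topspace X. f x \<in> S}"
      and "T \<subseteq> f ` topspace X \<and> openin X {x \<in> topspace X. f x \<in> T}"
    moreover have "{x \<in> topspace X. f x \<in> S \<inter> T} =
        {x \<in> topspace X. f x \<in> S} \<inter> {x \<in> topspace X. f x \<in> T}"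
      by auto
    ultimately show "S \<inter> T \<subseteq> f ` topspace X" "openin X {x \<in> topspace X. f x \<in> S \<inter> T}"
      by auto
  next
    fix K
    assume K: "\<forall>S\<in>K. S \<subseteq> f ` topspace X \<and> openin X {x \<in> topspace X. f x \<in> S}"
    then show "\<Union>K \<subseteq> f ` topspace X"
      by auto
    have "{x \<in> topspace X. f x \<in> \<Union>K} = (\<Union>S\<in>K. {x \<in> topspace X. f x \<in> S})"
      by auto
    with K show "openin X {x \<in> topspace X. f x \<in> \<Union>K}"
      by auto
  qed
  then show ?thesis
    by (simp add: quotient_topology_def)
qed

lemma topspace_quotient_topology [simp]: "topspace (quotient_topology X f) = f ` topspace X"
proof -
  have "{x \<in> topspace X. f x \<in> f ` topspace X} = topspace X"
    by auto
  then have "openin (quotient_topology X f) (f ` topspace X)"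
    by (simp add: openin_quotient_topology)
  then show ?thesis
    by (metis openin_quotient_topology openin_topspace openin_subset subset_antisym)
qed

lemma quotient_map_quotient_topology: "quotient_map X (quotient_topology X f) f"
  by (auto simp: quotient_map_def openin_quotient_topology)

text \<open>A point of the affine space with coordinates indexed by \<open>{..<n} \<times> {1, 2, 3}\<close> lists the
  coefficients of \<open>n\<close> linear forms; all other coordinates are required to vanish.\<close>

definition arrangement_of_coords :: "nat \<Rightarrow> (nat \<times> 3 \<Rightarrow> 'a::field) \<Rightarrow> 'a arrangement" where
  "arrangement_of_coords n c = (\<lambda>i. kernel_plane (\<chi> j. c (i, j))) ` {..<n}"

definition realization_coords :: "'b rel \<Rightarrow> (nat \<times> 3 \<Rightarrow> 'a::field) set" where
  "realization_coords L =
     {c. (\<forall>i\<ge>card (rank_part L 1). \<forall>j. c (i, j) = 0) \<and>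
         arrangement_of_coords (card (rank_part L 1)) c \<in> realizations L}"

text \<open>The moduli space carries the quotient of the Zariski topology on the ordered lists of
  defining forms: one divides by the scalings of the individual forms (which yields ordered lists
  of points of the dual projective plane), by the permutations of the list, and by the projective
  linear group.\<close>

definition moduli_topology :: "'b rel \<Rightarrow> 'a::field arrangement set topology" where
  "moduli_topology L =
     quotient_topology (subtopology zariski_topology (realization_coords L))
       (\<lambda>c. Restr proj_equiv (realizations L) ``
              {arrangement_of_coords (card (rank_part L 1)) c})"

lemma topspace_moduli_topology:
  "topspace (moduli_topology L :: 'a::field arrangement set topology) = moduli_space L"
proof -
  define n where "n = card (rank_part L 1)"
  have "\<exists>c. c \<in> realization_coords L \<and> arrangement_of_coords n c = A"
    if A: "A \<in> realizations L" for A :: "'a arrangement"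
  proof -
    have arr: "arrangement A" "card A = n"
      using A by (auto simp: realizations_def n_def)
    then obtain h where h: "bij_betw h {..<n} A"
      by (metis arrangement_def bij_betw_from_nat_into_finite ex_bij_betw_nat_finite atLeast0LessThan)
    have "\<exists>a. H = kernel_plane a" if "H \<in> A" for H
      using that arr plane_is_kernel unfolding arrangement_def by metis
    then obtain a where a: "\<And>H. H \<in> A \<Longrightarrow> H = kernel_plane (a H)"
      by metis
    define c where "c = (\<lambda>(i, j). if i < n then a (h i) $ j else 0)"
    have "arrangement_of_coords n c = (\<lambda>i. kernel_plane (a (h i))) ` {..<n}"
      by (auto simp: arrangement_of_coords_def c_def intro!: image_cong)
    also have "\<dots> = h ` {..<n}"
      using a h by (intro image_cong) (auto simp: bij_betw_def)
    also have "\<dots> = A" using h by (simp add: bij_betw_def)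
    finally have "arrangement_of_coords n c = A" .
    moreover from this have "c \<in> realization_coords L"
      using A by (simp add: realization_coords_def c_def n_def)
    ultimately show ?thesis by blast
  qed
  then have "arrangement_of_coords n ` realization_coords L = (realizations L :: 'a arrangement set)"
    by (auto simp: realization_coords_def n_def)
  then have "(\<lambda>A. Restr proj_equiv (realizations L) `` {A}) ` arrangement_of_coords n `
      realization_coords L = (moduli_space L :: 'a arrangement set set)"
    by (auto simp: moduli_space_def quotient_def)
  then show ?thesis
    by (simp add: moduli_topology_def image_image n_def)
qed

definition irreducible_closedin :: "'b topology \<Rightarrow> 'b set \<Rightarrow> bool" where
  "irreducible_closedin X Z \<longleftrightarrow> closedin X Z \<and> Z \<noteq> {} \<and>
     (\<forall>C D. closedin X C \<and> closedin X D \<and> Z \<subseteq> C \<union> D \<longrightarrow> Z \<subseteq> C \<or> Z \<subseteq> D)"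

text \<open>Krull dimension; it is \<open>- \<infinity>\<close> for the empty space.\<close>

definition krull_dim :: "'b topology \<Rightarrow> ereal" where
  "krull_dim X =
     Sup {ereal (real n) | n. \<exists>Z :: nat \<Rightarrow> 'b set.
            (\<forall>i\<le>n. irreducible_closedin X (Z i)) \<and> (\<forall>i<n. Z i \<subset> Z (Suc i))}"

subsection \<open>Rigidity\<close>

definition field_automorphism :: "('a::field \<Rightarrow> 'a) \<Rightarrow> bool" where
  "field_automorphism \<sigma> \<longleftrightarrow> bij \<sigma> \<and> \<sigma> 1 = 1 \<and>
     (\<forall>x y. \<sigma> (x + y) = \<sigma> x + \<sigma> y) \<and> (\<forall>x y. \<sigma> (x * y) = \<sigma> x * \<sigma> y)"

definition conjugate_arrangement :: "('a \<Rightarrow> 'a) \<Rightarrow> 'a::field arrangement \<Rightarrow> 'a arrangement" where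
  "conjugate_arrangement \<sigma> A = (\<lambda>H. (\<lambda>x. \<chi> i. \<sigma> (x $ i)) ` H) ` A"

text \<open>Conjugation of representatives is compatible with projective equivalence, hence acts on the
  points of a moduli space.\<close>

definition galois_conjugate :: "'a::field arrangement set \<Rightarrow> 'a arrangement set \<Rightarrow> bool" where
  "galois_conjugate X Y \<longleftrightarrow>
     (\<exists>\<sigma>. field_automorphism \<sigma> \<and> conjugate_arrangement \<sigma> ` X = Y)"

definition rigid :: "'a::field arrangement \<Rightarrow> bool" where
  "rigid A \<longleftrightarrow>
     krull_dim (moduli_topology (intersection_lattice A) :: 'a arrangement set topology) = 0 \<and>
     (\<forall>X \<in> (moduli_space (intersection_lattice A) :: 'a arrangement set set).
      \<forall>Y \<in> moduli_space (intersection_lattice A). galois_conjugate X Y)"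

section \<open>The two lattices\<close>

text \<open>The elements of \<open>L13\<close> are represented by the sets of atoms below them.\<close>

definition L13_blocks :: "nat set set" where
  "L13_blocks =
     {{1, 6, 8}, {2, 4, 9}, {3, 5, 7},
      {1, 5, 9, 13}, {2, 6, 7, 13}, {3, 4, 8, 13},
      {1, 4, 7, 10, 11}, {2, 5, 8, 11, 12}, {3, 6, 9, 10, 12}}"

definition L13 :: "nat set rel" where
  "L13 = relation_of (\<subseteq>)
     ({{}, {1..13}} \<union> {{i} | i. i \<in> {1..13}} \<union> L13_blocks \<union>
      {P. P \<subseteq> {1..13} \<and> card P = 2 \<and> \<not> (\<exists>B\<in>L13_blocks. P \<subseteq> B)})"

definition indet :: "rat poly fract" where
  "indet = Fract [:0, 1:] 1"

definition L15_forms :: "rat poly fract \<Rightarrow> (rat poly fract ^ 3) set" where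
  "L15_forms t =
     {vector [1, 0, 0], vector [1, 1, 0], vector [1, 0, 1], vector [1, 1, 1], vector [1, t, 1],
      vector [0, 1, 0], vector [2, 1, 1], vector [t + 1, t, 1], vector [t + 1, 1, 1],
      vector [2 * t, t, 1], vector [1, - t + 1, 1],
      vector [- 3 * t + 1, t^2 - 3 * t + 1, - t],
      vector [3 * t - 1, t, t],
      vector [- 3 * t + 1, - (t^2), - t],
      vector [3 * t - 1, 2 * t - 1, t]}"

definition L15 :: "(rat poly fract ^ 3) set rel" where
  "L15 = intersection_lattice (kernel_plane ` L15_forms indet)"

end

theory Submission imports Defs begin

text \<open>Derivations are identified with the polynomial maps that send every plane of \<open>A\<close> into itself,
  and by Saito's criterion the identity and two such maps form a basis as soon as the determinant of
  the three is a nonzero multiple of the product of all forms. In both families there is an explicit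
  basis whose two further members have the same degree \<open>e\<close>, where \<open>|A| = 2 e + 1\<close>, and every plane
  carries at most \<open>e\<close> points of intersection with the others. The latter makes every derivation of
  degree less than \<open>e\<close> of a deletion \<open>A - {H}\<close> preserve \<open>H\<close>, which is impossible if the deletion is
  free; so no chain of free subarrangements reaches \<open>A\<close>.

  A projective frame brings every realization of either lattice to a normal form that depends
  polynomially on one parameter \<open>t\<close>, with finitely many exceptional \<open>t\<close>; planes can be relabelled in
  finitely many ways only, so the moduli space is infinite, with closed points and finite proper
  closed subsets.\<close>

section \<open>Polynomial functions\<close>

text \<open>Both families have exponents \<open>1, e, e\<close>: below degree \<open>e\<close> only
  multiples of the identity preserve all planes, while a free deletion has determinant of degree
  \<open>2 e\<close> and would need something new below degree \<open>e\<close>. As freeness is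
  stated for arbitrary, possibly inhomogeneous bases, this is not counted with exponents:
  determinants are restricted to a ray and their orders at the origin are compared. A point of
  \<open>H\<close> on \<open>k\<close> planes forces a zero of multiplicity \<open>k - 2\<close>,
  and these multiplicities add up to \<open>2 e\<close> minus the number of points on
  \<open>H\<close>, which is at least \<open>e\<close>. For the moduli space the obstacle is that
  realizations carry no labels and are described by inequations as well as equations. Equivalence to
  the member with parameter \<open>t\<close> becomes a finite union, over labellings, of closed
  conditions, since a labelling with all prescribed concurrences has no room for another one. The
  ratios in the family with 13 planes are the roots of the simplest cubics of Shanks:
  \<open>r\<close> goes to \<open>- 1 / (1 + r)\<close> permutes them cyclically. The incidences
  amount to saying that the ratios form an orbit of this map, so one of them stays free.\<close>

inductive polyfn :: "('i \<Rightarrow> 'x \<Rightarrow> 'a) \<Rightarrow> ('x \<Rightarrow> 'a::comm_ring_1) \<Rightarrow> bool" for X where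
  polyfn_const: "polyfn X (\<lambda>_. c)"
| polyfn_coord: "polyfn X (X i)"
| polyfn_add: "polyfn X f \<Longrightarrow> polyfn X g \<Longrightarrow> polyfn X (\<lambda>x. f x + g x)"
| polyfn_mult: "polyfn X f \<Longrightarrow> polyfn X g \<Longrightarrow> polyfn X (\<lambda>x. f x * g x)"

lemma polyfn_uminus: "polyfn X f \<Longrightarrow> polyfn X (\<lambda>x. - f x)"
  using polyfn_mult[OF polyfn_const[of X "-1"]] by fastforce

lemma polyfn_diff: "polyfn X f \<Longrightarrow> polyfn X g \<Longrightarrow> polyfn X (\<lambda>x. f x - g x)"
  using polyfn_add[OF _ polyfn_uminus] by fastforce

lemma polyfn_power: "polyfn X f \<Longrightarrow> polyfn X (\<lambda>x. f x ^ n)"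
  by (induction n) (auto intro: polyfn_const polyfn_mult)

lemma polyfn_sum: "(\<And>i. i \<in> I \<Longrightarrow> polyfn X (f i)) \<Longrightarrow> polyfn X (\<lambda>x. \<Sum>i\<in>I. f i x)"
  by (induction I rule: infinite_finite_induct) (auto intro: polyfn_const polyfn_add)

lemma polyfn_prod: "(\<And>i. i \<in> I \<Longrightarrow> polyfn X (f i)) \<Longrightarrow> polyfn X (\<lambda>x. \<Prod>i\<in>I. f i x)"
  by (induction I rule: infinite_finite_induct) (auto intro: polyfn_const polyfn_mult)

lemmas polyfn_intros = polyfn_const polyfn_add polyfn_mult polyfn_uminus
  polyfn_diff polyfn_power polyfn_sum polyfn_prod

lemma polyfn_compose:
  assumes "polyfn X f" "\<And>i. polyfn Y (\<lambda>y. X i (g y))"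
  shows "polyfn Y (\<lambda>y. f (g y))"
  using assms(1) by induction (auto intro: polyfn_intros simp: assms(2))

section \<open>Evaluation of multivariate polynomials\<close>

lemma mpoly_eval_superset:
  assumes "finite K" "Poly_Mapping.keys p \<subseteq> K"
  shows "mpoly_eval p x = (\<Sum>m\<in>K. Poly_Mapping.lookup p m *
     (\<Prod>v\<in>Poly_Mapping.keys m. x v ^ Poly_Mapping.lookup m v))"
  unfolding mpoly_eval_def
  by (rule sum.mono_neutral_left) (use assms in \<open>auto simp: in_keys_iff\<close>)

lemma mpoly_eval_add: "mpoly_eval (p + q) x = mpoly_eval p x + mpoly_eval q x"
proof -
  let ?K = "Poly_Mapping.keys p \<union> Poly_Mapping.keys q"
  have *: "finite ?K" "Poly_Mapping.keys (p + q) \<subseteq> ?K" "Poly_Mapping.keys p \<subseteq> ?K"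
    "Poly_Mapping.keys q \<subseteq> ?K" by (auto simp: keys_add)
  show ?thesis
    using *(2-4) by (simp add: mpoly_eval_superset[OF *(1)] lookup_add distrib_right sum.distrib)
qed

lemma mpoly_eval_single:
  "mpoly_eval (Poly_Mapping.single m c) x =
     c * (\<Prod>v\<in>Poly_Mapping.keys m. x v ^ Poly_Mapping.lookup m v)"
  by (subst mpoly_eval_superset[of "{m}"]) auto

lemma monomial_eval_add:
  fixes x :: "'v \<Rightarrow> 'a::comm_semiring_1"
  shows "(\<Prod>v\<in>Poly_Mapping.keys (m + k). x v ^ Poly_Mapping.lookup (m + k) v) =
     (\<Prod>v\<in>Poly_Mapping.keys m. x v ^ Poly_Mapping.lookup m v) *
     (\<Prod>v\<in>Poly_Mapping.keys k. x v ^ Poly_Mapping.lookup k v)"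
proof -
  let ?K = "Poly_Mapping.keys m \<union> Poly_Mapping.keys k"
  have *: "(\<Prod>v\<in>Poly_Mapping.keys l. x v ^ Poly_Mapping.lookup l v) =
      (\<Prod>v\<in>?K. x v ^ Poly_Mapping.lookup l v)" if "Poly_Mapping.keys l \<subseteq> ?K" for l
    by (rule prod.mono_neutral_left) (use that in \<open>auto simp: in_keys_iff\<close>)
  show ?thesis
    by (subst (1 2 3) *) (auto simp: keys_add lookup_add power_add prod.distrib)
qed

lemma mpoly_induct [case_names zero single add]:
  assumes "P 0" "\<And>m c. P (Poly_Mapping.single m c)" "\<And>p q. P p \<Longrightarrow> P q \<Longrightarrow> P (p + q)"
  shows "P (p :: 'b \<Rightarrow>\<^sub>0 'a::comm_monoid_add)"
proof (induction p rule: Poly_Mapping.update_induct)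
  case const
  show ?case by (fact assms(1))
next
  case (update f k v)
  have "Poly_Mapping.update k v f = f + Poly_Mapping.single k v"
    using update(1)
        by (intro poly_mapping_eqI) (auto simp: lookup_update lookup_add lookup_single when_def
            in_keys_iff)
  then show ?case using assms(2,3) update by simp
qed

lemma mpoly_eval_0 [simp]: "mpoly_eval 0 x = 0"
  by (simp add: mpoly_eval_def)

lemma mpoly_eval_mult:
  "mpoly_eval (p * q) x = mpoly_eval p x * mpoly_eval q x"
proof (induction p rule: mpoly_induct)
  case (single m c)
  show ?case
    by (induction q rule: mpoly_induct)
      (simp_all add: mult_single mpoly_eval_single monomial_eval_add mpoly_eval_add algebra_simps)
qed (simp_all add: mpoly_eval_add distrib_right)

lemma mpoly_eval_sum: "mpoly_eval (\<Sum>i\<in>I. p i) x = (\<Sum>i\<in>I. mpoly_eval (p i) x)"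
  by (induction I rule: infinite_finite_induct) (auto simp: mpoly_eval_add)

lemma mpoly_eval_uminus:
  fixes p :: "('v, 'a::comm_ring_1) mpoly"
  shows "mpoly_eval (- p) x = - mpoly_eval p x"
  using mpoly_eval_add[of p "-p" x] by (simp add: eq_neg_iff_add_eq_0 add.commute)

lemma mpoly_eval_diff:
  fixes p :: "('v, 'a::comm_ring_1) mpoly"
  shows "mpoly_eval (p - q) x = mpoly_eval p x - mpoly_eval q x"
  using mpoly_eval_add[of p "-q" x] by (simp add: mpoly_eval_uminus)

text \<open>The bridge to actual polynomials: constants and coordinates are monomials, and
  evaluation respects sums and products. The parameter \<open>X\<close> names the coordinate
  functions, so one notion serves vectors (\<open>x $ i\<close>), points of the Zariski topology
  (\<open>c v\<close>) and, with index type \<open>unit\<close>, a single variable.\<close>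

lemma polyfn_iff_mpoly: "polyfn X f \<longleftrightarrow> (\<exists>p. f = (\<lambda>x. mpoly_eval p (\<lambda>i. X i x)))"
proof
  assume "polyfn X f"
  then show "\<exists>p. f = (\<lambda>x. mpoly_eval p (\<lambda>i. X i x))"
  proof induction
    case (polyfn_const c)
    show ?case by (rule exI[of _ "Poly_Mapping.single 0 c"]) (simp add: mpoly_eval_single)
  next
    case (polyfn_coord i)
    show ?case by (rule exI[of _ "Poly_Mapping.single (Poly_Mapping.single i 1) 1"])
        (simp add: mpoly_eval_single)
  next
    case (polyfn_add f g)
    then obtain p q where "f = (\<lambda>x. mpoly_eval p (\<lambda>i. X i x))" "g = (\<lambda>x. mpoly_eval q (\<lambda>i. X i x))"
      by blast
    then show ?case by (intro exI[of _ "p + q"]) (simp add: mpoly_eval_add)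
  next
    case (polyfn_mult f g)
    then obtain p q where "f = (\<lambda>x. mpoly_eval p (\<lambda>i. X i x))" "g = (\<lambda>x. mpoly_eval q (\<lambda>i. X i x))"
      by blast
    then show ?case by (intro exI[of _ "p * q"]) (simp add: mpoly_eval_mult)
  qed
next
  assume "\<exists>p. f = (\<lambda>x. mpoly_eval p (\<lambda>i. X i x))"
  then show "polyfn X f"
    by (auto simp: mpoly_eval_def intro!: polyfn_intros polyfn_coord[of X])
qed

lemma polyfn_mpoly: "polyfn X (\<lambda>x. mpoly_eval p (\<lambda>i. X i x))"
  by (auto simp: polyfn_iff_mpoly)

lemma polyfn_univariate: "polyfn (\<lambda>_::unit. \<lambda>s. s) f \<Longrightarrow> \<exists>p. \<forall>s. f s = poly p s"
proof (induction rule: polyfn.induct)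
  case (polyfn_const c)
  show ?case by (rule exI[of _ "[:c:]"]) simp
next
  case (polyfn_coord i)
  show ?case by (rule exI[of _ "[:0, 1:]"]) simp
next
  case (polyfn_add f g)
  then show ?case by (metis poly_add)
next
  case (polyfn_mult f g)
  then show ?case by (metis poly_mult)
qed

subsection \<open>Polynomial functions on the three-dimensional space\<close>

abbreviation pfun :: "('a::comm_ring_1 ^ 'n \<Rightarrow> 'a) \<Rightarrow> bool" where
  "pfun \<equiv> polyfn (\<lambda>i x. x $ i)"

definition pmap :: "('a::comm_ring_1 ^ 'n \<Rightarrow> 'a ^ 'm) \<Rightarrow> bool" where
  "pmap F \<longleftrightarrow> (\<forall>i. pfun (\<lambda>x. F x $ i))"

lemma pfun_coord: "pfun (\<lambda>x. x $ i)"
  by (rule polyfn_coord)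

lemma pmapD: "pmap F \<Longrightarrow> pfun (\<lambda>x. F x $ i)"
  by (simp add: pmap_def)

lemma pfun_compose: "pfun f \<Longrightarrow> pmap F \<Longrightarrow> pfun (\<lambda>x. f (F x))"
  by (rule polyfn_compose) (auto simp: pmap_def)

lemma pmap_id: "pmap (\<lambda>x. x)"
  unfolding pmap_def by (intro allI pfun_coord)

lemma pmap_add: "pmap F \<Longrightarrow> pmap G \<Longrightarrow> pmap (\<lambda>x. F x + G x)"
  by (auto simp: pmap_def intro: polyfn_intros)

lemma pmap_diff: "pmap F \<Longrightarrow> pmap G \<Longrightarrow> pmap (\<lambda>x. F x - G x)"
  by (auto simp: pmap_def intro: polyfn_intros)

lemma pmap_scale: "pfun f \<Longrightarrow> pmap F \<Longrightarrow> pmap (\<lambda>x. f x *s F x)"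
  by (auto simp: pmap_def intro: polyfn_intros)

lemma pmap_sum: "(\<And>i. i \<in> I \<Longrightarrow> pmap (F i)) \<Longrightarrow> pmap (\<lambda>x. \<Sum>i\<in>I. F i x)"
  by (auto simp: pmap_def intro: polyfn_intros)

lemma pmap_const: "pmap (\<lambda>_. v)"
  by (simp add: pmap_def polyfn_const)

lemma pmap_matrix: "pmap F \<Longrightarrow> pmap (\<lambda>x. M *v F x)"
  by (auto simp: pmap_def matrix_vector_mult_def intro!: polyfn_intros)

lemmas pmap_intros = pmap_id pmap_add pmap_diff pmap_scale pmap_sum pmap_const pmap_matrix

lemma pmap_compose: "pmap F \<Longrightarrow> pmap G \<Longrightarrow> pmap (\<lambda>x. F (G x))"
  unfolding pmap_def[of "\<lambda>x. F (G x)"] using pfun_compose pmapD by blast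

text \<open>Restriction to lines reduces several variables to one; most identity, order and degree
  arguments below are made for univariate polynomials along a line or a ray.\<close>

lemma pfun_line:
  fixes f :: "'a::comm_ring_1 ^ 'n \<Rightarrow> 'a"
  assumes "pfun f"
  shows "\<exists>p. \<forall>s. f (u + s *s v) = poly p s"
proof -
  have "polyfn (\<lambda>_::unit. \<lambda>s::'a. s) (\<lambda>s. s)"
    by (rule polyfn_coord[of "\<lambda>_::unit. \<lambda>s. s" "()"])
  then have "polyfn (\<lambda>_::unit. \<lambda>s. s) (\<lambda>s. f (u + s *s v))"
    by (intro polyfn_compose[OF assms], unfold vector_add_component vector_smult_component)
      (rule polyfn_add[OF polyfn_const polyfn_mult[OF _ polyfn_const]])
  then show ?thesis by (rule polyfn_univariate)
qed

lemma pfun_ray: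
  fixes f :: "'a::comm_ring_1 ^ 'n \<Rightarrow> 'a"
  assumes "pfun f"
  shows "\<exists>p. \<forall>s. f (s *s v) = poly p s"
  using pfun_line[OF assms, of 0 v] by simp

definition affine_set :: "('a::field ^ 'n) set \<Rightarrow> bool" where
  "affine_set S \<longleftrightarrow> (\<forall>x\<in>S. \<forall>y\<in>S. \<forall>s. x + s *s (y - x) \<in> S)"

lemma affine_set_UNIV: "affine_set UNIV"
  by (simp add: affine_set_def)

lemma affine_set_subspace: "vec.subspace S \<Longrightarrow> affine_set S"
  unfolding affine_set_def
      by (intro ballI allI vec.subspace_add vec.subspace_scale vec.subspace_diff)

lemma poly_eq_0_of_values:
  fixes p :: "'a::field_char_0 poly"
  assumes "\<And>s. s \<noteq> a \<Longrightarrow> poly p s = 0"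
  shows "p = 0"
proof (rule ccontr)
  assume "p \<noteq> 0"
  then have "finite (insert a {s. poly p s = 0})" by (simp add: poly_roots_finite)
  moreover have "insert a {s. poly p s = 0} = UNIV" using assms by blast
  ultimately show False using infinite_UNIV_char_0[where 'a = 'a] by simp
qed

text \<open>The line through \<open>x0\<close> and \<open>y\<close> stays in \<open>S\<close>; on it
  the product of two univariate polynomials is zero and the first factor is not. Thus polynomial
  functions on a plane or on the whole space have no zero divisors.\<close>

lemma pfun_mult_eq_0_on:
  fixes f g :: "'a::field_char_0 ^ 'n \<Rightarrow> 'a"
  assumes "affine_set S" "pfun f" "pfun g" "\<And>x. x \<in> S \<Longrightarrow> f x * g x = 0"
    and "x0 \<in> S" "f x0 \<noteq> 0" "y \<in> S"
  shows "g y = 0"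
proof -
  obtain p where p: "\<And>s. f (x0 + s *s (y - x0)) = poly p s"
    using pfun_line[OF assms(2)] by blast
  obtain q where q: "\<And>s. g (x0 + s *s (y - x0)) = poly q s"
    using pfun_line[OF assms(3)] by blast
  have "poly (p * q) s = 0" for s
    using assms by (simp flip: p q add: affine_set_def)
  then have "p * q = 0" using poly_eq_0_of_values by blast
  moreover have "poly p 0 \<noteq> 0" using assms by (simp flip: p)
  then have "p \<noteq> 0" by auto
  ultimately have "q = 0" by simp
  then show ?thesis using q[of 1] by simp
qed

subsection \<open>Faithfulness of evaluation\<close>

text \<open>Substituting \<open>s ^ N ^ i\<close> for the \<open>i\<close>-th variable, with \<open>N\<close> above all exponents, separates
  the monomials.\<close>

lemma digits_inj:
  fixes m1 m2 m3 N :: nat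
  assumes "m1 + N * (m2 + N * m3) = k1 + N * (k2 + N * k3)" "m1 < N" "m2 < N" "k1 < N" "k2 < N"
  shows "m1 = k1 \<and> m2 = k2 \<and> m3 = k3"
proof -
  have "(m1 + N * (m2 + N * m3)) mod N = m1" "(k1 + N * (k2 + N * k3)) mod N = k1"
    using assms(2,4) by simp_all
  then have 1: "m1 = k1" by (simp only: assms(1))
  then have e: "m2 + N * m3 = k2 + N * k3" using assms(1,2) by auto
  have "(m2 + N * m3) mod N = m2" "(k2 + N * k3) mod N = k2" using assms(3,5) by simp_all
  then have 2: "m2 = k2" by (simp only: e)
  then show ?thesis using 1 e assms(2) by auto
qed

lemma mpoly_eval_inj:
  fixes p :: "(3, 'a::field_char_0) mpoly"
  assumes "\<And>x. mpoly_eval p x = 0"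
  shows "p = 0"
proof -
  let ?l = Poly_Mapping.lookup
  obtain N where N: "\<And>m v. m \<in> Poly_Mapping.keys p \<Longrightarrow> ?l m v < N"
  proof -
    have "finite ((\<lambda>(m, v). ?l m v) ` (Poly_Mapping.keys p \<times> (UNIV :: 3 set)))" by simp
    then obtain N where "\<forall>k \<in> (\<lambda>(m, v). ?l m v) ` (Poly_Mapping.keys p \<times> (UNIV :: 3 set)). k < N"
      using finite_nat_set_iff_bounded by blast
    then have "?l m v < N" if "m \<in> Poly_Mapping.keys p" for m v
      using that by (metis (no_types, lifting) SigmaI UNIV_I case_prod_conv image_eqI)
    then show thesis by (rule that)
  qed
  define w where "w m = ?l m 1 + N * (?l m 2 + N * ?l m 3)" for m :: "3 \<Rightarrow>\<^sub>0 nat"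
  have inj: "inj_on w (Poly_Mapping.keys p)"
  proof (rule inj_onI)
    fix m k assume mk: "m \<in> Poly_Mapping.keys p" "k \<in> Poly_Mapping.keys p" "w m = w k"
    have "?l m 1 = ?l k 1 \<and> ?l m 2 = ?l k 2 \<and> ?l m 3 = ?l k 3"
      by (rule digits_inj[of _ N]) (use mk N in \<open>auto simp: w_def\<close>)
    then have "?l m v = ?l k v" for v using exhaust_3[of v] by auto
    then show "m = k" by (rule poly_mapping_eqI)
  qed
  define x :: "'a \<Rightarrow> 3 \<Rightarrow> 'a"
      where "x s v = (if v = 1 then s else if v = 2 then s ^ N else s ^ (N * N))" for s v
  define P where "P = (\<Sum>m\<in>Poly_Mapping.keys p. monom (?l p m) (w m))"
  have "(\<Prod>v\<in>Poly_Mapping.keys m. x s v ^ ?l m v) = s ^ w m" for m s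
  proof -
    have "(\<Prod>v\<in>Poly_Mapping.keys m. x s v ^ ?l m v) = (\<Prod>v\<in>UNIV. x s v ^ ?l m v)"
      by (rule prod.mono_neutral_left) (auto simp: in_keys_iff)
    also have "\<dots> = s ^ w m"
      unfolding UNIV_3 by (simp add: x_def w_def power_add algebra_simps flip: power_mult)
    finally show ?thesis .
  qed
  then have "poly P s = mpoly_eval p (x s)" for s
    by (simp add: P_def poly_sum poly_monom mpoly_eval_def)
  then have "P = 0" using assms poly_eq_0_of_values[of 0 P] by simp
  have "?l p m = 0" if m: "m \<in> Poly_Mapping.keys p" for m
  proof -
    have "coeff P (w m) = (\<Sum>k\<in>Poly_Mapping.keys p. if k = m then ?l p k else 0)"
      unfolding P_def coeff_sum coeff_monom
      by (rule sum.cong) (use inj m in \<open>auto dest: inj_onD\<close>)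
    then show ?thesis using \<open>P = 0\<close> m by simp
  qed
  then show ?thesis by (metis in_keys_iff poly_mapping_eqI lookup_zero)
qed

subsection \<open>Homogeneous components\<close>

definition homog :: "nat \<Rightarrow> ('a::comm_ring_1 ^ 'n \<Rightarrow> 'a) \<Rightarrow> bool" where
  "homog d f \<longleftrightarrow> (\<forall>s x. f (s *s x) = s ^ d * f x)"

definition homog_map :: "nat \<Rightarrow> ('a::comm_ring_1 ^ 'n \<Rightarrow> 'a ^ 'm) \<Rightarrow> bool" where
  "homog_map d F \<longleftrightarrow> (\<forall>s x. F (s *s x) = s ^ d *s F x)"

lemma pfun_homogeneous_components:
  fixes f :: "'a::comm_ring_1 ^ 'n \<Rightarrow> 'a"
  assumes "pfun f"
  obtains N g where "\<And>k. pfun (g k)" "\<And>k. homog k (g k)" "\<And>k x. k \<ge> N \<Longrightarrow> g k x = 0"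
    "\<And>x. f x = (\<Sum>k<N. g k x)"
proof -
  obtain p where p: "f = (\<lambda>x. mpoly_eval p (\<lambda>i. x $ i))"
    using assms by (auto simp: polyfn_iff_mpoly)
  define K where "K = Poly_Mapping.keys p"
  define dg where "dg m = (\<Sum>v\<in>Poly_Mapping.keys m. Poly_Mapping.lookup m v)" for m :: "'n \<Rightarrow>\<^sub>0 nat"
  define T where "T m x = Poly_Mapping.lookup p m *
     (\<Prod>v\<in>Poly_Mapping.keys m. (x $ v) ^ Poly_Mapping.lookup m v)" for m x
  define g where "g k x = (\<Sum>m\<in>{m\<in>K. dg m = k}. T m x)" for k x
  have finK: "finite K" by (simp add: K_def)
  then obtain N where N: "\<forall>m\<in>K. dg m < N"
    using finite_nat_set_iff_bounded[of "dg ` K"] by auto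
  have T: "pfun (T m)" "homog (dg m) (T m)" for m
    unfolding T_def homog_def
    by (auto intro!: polyfn_intros pfun_coord
        simp: dg_def power_sum power_mult_distrib prod.distrib algebra_simps)
  have "pfun (g k)" for k
    unfolding g_def by (rule polyfn_sum) (rule T)
  moreover have "homog k (g k)" for k
    using T(2) by (auto simp: homog_def g_def sum_distrib_left)
  moreover have "g k x = 0" if "k \<ge> N" for k x
  proof -
    have "{m\<in>K. dg m = k} = {}" using N that by auto
    then show ?thesis unfolding g_def by (simp only: sum.empty)
  qed
  moreover have "f x = (\<Sum>k<N. g k x)" for x
  proof -
    have "f x = (\<Sum>m\<in>K. T m x)" by (simp add: p mpoly_eval_def K_def T_def)
    also have "\<dots> = (\<Sum>k<N. g k x)"
      unfolding g_def using N finK by (intro sum.group[symmetric]) auto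
    finally show ?thesis .
  qed
  ultimately show thesis by (rule that)
qed

lemma pmap_homogeneous_components:
  fixes F :: "'a::comm_ring_1 ^ 'n \<Rightarrow> 'a ^ 'm"
  assumes "pmap F"
  obtains N G where "\<And>k. pmap (G k)" "\<And>k. homog_map k (G k)" "\<And>x. F x = (\<Sum>k<N. G k x)"
proof -
  have "\<exists>N g. (\<forall>k. pfun (g k)) \<and> (\<forall>k. homog k (g k)) \<and> (\<forall>k x. k \<ge> N \<longrightarrow> g k x = 0) \<and>
      (\<forall>x. F x $ i = (\<Sum>k<N. g k x))" for i
    by (rule pfun_homogeneous_components[OF pmapD[OF assms, of i]]) blast
  then obtain N g where g: "\<And>i k. pfun (g i k)" "\<And>i k. homog k (g i k)"
      "\<And>i k x. k \<ge> N i \<Longrightarrow> g i k x = 0" "\<And>i x. F x $ i = (\<Sum>k<N i. g i k x)"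
    by metis
  \<comment> \<open>A common bound for all coordinates; components beyond \<open>N i\<close> are
    zero and may be added.\<close>
  define M where "M = (\<Sum>i\<in>UNIV. N i)"
  have NM: "N i \<le> M" for i
    unfolding M_def by (rule member_le_sum) auto
  have "F x $ i = (\<Sum>k<M. g i k x)" for i x
    unfolding g(4) by (rule sum.mono_neutral_left) (use g(3) NM in auto)
  then have "F x = (\<Sum>k<M. \<chi> i. g i k x)" for x
    by (simp add: vec_eq_iff)
  moreover have "pmap (\<lambda>x. \<chi> i. g i k x)" for k
    using g(1) by (simp add: pmap_def)
  moreover have "homog_map k (\<lambda>x. \<chi> i. g i k x)" for k
    using g(2) by (simp add: homog_map_def homog_def vec_eq_iff)
  ultimately show thesis using that[of "\<lambda>k x. \<chi> i. g i k x" M] by blast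
qed

text \<open>Exchanging \<open>u\<close> and \<open>v\<close> inverts the parameter:
  \<open>f (u + s v) = s ^ d * f (v + u / s)\<close>. So \<open>p\<close> is \<open>s ^ d\<close>
  times a polynomial in \<open>1 / s\<close>, which leaves no power above \<open>d\<close>.\<close>

lemma homog_line_degree:
  fixes f :: "'a::field_char_0 ^ 'n \<Rightarrow> 'a"
  assumes f: "pfun f" "homog d f" and p: "\<And>s. f (u + s *s v) = poly p s"
  shows "degree p \<le> d"
proof (cases "p = 0")
  case False
  obtain q where q: "\<And>s. f (v + s *s u) = poly q s"
    using pfun_line[OF f(1)] by blast
  have "poly (monom 1 (degree q) * p - monom 1 d * reflect_poly q) s = 0" if "s \<noteq> 0" for s
  proof -
    have "u + s *s v = s *s (v + inverse s *s u)"
      using that by (simp add: vec_eq_iff field_simps)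
    then have "f (u + s *s v) = f (s *s (v + inverse s *s u))" by (rule arg_cong)
    also have "\<dots> = s ^ d * f (v + inverse s *s u)" using f(2) unfolding homog_def by blast
    finally have "poly p s = s ^ d * poly q (inverse s)"
      by (simp only: p q)
    then show ?thesis using that
      by (simp add: poly_monom poly_reflect_poly_nz)
  qed
  then have "monom 1 (degree q) * p - monom 1 d * reflect_poly q = 0"
    by (rule poly_eq_0_of_values)
  then have e: "monom 1 (degree q) * p = monom 1 d * reflect_poly q"
    by simp
  have "q \<noteq> 0" using e False by auto
  then have "degree q + degree p = d + degree (reflect_poly q)"
    using arg_cong[OF e, of degree] False
    by (simp add: degree_mult_eq degree_monom_eq)
  then show ?thesis using degree_reflect_poly_le[of q] by simp
qed simp

section \<open>Vectors and linear forms in dimension three\<close>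

definition dotp :: "'a::comm_ring_1 ^ 3 \<Rightarrow> 'a ^ 3 \<Rightarrow> 'a" where
  "dotp a x = (\<Sum>i\<in>UNIV. a $ i * x $ i)"

text \<open>The determinant with the given rows. Its vanishing is read in two ways: three vectors
  lie in a plane, or three forms have a common nonzero zero.\<close>

definition bracket :: "'a::comm_ring_1 ^ 3 \<Rightarrow> 'a ^ 3 \<Rightarrow> 'a ^ 3 \<Rightarrow> 'a" where
  "bracket a b c = a $ 1 * (b $ 2 * c $ 3 - b $ 3 * c $ 2) - a $ 2 * (b $ 1 * c $ 3 - b $ 3 * c $ 1)
     + a $ 3 * (b $ 1 * c $ 2 - b $ 2 * c $ 1)"

lemma dotp_3: "dotp a x = a $ 1 * x $ 1 + a $ 2 * x $ 2 + a $ 3 * x $ 3"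
  by (simp add: dotp_def sum_3)

lemma mem_kernel_plane: "x \<in> kernel_plane a \<longleftrightarrow> dotp a x = 0"
  by (simp add: kernel_plane_def dotp_def)

lemma dotp_add: "dotp a (x + y) = dotp a x + dotp a y"
  and dotp_diff: "dotp a (x - y) = dotp a x - dotp a y"
  and dotp_scale: "dotp a (s *s x) = s * dotp a x"
  and dotp_scale_left: "dotp (s *s a) x = s * dotp a x"
  and dotp_0: "dotp a 0 = 0" "dotp 0 x = 0"
  by (simp_all add: dotp_3 algebra_simps)

lemma dotp_axis: "dotp a (axis i c) = a $ i * c"
proof -
  have "dotp a (axis i c) = (\<Sum>j\<in>UNIV. if j = i then a $ i * c else 0)"
    unfolding dotp_def by (rule sum.cong) (auto simp: axis_def)
  then show ?thesis by simp
qed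

lemma dotp_sum: "dotp a (\<Sum>i\<in>I. F i) = (\<Sum>i\<in>I. dotp a (F i))"
  by (induction I rule: infinite_finite_induct) (auto simp: dotp_add dotp_0)

lemma subspace_kernel_plane: "vec.subspace (kernel_plane a)"
  by (auto simp: vec.subspace_def mem_kernel_plane dotp_add dotp_scale dotp_0)

lemma pfun_dotp: "pmap F \<Longrightarrow> pfun (\<lambda>x. dotp a (F x))"
  unfolding dotp_def pmap_def by (intro polyfn_intros) blast

lemma pfun_bracket: "pmap F \<Longrightarrow> pmap G \<Longrightarrow> pmap H \<Longrightarrow> pfun (\<lambda>x. bracket (F x) (G x) (H x))"
  unfolding bracket_def pmap_def by (intro polyfn_intros) blast+

lemma ex_dotp_eq_1:
  fixes a :: "'a::field ^ 3"
  assumes "a \<noteq> 0"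
  obtains w where "dotp a w = 1"
proof -
  obtain i where "a $ i \<noteq> 0" using assms by (auto simp: vec_eq_iff)
  then have "dotp a (axis i (1 / a $ i)) = 1"
    by (simp add: dotp_axis)
  then show thesis by (rule that)
qed

lemma kernel_plane_subset_imp:
  fixes a b :: "'a::field ^ 3"
  assumes "b \<noteq> 0" "kernel_plane b \<subseteq> kernel_plane a"
  obtains c where "a = c *s b"
proof -
  obtain w where w: "dotp b w = 1" using ex_dotp_eq_1[OF assms(1)] .
  have "dotp a x = dotp a w * dotp b x" for x
  proof -
    have "x - dotp b x *s w \<in> kernel_plane b"
      by (simp add: mem_kernel_plane dotp_diff dotp_scale w)
    then have "x - dotp b x *s w \<in> kernel_plane a" using assms by blast
    then show ?thesis by (simp add: mem_kernel_plane dotp_diff dotp_scale algebra_simps)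
  qed
  then have "a $ i = dotp a w * b $ i" for i
    using dotp_axis[of a i 1] dotp_axis[of b i 1] by (metis mult.right_neutral)
  then show thesis by (intro that[of "dotp a w"]) (simp add: vec_eq_iff)
qed

lemma kernel_plane_scale: "c \<noteq> 0 \<Longrightarrow> kernel_plane (c *s a) = kernel_plane a"
  by (auto simp: mem_kernel_plane dotp_scale_left)

lemma kernel_plane_subset_imp_eq:
  fixes a b :: "'a::field ^ 3"
  assumes "a \<noteq> 0" "b \<noteq> 0" "kernel_plane b \<subseteq> kernel_plane a"
  shows "kernel_plane a = kernel_plane b"
proof -
  obtain c where c: "a = c *s b" using kernel_plane_subset_imp assms by blast
  then have "c \<noteq> 0" using assms by auto
  then show ?thesis by (simp add: c kernel_plane_scale)
qed

lemma bracket_cramer: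
  "bracket u v w *s x = bracket x v w *s u + bracket u x w *s v + bracket u v x *s w"
  unfolding vec_eq_iff forall_3 bracket_def by (simp add: algebra_simps)

lemma bracket_add: "bracket (a + a') b c = bracket a b c + bracket a' b c"
  "bracket a (b + b') c = bracket a b c + bracket a b' c"
  "bracket a b (c + c') = bracket a b c + bracket a b c'"
  by (simp_all add: bracket_def algebra_simps)

lemma bracket_scale: "bracket (s *s a) b c = s * bracket a b c"
  "bracket a (s *s b) c = s * bracket a b c"
  "bracket a b (s *s c) = s * bracket a b c"
  by (simp_all add: bracket_def algebra_simps)

lemma bracket_same: "bracket a a c = 0" "bracket a b a = 0" "bracket a b b = 0"
  by (simp_all add: bracket_def algebra_simps)

lemma bracket_0: "bracket 0 b c = 0" "bracket a 0 c = 0" "bracket a b 0 = 0"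
  by (simp_all add: bracket_def)

text \<open>The identity behind the proof is
  \<open>bracket x y z a = (a x) (y \<times> z) + (a y) (z \<times> x) + (a z) (x \<times> y)\<close>.\<close>

lemma bracket_eq_0_of_plane:
  fixes a :: "'a::idom ^ 3"
  assumes "a \<noteq> 0" "dotp a x = 0" "dotp a y = 0" "dotp a z = 0"
  shows "bracket x y z = 0"
proof -
  have "bracket x y z * a $ 1 = dotp a x * (y $ 2 * z $ 3 - y $ 3 * z $ 2)
      + dotp a y * (z $ 2 * x $ 3 - z $ 3 * x $ 2) + dotp a z * (x $ 2 * y $ 3 - x $ 3 * y $ 2)"
    "bracket x y z * a $ 2 = dotp a x * (y $ 3 * z $ 1 - y $ 1 * z $ 3)
      + dotp a y * (z $ 3 * x $ 1 - z $ 1 * x $ 3) + dotp a z * (x $ 3 * y $ 1 - x $ 1 * y $ 3)"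
    "bracket x y z * a $ 3 = dotp a x * (y $ 1 * z $ 2 - y $ 2 * z $ 1)
      + dotp a y * (z $ 1 * x $ 2 - z $ 2 * x $ 1) + dotp a z * (x $ 1 * y $ 2 - x $ 2 * y $ 1)"
    by (simp_all add: bracket_def dotp_3 algebra_simps)
  then have "bracket x y z * a $ i = 0" for i
    using assms exhaust_3[of i] by auto
  then show ?thesis using assms(1) by (auto simp: vec_eq_iff)
qed

lemma bracket_eq_0_of_point:
  fixes q :: "'a::idom ^ 3"
  assumes "q \<noteq> 0" "dotp x q = 0" "dotp y q = 0" "dotp z q = 0"
  shows "bracket x y z = 0"
  using assms bracket_eq_0_of_plane[of q x y z] by (simp add: dotp_3 mult.commute)

subsection \<open>Divisibility by linear forms\<close>

text \<open>The factor theorem in difference form. For \<open>dotp a w = 1\<close> the point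
  \<open>x - dotp a x *s w\<close> is the projection of \<open>x\<close> to the plane of
  \<open>a\<close> along \<open>w\<close>; a coordinate changes by a multiple of
  \<open>dotp a x\<close>, and sums and products inherit this.\<close>

lemma pfun_sub_divisible:
  assumes "pfun f"
  shows "\<exists>h. pfun h \<and> (\<forall>x. f x - f (x - dotp a x *s w) = dotp a x * h x)"
  using assms
proof induction
  case (polyfn_const c)
  show ?case by (rule exI[of _ "\<lambda>_. 0"]) (simp add: polyfn.polyfn_const)
next
  case (polyfn_coord i)
  show ?case by (rule exI[of _ "\<lambda>_. w $ i"]) (simp add: polyfn.polyfn_const)
next
  case (polyfn_add f g)
  then obtain h k where hk: "pfun h" "pfun k" "\<And>x. f x - f (x - dotp a x *s w) = dotp a x * h x"
    "\<And>x. g x - g (x - dotp a x *s w) = dotp a x * k x" by blast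
  have "f x + g x - (f (x - dotp a x *s w) + g (x - dotp a x *s w)) = dotp a x * (h x + k x)" for x
    unfolding distrib_left hk(3,4)[symmetric] by simp
  then show ?case using hk(1,2)
    by (intro exI[of _ "\<lambda>x. h x + k x"] conjI polyfn.polyfn_add) auto
next
  case (polyfn_mult f g)
  then obtain h k where hk: "pfun h" "pfun k" "\<And>x. f x - f (x - dotp a x *s w) = dotp a x * h x"
    "\<And>x. g x - g (x - dotp a x *s w) = dotp a x * k x" by blast
  have "pmap (\<lambda>x. x - dotp a x *s w)"
    by (intro pmap_intros pfun_dotp)
  then have "pfun (\<lambda>x. f (x - dotp a x *s w))" by (rule pfun_compose[OF polyfn_mult(1)])
  moreover have "f x * g x - f (x - dotp a x *s w) * g (x - dotp a x *s w) =
      dotp a x * (h x * g x + f (x - dotp a x *s w) * k x)" for x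
  proof -
    have "f x * g x - f (x - dotp a x *s w) * g (x - dotp a x *s w) =
      (f x - f (x - dotp a x *s w)) * g x + f (x - dotp a x *s w) * (g x - g (x - dotp a x *s w))"
      by (simp add: algebra_simps)
    then show ?thesis unfolding hk by (simp add: algebra_simps)
  qed
  ultimately show ?case using hk polyfn_mult(1,2)
    by (intro exI[of _ "\<lambda>x. h x * g x + f (x - dotp a x *s w) * k x"] conjI
        polyfn.polyfn_add polyfn.polyfn_mult) auto
qed

lemma pfun_divisible:
  fixes f :: "'a::field ^ 3 \<Rightarrow> 'a"
  assumes "pfun f" "a \<noteq> 0" "\<And>x. x \<in> kernel_plane a \<Longrightarrow> f x = 0"
  obtains h where "pfun h" "\<And>x. f x = dotp a x * h x"
proof -
  obtain w where w: "dotp a w = 1" using ex_dotp_eq_1[OF assms(2)] .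
  obtain h where h: "pfun h" "\<And>x. f x - f (x - dotp a x *s w) = dotp a x * h x"
    using pfun_sub_divisible[OF assms(1)] by blast
  have "f (x - dotp a x *s w) = 0" for x
    by (rule assms(3)) (simp add: mem_kernel_plane dotp_diff dotp_scale w)
  then show thesis using h that by simp
qed

lemma pfun_prod_dotp: "pfun (\<lambda>x. \<Prod>i\<in>I. dotp (a i) x)"
  by (intro polyfn_intros pfun_dotp pmap_id)

text \<open>Induction gives a point good for \<open>I\<close>, the assumption one good for the new
  plane; absence of zero divisors on \<open>S\<close> gives a point good for both.\<close>

lemma prod_dotp_not_vanishing_on:
  fixes a :: "'i \<Rightarrow> 'a::field_char_0 ^ 3"
  assumes "finite I" "affine_set S" "S \<noteq> {}" "\<And>i. i \<in> I \<Longrightarrow> \<not> S \<subseteq> kernel_plane (a i)"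
  obtains x where "x \<in> S" "(\<Prod>i\<in>I. dotp (a i) x) \<noteq> 0"
  using assms(1,4)
proof (induction I arbitrary: thesis rule: finite_induct)
  case empty
  then show ?case using assms(3) by auto
next
  case (insert i I)
  obtain x where x: "x \<in> S" "(\<Prod>i\<in>I. dotp (a i) x) \<noteq> 0"
    using insert by blast
  have "\<exists>y\<in>S. dotp (a i) y \<noteq> 0"
    using insert.prems(2)[of i] by (auto simp: mem_kernel_plane)
  then obtain y where y: "y \<in> S" "dotp (a i) y \<noteq> 0" by blast
  show ?case
  proof (rule ccontr)
    assume "\<not> thesis"
    then have *: "dotp (a i) z * (\<Prod>i\<in>I. dotp (a i) z) = 0" if "z \<in> S" for z
      using insert.prems(1)[of z] that insert.hyps by auto
    have "(\<Prod>i\<in>I. dotp (a i) x) = 0"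
      by (rule pfun_mult_eq_0_on[OF assms(2) pfun_dotp[OF pmap_id] pfun_prod_dotp * y x(1)])
    with x show False by simp
  qed
qed

text \<open>The forms are split off one at a time. The product of those already removed does not
  vanish identically on the next plane, because the planes are distinct, so the quotient has to
  vanish there.\<close>

lemma pfun_divisible_prod:
  fixes f :: "'a::field_char_0 ^ 3 \<Rightarrow> 'a"
  assumes "finite I" "pfun f" "\<And>i. i \<in> I \<Longrightarrow> a i \<noteq> 0" "inj_on (\<lambda>i. kernel_plane (a i)) I"
    and "\<And>i x. i \<in> I \<Longrightarrow> x \<in> kernel_plane (a i) \<Longrightarrow> f x = 0"
  shows "\<exists>h. pfun h \<and> (\<forall>x. f x = (\<Prod>i\<in>I. dotp (a i) x) * h x)"
  using assms(1,3-5)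
proof (induction I rule: finite_induct)
  case empty
  then show ?case using assms(2) by auto
next
  case (insert j I)
  then obtain h where h: "pfun h" "\<And>x. f x = (\<Prod>i\<in>I. dotp (a i) x) * h x"
    by (auto simp: inj_on_def)
  have ne: "\<not> kernel_plane (a j) \<subseteq> kernel_plane (a i)" if "i \<in> I" for i
    using that insert.prems(1,2) insert.hyps kernel_plane_subset_imp_eq[of "a i" "a j"]
    by (auto simp: inj_on_def)
  have aff: "affine_set (kernel_plane (a j))"
    by (intro affine_set_subspace subspace_kernel_plane)
  have "0 \<in> kernel_plane (a j)" by (simp add: mem_kernel_plane dotp_0)
  then obtain x0 where x0: "x0 \<in> kernel_plane (a j)" "(\<Prod>i\<in>I. dotp (a i) x0) \<noteq> 0"
    using prod_dotp_not_vanishing_on[OF insert.hyps(1) aff, of a] ne by blast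
  have "h y = 0" if "y \<in> kernel_plane (a j)" for y
    by (rule pfun_mult_eq_0_on[OF aff pfun_prod_dotp h(1) _ x0 that])
      (use insert.prems(3)[of j] h(2) in simp)
  then obtain k where "pfun k" "\<And>x. h x = dotp (a j) x * k x"
    using pfun_divisible[OF h(1)] insert.prems(1)[of j] by (metis insertI1)
  then show ?case using h insert.hyps
    by (intro exI[of _ k]) (simp add: algebra_simps)
qed

section \<open>Derivations as polynomial maps\<close>

lemma mpoly_diff_superset:
  assumes "finite K" "Poly_Mapping.keys p \<subseteq> K"
  shows "mpoly_diff v p = (\<Sum>m\<in>K. Poly_Mapping.single (m - Poly_Mapping.single v 1)
        (of_nat (Poly_Mapping.lookup m v) * Poly_Mapping.lookup p m))"
  unfolding mpoly_diff_def
  by (rule sum.mono_neutral_left) (use assms in \<open>auto simp: in_keys_iff\<close>)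

lemma mpoly_diff_add: "mpoly_diff v (p + q) = mpoly_diff v p + mpoly_diff v q"
proof -
  let ?K = "Poly_Mapping.keys p \<union> Poly_Mapping.keys q"
  have *: "finite ?K" "Poly_Mapping.keys (p + q) \<subseteq> ?K" "Poly_Mapping.keys p \<subseteq> ?K"
    "Poly_Mapping.keys q \<subseteq> ?K" by (auto simp: keys_add)
  show ?thesis
    using *(2-4)
    by (simp add: mpoly_diff_superset[OF *(1)] lookup_add distrib_left single_add sum.distrib)
qed

lemma mpoly_diff_single: "mpoly_diff v (Poly_Mapping.single m c) =
    Poly_Mapping.single (m - Poly_Mapping.single v 1) (of_nat (Poly_Mapping.lookup m v) * c)"
  by (subst mpoly_diff_superset[of "{m}"]) auto

lemma mpoly_diff_linear_form: "mpoly_diff i (linear_form a) = Poly_Mapping.single 0 (a $ i)"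
proof -
  have "mpoly_diff i (Poly_Mapping.single (Poly_Mapping.single j 1) (a $ j)) =
      (if j = i then Poly_Mapping.single 0 (a $ i) else 0)" for j
    by (simp add: mpoly_diff_single lookup_single)
  then show ?thesis
    using exhaust_3[of i] by (auto simp: linear_form_def sum_3 mpoly_diff_add)
qed

definition eval_map :: "(('n, 'a::comm_ring_1) mpoly) ^ 'm \<Rightarrow> 'a ^ 'n \<Rightarrow> 'a ^ 'm" where
  "eval_map \<theta> x = (\<chi> i. mpoly_eval (\<theta> $ i) (\<lambda>j. x $ j))"

lemma pmap_eval_map: "pmap (eval_map \<theta>)"
  by (simp add: pmap_def eval_map_def polyfn_mpoly)

lemma ex_eval_map:
  assumes "pmap F"
  obtains \<theta> where "F = eval_map \<theta>"
proof -
  have "\<exists>p. (\<lambda>x. F x $ i) = (\<lambda>x. mpoly_eval p (\<lambda>j. x $ j))" for i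
    using pmapD[OF assms, of i] by (simp add: polyfn_iff_mpoly)
  then obtain p where p: "\<And>i. (\<lambda>x. F x $ i) = (\<lambda>x. mpoly_eval (p i) (\<lambda>j. x $ j))"
    by metis
  have "F x $ i = mpoly_eval (p i) (\<lambda>j. x $ j)" for x i
    using fun_cong[OF p] .
  then have "F = eval_map (\<chi> i. p i)" by (simp add: eval_map_def fun_eq_iff vec_eq_iff)
  then show thesis by (rule that)
qed

lemma mpoly_eval_eq_iff:
  fixes p q :: "(3, 'a::field_char_0) mpoly"
  shows "p = q \<longleftrightarrow> (\<forall>x :: 'a ^ 3. mpoly_eval p (\<lambda>j. x $ j) = mpoly_eval q (\<lambda>j. x $ j))"
proof
  assume *: "\<forall>x :: 'a ^ 3. mpoly_eval p (\<lambda>j. x $ j) = mpoly_eval q (\<lambda>j. x $ j)"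
  have "mpoly_eval (p - q) x = 0" for x
    using *[rule_format, of "\<chi> i. x i"] by (simp add: mpoly_eval_diff vec_lambda_inverse)
  then have "p - q = 0" by (rule mpoly_eval_inj)
  then show "p = q" by simp
qed simp

lemma eval_map_eq_iff:
  fixes \<theta> \<eta> :: "(3, 'a::field_char_0) mpoly ^ 'm"
  shows "eval_map \<theta> = eval_map \<eta> \<longleftrightarrow> \<theta> = \<eta>"
  by (auto simp: eval_map_def fun_eq_iff vec_eq_iff mpoly_eval_eq_iff)

lemma eval_map_add: "eval_map (\<theta> + \<eta>) x = eval_map \<theta> x + eval_map \<eta> x"
  by (simp add: eval_map_def vec_eq_iff mpoly_eval_add)

lemma eval_map_scale: "eval_map (p *s \<theta>) x = mpoly_eval p (\<lambda>j. x $ j) *s eval_map \<theta> x"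
  by (simp add: eval_map_def vec_eq_iff mpoly_eval_mult)

lemma eval_map_0: "eval_map 0 x = 0"
  by (simp add: eval_map_def vec_eq_iff)

lemma eval_map_sum: "eval_map (\<Sum>i\<in>I. \<theta> i) x = (\<Sum>i\<in>I. eval_map (\<theta> i) x)"
  by (induction I rule: infinite_finite_induct) (auto simp: eval_map_add eval_map_0)

lemma mpoly_eval_linear_form: "mpoly_eval (linear_form a) (\<lambda>j. x $ j) = dotp a x"
  by (simp add: linear_form_def mpoly_eval_sum mpoly_eval_single dotp_def)

text \<open>The partial derivatives of a linear form are its coefficients, so a derivation acts on
  it by plain composition; this turns tangency into a condition on values.\<close>

lemma mpoly_eval_apply_derivation:
  "mpoly_eval (apply_derivation \<theta> (linear_form a)) (\<lambda>j. x $ j) = dotp a (eval_map \<theta> x)"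
  by (simp add: apply_derivation_def mpoly_diff_linear_form mpoly_eval_sum mpoly_eval_mult
      mpoly_eval_single dotp_def eval_map_def mult.commute)

definition preserves :: "'b set set \<Rightarrow> ('b \<Rightarrow> 'b) \<Rightarrow> bool" where
  "preserves A F \<longleftrightarrow> (\<forall>H\<in>A. \<forall>x\<in>H. F x \<in> H)"

text \<open>Evaluating the divisibility gives one direction. For the other, the factor theorem
  divides the values by the form, and faithfulness of evaluation lifts the quotient to a polynomial
  identity.\<close>

lemma derivation_module_iff:
  fixes A :: "'a::field_char_0 arrangement"
  assumes "\<And>H. H \<in> A \<Longrightarrow> \<exists>a. a \<noteq> 0 \<and> H = kernel_plane a"
  shows "\<theta> \<in> derivation_module A \<longleftrightarrow> preserves A (eval_map \<theta>)"
proof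
  assume \<theta>: "\<theta> \<in> derivation_module A"
  show "preserves A (eval_map \<theta>)"
    unfolding preserves_def
  proof (intro ballI)
    fix H x assume H: "H \<in> A" "x \<in> H"
    then obtain a where a: "a \<noteq> 0" "H = kernel_plane a" using assms by blast
    then have "linear_form a dvd apply_derivation \<theta> (linear_form a)"
      using \<theta> H unfolding derivation_module_def by blast
    then obtain k where "apply_derivation \<theta> (linear_form a) = linear_form a * k" by (elim dvdE)
    then have "dotp a (eval_map \<theta> x) = dotp a x * mpoly_eval k (\<lambda>j. x $ j)"
      by (simp only: mpoly_eval_mult mpoly_eval_linear_form flip: mpoly_eval_apply_derivation)
    then show "eval_map \<theta> x \<in> H" using H by (simp add: a mem_kernel_plane)
  qed
next
  assume \<theta>: "preserves A (eval_map \<theta>)"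
  show "\<theta> \<in> derivation_module A"
    unfolding derivation_module_def
  proof (intro CollectI ballI allI impI, elim conjE)
    fix H a assume H: "H \<in> A" "a \<noteq> 0" "H = kernel_plane a"
    have "dotp a (eval_map \<theta> x) = 0" if "x \<in> kernel_plane a" for x
      using \<theta> H that unfolding preserves_def mem_kernel_plane[symmetric] by blast
    then obtain h where h: "pfun h" "\<And>x. dotp a (eval_map \<theta> x) = dotp a x * h x"
      using pfun_divisible[OF pfun_dotp[OF pmap_eval_map] H(2)] by metis
    obtain k where k: "h = (\<lambda>x. mpoly_eval k (\<lambda>j. x $ j))"
      using h(1) by (auto simp: polyfn_iff_mpoly)
    have "apply_derivation \<theta> (linear_form a) = linear_form a * k"
      by (simp add: mpoly_eval_eq_iff mpoly_eval_apply_derivation mpoly_eval_mult h k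
          mpoly_eval_linear_form)
    then show "linear_form a dvd apply_derivation \<theta> (linear_form a)" by simp
  qed
qed

lemma module_vec: "module ((*s) :: 'b::comm_ring_1 \<Rightarrow> 'b ^ 'n \<Rightarrow> 'b ^ 'n)"
  by unfold_locales (simp_all add: vec_eq_iff algebra_simps)

section \<open>Saito's criterion\<close>

locale plane_family =
  fixes I :: "'i set" and a :: "'i \<Rightarrow> 'a::field_char_0 ^ 3"
  assumes finite_index: "finite I"
    and form_nonzero: "i \<in> I \<Longrightarrow> a i \<noteq> 0"
    and inj_plane: "inj_on (\<lambda>i. kernel_plane (a i)) I"
begin

definition planes :: "'a arrangement" where
  "planes = (\<lambda>i. kernel_plane (a i)) ` I"

lemma kernel_of_planes: "H \<in> planes \<Longrightarrow> \<exists>a. a \<noteq> 0 \<and> H = kernel_plane a"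
  using form_nonzero by (auto simp: planes_def)

lemma mem_derivation_module: "\<theta> \<in> derivation_module planes \<longleftrightarrow> preserves planes (eval_map \<theta>)"
  by (rule derivation_module_iff) (rule kernel_of_planes)

lemma preserves_iff:
  "preserves planes F \<longleftrightarrow> (\<forall>i\<in>I. \<forall>x. dotp (a i) x = 0 \<longrightarrow> dotp (a i) (F x) = 0)"
  by (auto simp: preserves_def planes_def mem_kernel_plane)

lemma ex_form_prod_nonzero: "\<exists>x. (\<Prod>i\<in>I. dotp (a i) x) \<noteq> 0"
proof -
  have "\<not> UNIV \<subseteq> kernel_plane (a i)" if "i \<in> I" for i
    using ex_dotp_eq_1[OF form_nonzero[OF that]]
        by (metis UNIV_I mem_kernel_plane subsetD zero_neq_one)
  then show ?thesis
    using prod_dotp_not_vanishing_on[OF finite_index affine_set_UNIV, of a] by blast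
qed

lemma form_prod_cancel:
  assumes "pfun f" "\<And>x. (\<Prod>i\<in>I. dotp (a i) x) * f x = 0"
  shows "f x = 0"
  using ex_form_prod_nonzero pfun_mult_eq_0_on[OF affine_set_UNIV pfun_prod_dotp assms(1)] assms(2)
  by blast

text \<open>On the plane of \<open>i\<close> all three values lie in that plane and are dependent,
  so each form divides the determinant; distinct planes then give the whole product.\<close>

lemma bracket_divisible:
  assumes "pmap F" "pmap G" "pmap H" "preserves planes F" "preserves planes G" "preserves planes H"
  shows "\<exists>h. pfun h \<and> (\<forall>x. bracket (F x) (G x) (H x) = (\<Prod>i\<in>I. dotp (a i) x) * h x)"
proof (rule pfun_divisible_prod[OF finite_index])
  fix i x assume "i \<in> I" "x \<in> kernel_plane (a i)"
  then show "bracket (F x) (G x) (H x) = 0"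
    using assms(4-6) by (intro bracket_eq_0_of_plane[OF form_nonzero[of i]])
      (auto simp: preserves_iff mem_kernel_plane)
qed (use assms form_nonzero inj_plane in \<open>auto intro: pfun_bracket\<close>)

end

locale saito_basis = plane_family I a for I :: "'i set" and a :: "'i \<Rightarrow> 'a::field_char_0 ^ 3" +
  fixes F1 F2 F3 :: "'a ^ 3 \<Rightarrow> 'a ^ 3" and c :: 'a
  assumes pmap_basis: "pmap F1" "pmap F2" "pmap F3"
    and preserves_basis: "preserves planes F1" "preserves planes F2" "preserves planes F3"
    and det_basis: "\<And>x. bracket (F1 x) (F2 x) (F3 x) = c * (\<Prod>i\<in>I. dotp (a i) x)"
    and c_nonzero: "c \<noteq> 0"
begin

text \<open>Cramer's rule: each determinant with \<open>F\<close> in place of a basis member is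
  divisible by the product of the forms, which up to \<open>c\<close> is also the denominator;
  cancelling it leaves polynomial coefficients.\<close>

lemma basis_expansion:
  assumes F: "pmap F" "preserves planes F"
  obtains h1 h2 h3 where "pfun h1" "pfun h2" "pfun h3"
    "\<And>x. F x = h1 x *s F1 x + h2 x *s F2 x + h3 x *s F3 x"
proof -
  let ?Q = "\<lambda>x. \<Prod>i\<in>I. dotp (a i) x"
  obtain h1 where h1: "pfun h1" "\<And>x. bracket (F x) (F2 x) (F3 x) = ?Q x * h1 x"
    using bracket_divisible[OF F(1) pmap_basis(2,3) F(2) preserves_basis(2,3)] by blast
  obtain h2 where h2: "pfun h2" "\<And>x. bracket (F1 x) (F x) (F3 x) = ?Q x * h2 x"
    using bracket_divisible[OF pmap_basis(1) F(1) pmap_basis(3) preserves_basis(1) F(2)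
        preserves_basis(3)] by blast
  obtain h3 where h3: "pfun h3" "\<And>x. bracket (F1 x) (F2 x) (F x) = ?Q x * h3 x"
    using bracket_divisible[OF pmap_basis(1,2) F(1) preserves_basis(1,2) F(2)] by blast
  define G where "G x = h1 x *s F1 x + h2 x *s F2 x + h3 x *s F3 x" for x
  have G: "pmap G" unfolding G_def by (intro pmap_add pmap_scale h1 h2 h3 pmap_basis)
  have cQ: "(c * ?Q x) *s F x = ?Q x *s G x" for x
    using bracket_cramer[of "F1 x" "F2 x" "F3 x" "F x"]
    by (simp add: det_basis h1 h2 h3 G_def vec_eq_iff algebra_simps)
  have "c * F x $ i - G x $ i = 0" for x i
  proof (rule form_prod_cancel[of "\<lambda>x. c * F x $ i - G x $ i"])
    show "pfun (\<lambda>x. c * F x $ i - G x $ i)"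
      by (intro polyfn_intros pmapD F(1) G)
    have "c * ?Q x * F x $ i = ?Q x * G x $ i" for x
      using arg_cong[OF cQ[of x], of "\<lambda>v. v $ i"] by simp
    then show "?Q x * (c * F x $ i - G x $ i) = 0" for x
      by (simp add: algebra_simps)
  qed
  then have "F x = (1 / c) *s G x" for x
    using c_nonzero by (simp add: vec_eq_iff field_simps)
  then have "F x = (h1 x / c) *s F1 x + (h2 x / c) *s F2 x + (h3 x / c) *s F3 x" for x
    by (simp add: G_def vec_eq_iff add_divide_distrib)
  moreover have "pfun (\<lambda>x. h x / c)" if "pfun h" for h
    using polyfn_mult[OF that polyfn_const[of _ "1 / c"]] by simp
  ultimately show thesis using that h1(1) h2(1) h3(1) by blast
qed

lemma free: "free_arrangement planes"
proof -
  obtain \<theta>1 \<theta>2 \<theta>3 where \<theta>: "F1 = eval_map \<theta>1" "F2 = eval_map \<theta>2" "F3 = eval_map \<theta>3"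
    using ex_eval_map pmap_basis by metis
  interpret m: module "(*s) :: (3, 'a) mpoly \<Rightarrow> (3, 'a) mpoly ^ 3 \<Rightarrow> _" by (rule module_vec)
  let ?B = "{\<theta>1, \<theta>2, \<theta>3}"
  obtain x0 where "(\<Prod>i\<in>I. dotp (a i) x0) \<noteq> 0" using ex_form_prod_nonzero by blast
  then have "bracket (F1 x0) (F2 x0) (F3 x0) \<noteq> 0" by (simp add: det_basis c_nonzero)
  then have "F1 \<noteq> F2" "F1 \<noteq> F3" "F2 \<noteq> F3" using bracket_same by metis+
  then have distinct: "\<theta>1 \<noteq> \<theta>2" "\<theta>1 \<noteq> \<theta>3" "\<theta>2 \<noteq> \<theta>3" by (auto simp: \<theta>)
  have indep: "\<not> m.dependent ?B"
    unfolding m.dependent_finite[OF finite.intros(2)[OF finite.intros(2)[OF finite.intros(2)[OF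
        finite.emptyI]]]]
  proof (intro notI, elim exE conjE)
    fix u assume u: "\<exists>v\<in>?B. u v \<noteq> 0" "(\<Sum>v\<in>?B. u v *s v) = 0"
    define k where "k \<theta> x = mpoly_eval (u \<theta>) (\<lambda>j. x $ j)" for \<theta> and x :: "'a ^ 3"
    have "eval_map (\<Sum>v\<in>?B. u v *s v) x = 0" for x by (simp add: u(2) eval_map_0)
    then have z: "k \<theta>1 x *s F1 x + k \<theta>2 x *s F2 x + k \<theta>3 x *s F3 x = 0" for x
      using distinct by (simp add: eval_map_sum eval_map_add eval_map_scale k_def \<theta> add.assoc)
    have pk: "pfun (k \<theta>)" for \<theta> unfolding k_def[abs_def] by (rule polyfn_mpoly)
    have "c * k \<theta>1 x = 0" "c * k \<theta>2 x = 0" "c * k \<theta>3 x = 0" for x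
    proof -
      \<comment> \<open>Placed in one slot of the determinant, the relation keeps only the
        coefficient belonging to that slot.\<close>
      have "bracket (k \<theta>1 x *s F1 x + k \<theta>2 x *s F2 x + k \<theta>3 x *s F3 x) (F2 x) (F3 x) = 0"
        "bracket (F1 x) (k \<theta>1 x *s F1 x + k \<theta>2 x *s F2 x + k \<theta>3 x *s F3 x) (F3 x) = 0"
        "bracket (F1 x) (F2 x) (k \<theta>1 x *s F1 x + k \<theta>2 x *s F2 x + k \<theta>3 x *s F3 x) = 0" for x
        by (simp_all add: z bracket_0)
      then have "k \<theta>1 x * bracket (F1 x) (F2 x) (F3 x) = 0"
          "k \<theta>2 x * bracket (F1 x) (F2 x) (F3 x) = 0"
        "k \<theta>3 x * bracket (F1 x) (F2 x) (F3 x) = 0" for x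
        unfolding bracket_add bracket_scale bracket_same by simp_all
      then have "(\<Prod>i\<in>I. dotp (a i) x) * (c * k \<theta>1 x) = 0" "(\<Prod>i\<in>I. dotp (a i) x) * (c * k \<theta>2 x) = 0"
        "(\<Prod>i\<in>I. dotp (a i) x) * (c * k \<theta>3 x) = 0" for x
        unfolding det_basis by (simp_all only: mult_ac)
      note q = this
      show "c * k \<theta>1 x = 0" "c * k \<theta>2 x = 0" "c * k \<theta>3 x = 0"
        by (rule form_prod_cancel[OF polyfn_mult[OF polyfn_const pk]], rule q)+
    qed
    then have "k \<theta>1 x = 0" "k \<theta>2 x = 0" "k \<theta>3 x = 0" for x
      using c_nonzero by auto
    then have "u \<theta>1 = 0" "u \<theta>2 = 0" "u \<theta>3 = 0"
      unfolding mpoly_eval_eq_iff by (simp_all flip: k_def)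
    then show False using u(1) by auto
  qed
  have "m.span ?B = derivation_module planes"
  proof
    have "m.subspace (derivation_module planes)"
      unfolding m.subspace_def
      by (auto simp: mem_derivation_module preserves_iff eval_map_0 eval_map_add eval_map_scale
          dotp_0 dotp_add dotp_scale)
    moreover have "?B \<subseteq> derivation_module planes"
      using preserves_basis by (simp add: mem_derivation_module \<theta>)
    ultimately show "m.span ?B \<subseteq> derivation_module planes"
      by (metis m.span_minimal)
  next
    show "derivation_module planes \<subseteq> m.span ?B"
    proof
      fix \<eta> assume "\<eta> \<in> derivation_module planes"
      then have "preserves planes (eval_map \<eta>)" by (simp add: mem_derivation_module)
      then obtain h1 h2 h3 where h: "pfun h1" "pfun h2" "pfun h3"
          "\<And>x. eval_map \<eta> x = h1 x *s F1 x + h2 x *s F2 x + h3 x *s F3 x"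
        using basis_expansion[OF pmap_eval_map] by metis
      obtain k1 k2 k3 where k: "h1 = (\<lambda>x. mpoly_eval k1 (\<lambda>j. x $ j))"
          "h2 = (\<lambda>x. mpoly_eval k2 (\<lambda>j. x $ j))" "h3 = (\<lambda>x. mpoly_eval k3 (\<lambda>j. x $ j))"
        using h(1-3) by (auto simp: polyfn_iff_mpoly)
      have "eval_map \<eta> = eval_map (k1 *s \<theta>1 + k2 *s \<theta>2 + k3 *s \<theta>3)"
        by (rule ext) (simp add: h(4) k eval_map_add eval_map_scale \<theta>)
      then have "\<eta> = k1 *s \<theta>1 + k2 *s \<theta>2 + k3 *s \<theta>3" by (simp add: eval_map_eq_iff)
      then show "\<eta> \<in> m.span ?B"
        by (auto intro!: m.span_add m.span_scale intro: m.span_base)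
    qed
  qed
  then show ?thesis unfolding free_arrangement_def using indep by blast
qed

end

section \<open>Deletions of free arrangements\<close>

text \<open>Multiplicativity of the determinant, one factor being given by coefficient vectors; used
  for transition matrices between bases and for changes of coordinates.\<close>

lemma bracket_linear_combination:
  "bracket (r $ 1 *s u + r $ 2 *s v + r $ 3 *s w) (s $ 1 *s u + s $ 2 *s v + s $ 3 *s w)
     (t $ 1 *s u + t $ 2 *s v + t $ 3 *s w) = bracket r s t * bracket u v w"
proof -
  have "bracket v u w = - bracket u v w" "bracket u w v = - bracket u v w"
    "bracket v w u = bracket u v w" "bracket w u v = bracket u v w"
        "bracket w v u = - bracket u v w"
    by (simp_all add: bracket_def algebra_simps)
  then show ?thesis
    unfolding bracket_add bracket_scale bracket_same
    by (simp add: bracket_def[of r s t] algebra_simps)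
qed

context plane_family
begin

lemma preserves_sum:
  "(\<And>k. k \<in> K \<Longrightarrow> preserves planes (F k)) \<Longrightarrow> preserves planes (\<lambda>x. \<Sum>k\<in>K. F k x)"
  by (auto simp: preserves_iff dotp_sum)

lemma preserves_ident: "preserves planes (\<lambda>x. x)"
  by (simp add: preserves_iff)

lemma preserves_form_prod: "preserves planes (\<lambda>x. (\<Prod>i\<in>I. dotp (a i) x) *s v)"
  using finite_index by (auto simp: preserves_iff dotp_scale)

text \<open>Freeness only provides some set \<open>B\<close>, of unknown size and not homogeneous.
  At a point off all planes the values of derivations span the whole space, because the product of
  the forms times any \<open>v\<close> is a derivation; hence three members of \<open>B\<close> have
  independent values, and Cramer's rule makes any fourth dependent on them.\<close>

lemma free_obtain_basis:
  assumes "free_arrangement planes"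
  obtains b1 b2 b3 where "pmap b1" "pmap b2" "pmap b3"
    "preserves planes b1" "preserves planes b2" "preserves planes b3"
    "\<And>F. pmap F \<Longrightarrow> preserves planes F \<Longrightarrow>
       \<exists>r :: 'a ^ 3 \<Rightarrow> 'a ^ 3. pmap r \<and> (\<forall>x. F x = r x $ 1 *s b1 x + r x $ 2 *s b2 x + r x $ 3 *s
           b3 x)"
proof -
  interpret m: module "(*s) :: (3, 'a) mpoly \<Rightarrow> (3, 'a) mpoly ^ 3 \<Rightarrow> _" by (rule module_vec)
  obtain B where B: "\<not> m.dependent B" "m.span B = derivation_module planes"
    using assms unfolding free_arrangement_def by blast
  define Q where "Q x = (\<Prod>i\<in>I. dotp (a i) x)" for x
  obtain x0 where x0: "Q x0 \<noteq> 0" using ex_form_prod_nonzero by (auto simp: Q_def)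
  have mem: "\<exists>\<eta>\<in>m.span B. eval_map \<eta> = F" if "pmap F" "preserves planes F" for F
    using that ex_eval_map[OF that(1)] by (metis B(2) mem_derivation_module)
  \<comment> \<open>If a nonzero linear functional \<open>l\<close> killed all values of
    \<open>B\<close> at \<open>x0\<close>, it would kill those of the span, in particular
    \<open>Q x0 *s v\<close>.\<close>
  have choose: "\<exists>b\<in>B. l (eval_map b x0) \<noteq> 0"
    if l: "\<And>u v. l (u + v) = l u + l v" "\<And>s u. l (s *s u) = s * l u" "l v \<noteq> (0 :: 'a)" for l v
  proof (rule ccontr)
    assume neg: "\<not> ?thesis"
    have l0: "l 0 = 0" using l(2)[of 0 0] by simp
    have "m.subspace {\<theta>. l (eval_map \<theta> x0) = 0}"
      unfolding m.subspace_def by (simp add: eval_map_0 eval_map_add eval_map_scale l l0)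
    then have "m.span B \<subseteq> {\<theta>. l (eval_map \<theta> x0) = 0}"
      using neg by (intro m.span_minimal) auto
    moreover obtain \<eta> where "\<eta> \<in> m.span B" "eval_map \<eta> = (\<lambda>x. Q x *s v)"
      using mem[of "\<lambda>x. Q x *s v"] pmap_scale[OF pfun_prod_dotp pmap_const] preserves_form_prod
      unfolding Q_def by blast
    ultimately show False using x0 l by auto
  qed
  obtain b1 where b1: "b1 \<in> B" "bracket (eval_map b1 x0) (axis 2 1) (axis 3 1) \<noteq> 0"
    using choose[of "\<lambda>u. bracket u (axis 2 1) (axis 3 1)" "axis 1 1"]
    by (auto simp: bracket_add bracket_scale) (auto simp: bracket_def axis_def)
  obtain v2 where v2: "bracket (eval_map b1 x0) v2 (axis 3 1) \<noteq> 0" using b1(2) by blast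
  obtain b2 where b2: "b2 \<in> B" "bracket (eval_map b1 x0) (eval_map b2 x0) (axis 3 1) \<noteq> 0"
    using choose[of "\<lambda>u. bracket (eval_map b1 x0) u (axis 3 1)", OF _ _ v2]
    by (auto simp: bracket_add bracket_scale)
  obtain b3 where b3: "b3 \<in> B" "bracket (eval_map b1 x0) (eval_map b2 x0) (eval_map b3 x0) \<noteq> 0"
    using choose[of "bracket (eval_map b1 x0) (eval_map b2 x0)", OF _ _ b2(2)]
    by (auto simp: bracket_add bracket_scale)
  have dist: "b1 \<noteq> b2" "b1 \<noteq> b3" "b2 \<noteq> b3"
    using b3(2) by (auto simp: bracket_same)
  have eq: "B = {b1, b2, b3}"
  proof (rule ccontr)
    assume "B \<noteq> {b1, b2, b3}"
    then obtain b where b: "b \<in> B" "b \<noteq> b1" "b \<noteq> b2" "b \<noteq> b3" using b1 b2 b3 by blast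
    have "\<exists>p. \<forall>x. mpoly_eval p (\<lambda>j. x $ j) = bracket (eval_map \<alpha> x) (eval_map \<beta> x) (eval_map \<gamma> x)"
      for \<alpha> \<beta> \<gamma> :: "(3, 'a) mpoly ^ 3"
      using pfun_bracket[OF pmap_eval_map pmap_eval_map pmap_eval_map, of \<alpha> \<beta> \<gamma>]
      unfolding polyfn_iff_mpoly by (metis (no_types))
    then obtain D where D: "\<And>\<alpha> \<beta> \<gamma> x. mpoly_eval (D \<alpha> \<beta> \<gamma>) (\<lambda>j. x $ j) =
        bracket (eval_map \<alpha> x) (eval_map \<beta> x) (eval_map \<gamma> (x :: 'a ^ 3))"
      by metis
    \<comment> \<open>Cramer's rule with determinants as polynomial coefficients; the coefficient of
      \<open>b\<close> is nonzero at \<open>x0\<close>, so the dependence is genuine.\<close>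
    have "eval_map (D b1 b2 b3 *s b) =
        eval_map (D b b2 b3 *s b1 + D b1 b b3 *s b2 + D b1 b2 b *s b3)"
      by (rule ext) (simp add: eval_map_add eval_map_scale D bracket_cramer[symmetric])
    then have rel: "D b1 b2 b3 *s b = D b b2 b3 *s b1 + D b1 b b3 *s b2 + D b1 b2 b *s b3"
      by (simp add: eval_map_eq_iff)
    define u where "u v = (if v = b then D b1 b2 b3 else if v = b1 then - D b b2 b3
        else if v = b2 then - D b1 b b3 else - D b1 b2 b)" for v
    have "(\<Sum>v\<in>{b, b1, b2, b3}. u v *s v) = 0"
      using b dist by (simp add: u_def rel m.scale_minus_left)
    moreover have "u b \<noteq> 0" using b3(2) D[of b1 b2 b3 x0] by (auto simp: u_def)
    ultimately have "m.dependent B"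
      unfolding m.dependent_explicit
      by (intro exI[of _ "{b, b1, b2, b3}"] exI[of _ u]) (use b b1 b2 b3 in auto)
    then show False using B(1) by simp
  qed
  show thesis
  proof (rule that[of "eval_map b1" "eval_map b2" "eval_map b3"])
    have "b \<in> derivation_module planes" if "b \<in> B" for b
      using m.span_base[OF that] B(2) by simp
    then show "preserves planes (eval_map b1)" "preserves planes (eval_map b2)"
      "preserves planes (eval_map b3)"
      using b1(1) b2(1) b3(1) by (simp_all flip: mem_derivation_module)
    fix F assume "pmap F" "preserves planes F"
    then obtain \<eta> where \<eta>: "\<eta> \<in> m.span B" "eval_map \<eta> = F" using mem by blast
    then obtain k1 k2 k3 where "\<eta> - k1 *s b1 - k2 *s b2 - k3 *s b3 = 0"
      unfolding eq m.span_insert m.span_empty by auto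
    then have \<eta>': "\<eta> = k1 *s b1 + k2 *s b2 + k3 *s b3" by (simp add: algebra_simps)
    show "\<exists>r :: 'a ^ 3 \<Rightarrow> 'a ^ 3. pmap r \<and> (\<forall>x. F x = r x $ 1 *s eval_map b1 x + r x $ 2 *s
        eval_map b2 x +
        r x $ 3 *s eval_map b3 x)"
      by (rule exI[of _ "eval_map (vector [k1, k2, k3])"])
        (simp add: pmap_eval_map eval_map_add eval_map_scale \<eta>' flip: \<eta>(2),
         simp add: eval_map_def)
  qed (rule pmap_eval_map)+
qed

text \<open>Along the ray through a point of a plane, the form of that plane applied to the sum is a
  polynomial in \<open>s\<close> whose coefficients are its values on the components; it vanishes
  for all \<open>s\<close>.\<close>

lemma preserves_components:
  assumes "preserves planes (\<lambda>x. \<Sum>k<N. G k x)" "\<And>k. homog_map k (G k)" "k < (N :: nat)"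
  shows "preserves planes (G k)"
  unfolding preserves_iff
proof (intro ballI allI impI)
  fix i x assume i: "i \<in> I" "dotp (a i) x = 0"
  define P where "P = (\<Sum>k<N. monom (dotp (a i) (G k x)) k)"
  have "poly P s = 0" for s
  proof -
    have "dotp (a i) (s *s x) = 0" using i by (simp add: dotp_scale)
    then have "dotp (a i) (\<Sum>k<N. G k (s *s x)) = 0"
      using assms(1) i(1) by (auto simp: preserves_iff)
    then show ?thesis
      using assms(2)
          by (simp add: P_def poly_sum poly_monom dotp_sum homog_map_def dotp_scale mult.commute)
  qed
  then have "P = 0" using poly_eq_0_of_values by blast
  then have "coeff P k = 0" by simp
  then show "dotp (a i) (G k x) = 0"
    using assms(3) by (simp add: P_def coeff_sum)
qed

end

locale homogeneous_basis = plane_family I a for I :: "'i set" and a :: "'i \<Rightarrow> 'a::field_char_0 ^ 3" +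
  fixes F G :: "'a ^ 3 \<Rightarrow> 'a ^ 3" and e :: nat
  assumes pmap_FG: "pmap F" "pmap G"
    and homog_FG: "homog_map e F" "homog_map e G"
    and preserves_FG: "preserves planes F" "preserves planes G"
    and card_index: "card I = 2 * e + 1" and e_pos: "e > 0"
    and det_nonzero: "\<exists>x. bracket x (F x) (G x) \<noteq> 0"
begin

lemma det_homogeneous: "bracket (s *s x) (F (s *s x)) (G (s *s x)) = s ^ (2 * e + 1) * bracket x
    (F x) (G x)"
  using homog_FG by (simp add: homog_map_def bracket_scale power_add mult_2)

lemma form_prod_homogeneous:
  "(\<Prod>i\<in>I. dotp (a i) (s *s x)) = s ^ (2 * e + 1) * (\<Prod>i\<in>I. dotp (a i) x)"
  by (simp add: dotp_scale prod.distrib card_index)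

text \<open>The determinant and the product of the forms have the same degree.\<close>

lemma saito: obtains c where "saito_basis I a (\<lambda>x. x) F G c"
proof -
  let ?Q = "\<lambda>x. \<Prod>i\<in>I. dotp (a i) x"
  obtain h where h: "pfun h" "\<And>x. bracket x (F x) (G x) = ?Q x * h x"
    using bracket_divisible[OF pmap_id pmap_FG preserves_ident preserves_FG] by blast
  \<comment> \<open>Where the product is nonzero, it and the determinant scale by the same power of
    \<open>s\<close>, so \<open>h\<close> is constant along the ray; the factor \<open>?Q x\<close>
    covers the other points and is cancelled afterwards.\<close>
  have "?Q x * (h x - h 0) = 0" for x
  proof (cases "?Q x = 0")
    case False
    obtain p where p: "\<And>s. h (s *s x) = poly p s" using pfun_ray[OF h(1)] by blast
    have "poly (p - [:h x:]) s = 0" if "s \<noteq> 0" for s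
      using det_homogeneous[of s x] that False
      unfolding h form_prod_homogeneous p by simp
    then have "p = [:h x:]" using poly_eq_0_of_values[of 0 "p - [:h x:]"] by simp
    then have "h 0 = h x" using p[of 0] by simp
    then show ?thesis by simp
  qed simp
  then have "h x - h 0 = 0" for x
    by (intro form_prod_cancel[OF polyfn_diff[OF h(1) polyfn_const]])
  then have det: "bracket x (F x) (G x) = h 0 * ?Q x" for x
    using h(2)[of x] by simp
  moreover have "h 0 \<noteq> 0" using det_nonzero det by auto
  ultimately have "saito_basis I a (\<lambda>x. x) F G (h 0)"
    by unfold_locales (simp_all add: pmap_id pmap_FG preserves_ident preserves_FG)
  then show thesis by (rule that)
qed

lemma free: "free_arrangement planes"
  using saito saito_basis.free by metis

text \<open>Components of degree below \<open>e\<close> preserve all planes by \<open>low\<close>,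
  hence expand in \<open>x\<close>, \<open>F x\<close>, \<open>G x\<close>. Since \<open>F\<close>
  and \<open>G\<close> have degree \<open>e\<close>, only the multiple of \<open>x\<close> can have
  order less than \<open>e\<close> along the ray.\<close>

lemma low_order_split:
  assumes i: "i \<in> I" and b: "pmap b" "preserves (planes - {kernel_plane (a i)}) b"
    and low: "\<And>d H. d < e \<Longrightarrow> pmap H \<Longrightarrow> homog_map d H \<Longrightarrow>
      preserves (planes - {kernel_plane (a i)}) H \<Longrightarrow> preserves planes H"
  shows "\<exists>p r. \<forall>s. b (s *s x) = (poly p s * s) *s x + s ^ e *s (\<chi> j. poly (r $ j) s)"
proof -
  obtain c where "saito_basis I a (\<lambda>x. x) F G c" by (rule saito)
  then interpret saito_basis I a "\<lambda>x. x" F G c .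
  interpret J: plane_family "I - {i}" a
    by unfold_locales (use finite_index form_nonzero inj_plane in \<open>auto simp: inj_on_def\<close>)
  have Jp: "J.planes = planes - {kernel_plane (a i)}"
    using i inj_plane by (auto simp: planes_def J.planes_def inj_on_def)
  obtain N C where C: "\<And>k. pmap (C k)" "\<And>k. homog_map k (C k)" "\<And>x. b x = (\<Sum>k<N. C k x)"
    by (rule pmap_homogeneous_components[OF b(1)]) (rule that)
  have b': "b = (\<lambda>x. \<Sum>k<N. C k x)" using C(3) by (rule ext)
  have "preserves planes (C k)" if "k < N" "k < e" for k
    using J.preserves_components[where N = N and G = C and k = k] b(2) C that unfolding Jp b'
        by (intro low) auto
  then have low_pres: "preserves planes (\<lambda>x. \<Sum>k\<in>{..<N} \<inter> {..<e}. C k x)"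
    by (intro preserves_sum) auto
  obtain h1 h2 h3 where h: "pfun h1" "pfun h2" "pfun h3"
    "\<And>x. (\<Sum>k\<in>{..<N} \<inter> {..<e}. C k x) = h1 x *s x + h2 x *s F x + h3 x *s G x"
    using basis_expansion[OF pmap_sum low_pres] C(1) by metis
  obtain p1 p2 p3 where p: "\<And>s. h1 (s *s x) = poly p1 s" "\<And>s. h2 (s *s x) = poly p2 s"
    "\<And>s. h3 (s *s x) = poly p3 s"
    using pfun_ray h(1-3) by metis
  \<comment> \<open>Everything of order at least \<open>e\<close>: the contributions of
    \<open>F\<close> and \<open>G\<close>, and the components of degree \<open>e\<close> and
    more.\<close>
  define r :: "'a poly ^ 3" where "r = (\<chi> j. p2 * [:F x $ j:] + p3 * [:G x $ j:] +
      (\<Sum>k\<in>{..<N} - {..<e}. monom (C k x $ j) (k - e)))"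
  have "b (s *s x) = (poly p1 s * s) *s x + s ^ e *s (\<chi> j. poly (r $ j) s)" for s
  proof -
    have "b (s *s x) = (\<Sum>k\<in>{..<N} \<inter> {..<e}. C k (s *s x)) + (\<Sum>k\<in>{..<N} - {..<e}. C k (s *s x))"
      unfolding C(3) by (subst sum.union_disjoint[symmetric]) (auto intro!: sum.cong)
    also have "(\<Sum>k\<in>{..<N} - {..<e}. C k (s *s x)) =
        s ^ e *s (\<Sum>k\<in>{..<N} - {..<e}. s ^ (k - e) *s C k x)"
      unfolding vec.scale_sum_right
    proof (rule sum.cong)
      fix k assume "k \<in> {..<N} - {..<e}"
      then have "k = e + (k - e)" by auto
      then have "s ^ k = s ^ e * s ^ (k - e)" by (metis power_add)
      then show "C k (s *s x) = s ^ e *s (s ^ (k - e) *s C k x)"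
        using C(2)[of k] by (simp add: homog_map_def)
    qed simp
    also have "(\<Sum>k\<in>{..<N} \<inter> {..<e}. C k (s *s x)) =
        poly p1 s *s (s *s x) + poly p2 s *s (s ^ e *s F x) + poly p3 s *s (s ^ e *s G x)"
      unfolding h(4) p using homog_FG by (simp add: homog_map_def)
    finally show ?thesis
      by (simp add: vec_eq_iff r_def poly_sum poly_monom sum_distrib_left algebra_simps)
  qed
  then show ?thesis by blast
qed

text \<open>Along the ray through a point \<open>x\<close> every derivation of the deletion is a multiple of \<open>x\<close> up to
  order \<open>e\<close>, so the determinant of three of them vanishes to order \<open>2 e + 1\<close>; but for a basis it
  would be a product of \<open>2 e\<close> linear forms.\<close>

theorem deletion_not_free:
  assumes i: "i \<in> I"
    and low: "\<And>d H. d < e \<Longrightarrow> pmap H \<Longrightarrow> homog_map d H \<Longrightarrow>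
      preserves (planes - {kernel_plane (a i)}) H \<Longrightarrow> preserves planes H"
  shows "\<not> free_arrangement (planes - {kernel_plane (a i)})"
proof
  interpret J: plane_family "I - {i}" a
    by unfold_locales (use finite_index form_nonzero inj_plane in \<open>auto simp: inj_on_def\<close>)
  have Jp: "J.planes = planes - {kernel_plane (a i)}"
    using i inj_plane by (auto simp: planes_def J.planes_def inj_on_def)
  assume "free_arrangement (planes - {kernel_plane (a i)})"
  then have free: "free_arrangement J.planes" by (simp only: Jp)
  obtain b1 b2 b3 where b: "pmap b1" "pmap b2" "pmap b3"
    "preserves J.planes b1" "preserves J.planes b2" "preserves J.planes b3"
    and exp: "\<And>F. pmap F \<Longrightarrow> preserves J.planes F \<Longrightarrow>
       \<exists>r :: 'a ^ 3 \<Rightarrow> 'a ^ 3. pmap r \<and> (\<forall>x. F x = r x $ 1 *s b1 x + r x $ 2 *s b2 x + r x $ 3 *s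
           b3 x)"
    by (rule J.free_obtain_basis[OF free]) (rule that)
  have sub: "preserves J.planes H" if "preserves planes H" for H
    using that by (auto simp: preserves_def Jp)
  obtain R1 R2 R3 :: "'a ^ 3 \<Rightarrow> 'a ^ 3" where R: "pmap R1" "pmap R2" "pmap R3"
    and idR: "\<And>x. x = R1 x $ 1 *s b1 x + R1 x $ 2 *s b2 x + R1 x $ 3 *s b3 x"
    and FR: "\<And>x. F x = R2 x $ 1 *s b1 x + R2 x $ 2 *s b2 x + R2 x $ 3 *s b3 x"
    and GR: "\<And>x. G x = R3 x $ 1 *s b1 x + R3 x $ 2 *s b2 x + R3 x $ 3 *s b3 x"
    using exp[OF pmap_id sub[OF preserves_ident]] exp[OF pmap_FG(1) sub[OF preserves_FG(1)]]
      exp[OF pmap_FG(2) sub[OF preserves_FG(2)]] by metis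
  \<comment> \<open>The determinant of the transition matrix from \<open>b1\<close>,
    \<open>b2\<close>, \<open>b3\<close> to \<open>x\<close>, \<open>F x\<close>,
    \<open>G x\<close>. It takes the place of the missing form of plane \<open>i\<close>; the
    contradiction comes from its zero at the origin.\<close>
  define m where "m x = bracket (R1 x) (R2 x) (R3 x)" for x
  have pm: "pfun m" unfolding m_def[abs_def] by (rule pfun_bracket[OF R])
  have det: "bracket x (F x) (G x) = m x * bracket (b1 x) (b2 x) (b3 x)" for x
    unfolding m_def bracket_linear_combination[symmetric] idR[symmetric] FR[symmetric]
      GR[symmetric] by (rule refl)
  let ?QJ = "\<lambda>x. \<Prod>j\<in>I - {i}. dotp (a j) x"
  \<comment> \<open>A regular transition matrix would put \<open>b1 x\<close>, \<open>b2 x\<close>,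
    \<open>b3 x\<close> into plane \<open>i\<close>, since \<open>x\<close>, \<open>F x\<close>,
    \<open>G x\<close> lie there; but the deletion has a derivation with value
    \<open>?QJ x *s v\<close>, which is outside this plane.\<close>
  have m0: "m x = 0" if x: "dotp (a i) x = 0" "?QJ x \<noteq> 0" for x
  proof (rule ccontr)
    assume "m x \<noteq> 0"
    define w :: "'a ^ 3"
        where "w = vector [dotp (a i) (b1 x), dotp (a i) (b2 x), dotp (a i) (b3 x)]"
    have w: "dotp w r = dotp (a i) (r $ 1 *s b1 x + r $ 2 *s b2 x + r $ 3 *s b3 x)" for r
      by (simp add: w_def dotp_3[of "vector _"] dotp_add dotp_scale)
    have "dotp (a i) (F x) = 0" "dotp (a i) (G x) = 0"
      using preserves_FG i x(1) by (auto simp: preserves_iff)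
    then have "dotp w (R1 x) = 0" "dotp w (R2 x) = 0" "dotp w (R3 x) = 0"
      unfolding w using x(1) by (simp_all flip: idR FR GR)
    then have "w = 0"
      using bracket_eq_0_of_plane \<open>m x \<noteq> 0\<close> unfolding m_def by blast
    obtain v where v: "dotp (a i) v = 1" using ex_dotp_eq_1[OF form_nonzero[OF i]] .
    obtain r :: "'a ^ 3" where "?QJ x *s v = r $ 1 *s b1 x + r $ 2 *s b2 x + r $ 3 *s b3 x"
      using exp[OF pmap_scale[OF pfun_prod_dotp pmap_const] J.preserves_form_prod, of v] by blast
    then have "dotp (a i) (?QJ x *s v) = dotp w r" by (simp only: w)
    then show False using \<open>w = 0\<close> v x(2) by (simp add: dotp_scale dotp_0)
  qed
  have "m 0 = 0"
  proof -
    have "\<not> kernel_plane (a i) \<subseteq> kernel_plane (a j)" if "j \<in> I - {i}" for j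
      using that i form_nonzero inj_plane kernel_plane_subset_imp_eq[of "a j" "a i"]
      by (auto simp: inj_on_def)
    moreover have "0 \<in> kernel_plane (a i)" by (simp add: mem_kernel_plane dotp_0)
    ultimately obtain h where h: "h \<in> kernel_plane (a i)" "?QJ h \<noteq> 0"
      using prod_dotp_not_vanishing_on[OF _ affine_set_subspace[OF subspace_kernel_plane], of "I -
          {i}" "a i" a]
        finite_index by blast
    obtain p where p: "\<And>s. m (s *s h) = poly p s" using pfun_ray[OF pm] by blast
    have "poly p s = 0" if "s \<noteq> 0" for s
      unfolding p[symmetric]
      by (rule m0) (use h that finite_index in \<open>auto simp: mem_kernel_plane dotp_scale\<close>)
    then have "p = 0" by (rule poly_eq_0_of_values)
    then show ?thesis using p[of 0] by simp
  qed
  obtain x where x: "bracket x (F x) (G x) \<noteq> 0" using det_nonzero by blast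
  have split: "\<exists>p r. \<forall>s. f (s *s x) = (poly p s * s) *s x + s ^ e *s (\<chi> j. poly (r $ j) s)"
    if "pmap f" "preserves J.planes f" for f
    by (rule low_order_split[OF i that(1) that(2)[unfolded Jp] low])
  obtain p1 r1 where 1: "\<And>s. b1 (s *s x) = (poly p1 s * s) *s x + s ^ e *s (\<chi> j. poly (r1 $ j) s)"
    using split[OF b(1,4)] by blast
  obtain p2 r2 where 2: "\<And>s. b2 (s *s x) = (poly p2 s * s) *s x + s ^ e *s (\<chi> j. poly (r2 $ j) s)"
    using split[OF b(2,5)] by blast
  obtain p3 r3 where 3: "\<And>s. b3 (s *s x) = (poly p3 s * s) *s x + s ^ e *s (\<chi> j. poly (r3 $ j) s)"
    using split[OF b(3,6)] by blast
  define X :: "'a poly ^ 3" where "X = (\<chi> j. [:x $ j:])"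
  \<comment> \<open>The factor left after taking out \<open>s ^ (2 * e + 1)\<close>: products with
    two copies of \<open>x\<close> vanish, one copy gives order \<open>1 + 2 * e\<close>, none gives
    \<open>3 * e = (2 * e + 1) + (e - 1)\<close>, which needs \<open>e_pos\<close>.\<close>
  define P where "P = monom 1 (e - 1) * bracket r1 r2 r3 + p1 * bracket X r2 r3 +
     p2 * bracket r1 X r3 + p3 * bracket r1 r2 X"
  have ev: "poly (bracket u v w) s =
      bracket (\<chi> j. poly (u $ j) s) (\<chi> j. poly (v $ j) s) (\<chi> j. poly (w $ j) s)"
    for u v w :: "'a poly ^ 3" and s by (simp add: bracket_def)
  have "bracket (b1 (s *s x)) (b2 (s *s x)) (b3 (s *s x)) = s ^ (2 * e + 1) * poly P s" for s
  proof -
    have se: "s ^ e = s * s ^ (e - 1)" using e_pos by (simp flip: power_Suc)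
    have "(\<chi> j. poly (X $ j) s) = x" by (simp add: X_def vec_eq_iff)
    then show ?thesis
      unfolding 1 2 3 P_def bracket_add bracket_scale bracket_same
      by (simp add: ev poly_monom power_add mult_2) (simp add: se algebra_simps)
  qed
  moreover obtain q where q: "\<And>s. m (s *s x) = poly q s" using pfun_ray[OF pm] by blast
  ultimately have key: "s ^ (2 * e + 1) * bracket x (F x) (G x) = poly q s * (s ^ (2 * e + 1) *
      poly P s)" for s
    using det[of "s *s x"] det_homogeneous[of s x] by simp
  \<comment> \<open>Cancelling \<open>s ^ (2 * e + 1)\<close> makes \<open>q * P\<close> a nonzero
    constant, although \<open>q\<close> has the root 0.\<close>
  have "poly (q * P - [:bracket x (F x) (G x):]) s = 0" if "s \<noteq> 0" for s
    using key[of s] that by (simp add: mult.left_commute)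
  then have "q * P - [:bracket x (F x) (G x):] = 0" by (rule poly_eq_0_of_values)
  then have "poly (q * P - [:bracket x (F x) (G x):]) 0 = 0" by simp
  moreover have "poly q 0 = 0" using q[of 0] \<open>m 0 = 0\<close> by simp
  ultimately show False using x by simp
qed

end

section \<open>Arrangements with prescribed concurrences\<close>

definition realizes :: "nat set \<Rightarrow> nat set set \<Rightarrow> (nat \<Rightarrow> 'a::comm_ring_1 ^ 3) \<Rightarrow> bool" where
  "realizes I \<B> a \<longleftrightarrow> (\<forall>i\<in>I. \<forall>j\<in>I. \<forall>k\<in>I. i \<noteq> j \<and> i \<noteq> k \<and> j \<noteq> k \<longrightarrow>
     (bracket (a i) (a j) (a k) = 0 \<longleftrightarrow> (\<exists>b\<in>\<B>. {i, j, k} \<subseteq> b)))"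

definition cross :: "'a::comm_ring_1 ^ 3 \<Rightarrow> 'a ^ 3 \<Rightarrow> 'a ^ 3" where
  "cross b c = vector [b $ 2 * c $ 3 - b $ 3 * c $ 2, b $ 3 * c $ 1 - b $ 1 * c $ 3,
     b $ 1 * c $ 2 - b $ 2 * c $ 1]"

lemma dotp_cross: "dotp a (cross b c) = bracket a b c"
  by (simp add: bracket_def dotp_3 cross_def algebra_simps)

lemma dotp_commute: "dotp a b = dotp b a"
  by (simp add: dotp_3 mult.commute)

lemma dotp_cross_left: "dotp (cross b c) a = bracket a b c"
  by (simp add: dotp_commute[of "cross b c"] dotp_cross)

lemma cross_cross: "cross a (cross b c) = dotp a c *s b - dotp a b *s c"
  unfolding vec_eq_iff forall_3 by (simp add: cross_def dotp_3 algebra_simps)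

lemma cross_0: "cross a 0 = 0" "cross 0 a = 0"
  unfolding vec_eq_iff forall_3 by (simp_all add: cross_def)

lemma plane_intersection:
  fixes a b :: "'a::field ^ 3"
  assumes "cross a b \<noteq> 0" "dotp a x = 0" "dotp b x = 0"
  obtains c where "x = c *s cross a b"
proof -
  obtain w where w: "dotp (cross a b) w = 1" using ex_dotp_eq_1[OF assms(1)] .
  then have "bracket w a b = 1" by (simp add: dotp_cross_left)
  have "cross x (cross a b) = 0"
    using assms by (simp add: cross_cross dotp_commute[of x])
  then have "cross w (cross x (cross a b)) = 0" by (simp add: cross_0)
  then have "dotp w (cross a b) *s x = dotp w x *s cross a b"
    unfolding cross_cross[of w] by simp
  then show thesis using w that by (simp add: dotp_commute[of w])
qed

lemma cross_eq_0_if_bracket: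
  "cross a b = 0 \<Longrightarrow> bracket a b c = 0"
  using dotp_cross[of c a b] by (simp add: dotp_0 bracket_def algebra_simps)

text \<open>A simple matroid of rank three, given by its lines with at least three points; here
  points are planes and a block is a line common to three or more of them. \<open>off_block\<close>
  gives every pair a third plane not through its common line, which later makes the forms nonzero
  and the planes distinct.\<close>

locale block_system =
  fixes I :: "nat set" and \<B> :: "nat set set"
  assumes finite_points: "finite I"
    and block_subset: "b \<in> \<B> \<Longrightarrow> b \<subseteq> I"
    and block_card: "b \<in> \<B> \<Longrightarrow> 3 \<le> card b"
    and block_eqI: "b \<in> \<B> \<Longrightarrow> b' \<in> \<B> \<Longrightarrow> i \<in> b \<Longrightarrow> j \<in> b \<Longrightarrow> i \<in> b' \<Longrightarrow> j \<in> b' \<Longrightarrow> i \<noteq> j \<Longrightarrow> b = b'"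
    and off_block: "i \<in> I \<Longrightarrow> j \<in> I \<Longrightarrow> i \<noteq> j \<Longrightarrow> \<exists>k\<in>I. k \<noteq> i \<and> k \<noteq> j \<and> (\<forall>b\<in>\<B>. \<not> {i, j, k} \<subseteq> b)"
    and two_points: "\<exists>i\<in>I. \<exists>j\<in>I. i \<noteq> j"
begin

lemma finite_blocks: "finite \<B>"
  using finite_points block_subset by (meson Pow_iff finite_Pow_iff finite_subset subsetI)

lemma block_two_points:
  assumes "b \<in> \<B>"
  obtains i j where "i \<in> b" "j \<in> b" "i \<noteq> j"
proof -
  have "\<not> card b \<le> 1" using block_card[OF assms] by simp
  moreover have "finite b" using finite_points block_subset[OF assms] finite_subset by blast
  ultimately show thesis using that card_le_Suc0_iff_eq[of b] by auto
qed

lemma block_other_point: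
  assumes "b \<in> \<B>"
  obtains j where "j \<in> b" "j \<noteq> i"
  using block_two_points[OF assms] by metis

end

locale realization = block_system I \<B> for I :: "nat set" and \<B> :: "nat set set" +
  fixes a :: "nat \<Rightarrow> 'a::field ^ 3"
  assumes realizes: "realizes I \<B> a"
begin

lemma bracket_iff:
  "i \<in> I \<Longrightarrow> j \<in> I \<Longrightarrow> k \<in> I \<Longrightarrow> i \<noteq> j \<Longrightarrow> i \<noteq> k \<Longrightarrow> j \<noteq> k \<Longrightarrow>
     bracket (a i) (a j) (a k) = 0 \<longleftrightarrow> (\<exists>b\<in>\<B>. {i, j, k} \<subseteq> b)"
  using realizes unfolding realizes_def by blast

lemma cross_nonzero:
  assumes "i \<in> I" "j \<in> I" "i \<noteq> j"
  shows "cross (a i) (a j) \<noteq> 0"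
proof
  assume 0: "cross (a i) (a j) = 0"
  obtain k where k: "k \<in> I" "k \<noteq> i" "k \<noteq> j" "\<forall>b\<in>\<B>. \<not> {i, j, k} \<subseteq> b"
    using off_block[OF assms] by blast
  then have "bracket (a i) (a j) (a k) \<noteq> 0" using bracket_iff[of i j k] assms by auto
  then show False using cross_eq_0_if_bracket[OF 0] by blast
qed

lemma form_nonzero: "i \<in> I \<Longrightarrow> a i \<noteq> 0"
proof
  assume "i \<in> I" "a i = 0"
  obtain j where "j \<in> I" "j \<noteq> i" using two_points by blast
  then show False using cross_nonzero[of i j] \<open>i \<in> I\<close> \<open>a i = 0\<close> by (simp add: cross_0)
qed

lemma inj_plane: "inj_on (\<lambda>i. kernel_plane (a i)) I"
proof (rule inj_onI, rule ccontr)
  fix i j assume ij: "i \<in> I" "j \<in> I" "kernel_plane (a i) = kernel_plane (a j)" "i \<noteq> j"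
  obtain c where "a i = c *s a j"
    using kernel_plane_subset_imp[of "a j" "a i"] form_nonzero ij by blast
  then have "cross (a i) (a j) = 0"
    unfolding vec_eq_iff forall_3 by (simp add: cross_def)
  then show False using cross_nonzero ij by blast
qed

text \<open>The vector spans the intersection of two planes of the block; a further plane contains
  it exactly if it shares a block with these two, and \<open>block_eqI\<close> identifies that block
  with \<open>b\<close>.\<close>

lemma block_point:
  assumes b: "b \<in> \<B>"
  obtains p where "p \<noteq> 0" "\<And>j. j \<in> I \<Longrightarrow> dotp (a j) p = 0 \<longleftrightarrow> j \<in> b"
proof -
  obtain i j where ij: "i \<in> b" "j \<in> b" "i \<noteq> j" using block_two_points[OF b] .
  have I: "i \<in> I" "j \<in> I" using ij block_subset[OF b] by auto
  show thesis
  proof (rule that[of "cross (a i) (a j)"])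
    show "cross (a i) (a j) \<noteq> 0" using cross_nonzero I ij(3) by blast
    fix k assume k: "k \<in> I"
    show "dotp (a k) (cross (a i) (a j)) = 0 \<longleftrightarrow> k \<in> b"
    proof (cases "k = i \<or> k = j")
      case True
      then show ?thesis using ij by (auto simp: dotp_cross bracket_same)
    next
      case False
      have "(\<exists>b'\<in>\<B>. {k, i, j} \<subseteq> b') \<longleftrightarrow> k \<in> b"
        using block_eqI[OF b _ ij(1,2) _ _ ij(3)] b ij by blast
      then show ?thesis using bracket_iff[of k i j] False k I ij by (simp add: dotp_cross)
    qed
  qed
qed

end

locale realization_char_0 = realization I \<B> a
  for I :: "nat set" and \<B> and a :: "nat \<Rightarrow> 'a::field_char_0 ^ 3"

sublocale realization_char_0 \<subseteq> plane_family I a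
  by unfold_locales (use finite_points form_nonzero inj_plane in auto)

subsection \<open>Low degree derivations of a deletion\<close>

lemma sum_order_le_degree_points:
  fixes q :: "'a::idom poly"
  assumes "q \<noteq> 0" "finite K" "inj_on s K" "\<And>b. b \<in> K \<Longrightarrow> [:- s b, 1:] ^ m b dvd q"
  shows "(\<Sum>b\<in>K. m b) \<le> degree q"
proof -
  have "(\<Sum>b\<in>K. m b) \<le> (\<Sum>b\<in>K. order (s b) q)"
    using assms by (intro sum_mono) (auto simp: order_divides)
  also have "\<dots> = (\<Sum>x\<in>s ` K. order x q)"
    using assms(3) by (simp add: sum.reindex)
  also have "\<dots> = (\<Sum>x\<in>s ` K \<inter> {x. poly q x = 0}. order x q)"
    using assms(1,2) by (intro sum.mono_neutral_right) (auto simp: order_0I)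
  also have "\<dots> \<le> (\<Sum>x | poly q x = 0. order x q)"
    using assms(1) by (intro sum_mono2) (auto simp: poly_roots_finite)
  also have "\<dots> \<le> degree q" by (rule sum_order_le_degree[OF assms(1)])
  finally show ?thesis .
qed

text \<open>Near a point \<open>p\<close> of the deleted plane \<open>H\<close>, \<open>det (x, F x, p)\<close> vanishes on all other planes
  through \<open>p\<close>; restricted to \<open>H\<close> it is the form of \<open>H\<close> applied to \<open>F\<close>, up to a single linear
  factor.\<close>

lemma (in realization_char_0) multiplicity_at_point:
  assumes i: "i \<in> I" and b: "b \<in> \<B>" "i \<in> b"
    and F: "pmap F" "preserves (planes - {kernel_plane (a i)}) F"
    and u: "dotp (a i) u = 0" "\<And>j. j \<in> I - {i} \<Longrightarrow> dotp (a j) u \<noteq> 0"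
    and P: "dotp (a i) v = 0" "\<And>j. j \<in> I \<Longrightarrow> dotp (a j) (v + t *s u) = 0 \<longleftrightarrow> j \<in> b"
    and q: "\<And>s. dotp (a i) (F (v + s *s u)) = poly q s"
  shows "[:- t, 1:] ^ (card b - 2) dvd q"
proof -
  define P where "P = v + t *s u"
  have Pj: "dotp (a j) P = 0" if "j \<in> b" for j
    using P(2)[of j] that block_subset[OF b(1)] by (auto simp: P_def)
  have Pi: "dotp (a i) P = 0" using Pj b by blast
  obtain j where j: "j \<in> b" "j \<noteq> i" using block_other_point[OF b(1)] .
  have finb: "finite b" using finite_points block_subset[OF b(1)] finite_subset by blast
  have "P \<noteq> 0"
  proof
    assume "P = 0"
    then have "I \<subseteq> b" using P(2) by (auto simp: P_def dotp_0)
    then show False using off_block[of i j] b i j block_subset[OF b(1)] by blast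
  qed
  have ju: "dotp (a j) u \<noteq> 0" using u(2) j block_subset[OF b(1)] by blast
  have PU: "cross P u \<noteq> 0"
  proof
    assume "cross P u = 0"
    then have "dotp (a j) u *s P - dotp (a j) P *s u = 0"
      by (metis cross_cross cross_0(1))
    then show False using ju \<open>P \<noteq> 0\<close> Pj[OF j(1)] by simp
  qed
  \<comment> \<open>\<open>P\<close> and \<open>u\<close> lie in plane \<open>i\<close> and are
    independent, so their cross product is its form up to a nonzero scalar; this identifies
    \<open>bracket u y P\<close> with the value of that form.\<close>
  have "kernel_plane (a i) \<subseteq> kernel_plane (cross P u)"
    using u(1) Pi by (auto simp: mem_kernel_plane dotp_cross_left
        intro!: bracket_eq_0_of_plane[OF form_nonzero[OF i]])
  then obtain \<kappa> where \<kappa>: "cross P u = \<kappa> *s a i"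
    using kernel_plane_subset_imp[OF form_nonzero[OF i]] by blast
  have "\<kappa> \<noteq> 0" using PU \<kappa> by auto
  have br: "bracket u y P = \<kappa> * dotp (a i) y" for y
  proof -
    have "bracket u y P = bracket y P u" by (simp add: bracket_def algebra_simps)
    then show ?thesis by (simp add: \<kappa> dotp_scale_left flip: dotp_cross_left)
  qed
  have "\<exists>h. pfun h \<and> (\<forall>x. bracket x (F x) P = (\<Prod>j\<in>b - {i}. dotp (a j) x) * h x)"
  proof (rule pfun_divisible_prod)
    show "finite (b - {i})" using finb by simp
    show "pfun (\<lambda>x. bracket x (F x) P)"
      by (rule pfun_bracket[OF pmap_id F(1) pmap_const])
    fix k assume k: "k \<in> b - {i}"
    then have kI: "k \<in> I" "k \<noteq> i" using block_subset[OF b(1)] by auto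
    then show "a k \<noteq> 0" using form_nonzero by blast
    fix x assume x: "x \<in> kernel_plane (a k)"
    have "kernel_plane (a k) \<in> planes - {kernel_plane (a i)}"
      using kI i inj_plane by (auto simp: planes_def inj_on_def)
    then have "F x \<in> kernel_plane (a k)" using F(2) x by (auto simp: preserves_def)
    then show "bracket x (F x) P = 0"
      using x k Pj by (intro bracket_eq_0_of_plane[OF form_nonzero[OF kI(1)]])
        (auto simp: mem_kernel_plane)
  next
    show "inj_on (\<lambda>i. kernel_plane (a i)) (b - {i})"
      using inj_plane block_subset[OF b(1)] by (auto simp: inj_on_def)
  qed
  then obtain h where h: "pfun h" "\<And>x. bracket x (F x) P = (\<Prod>j\<in>b - {i}. dotp (a j) x) * h x"
    by blast
  obtain g where g: "\<And>s. h (v + s *s u) = poly g s" using pfun_line[OF h(1)] by blast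
  define C where "C = (\<Prod>j\<in>b - {i}. dotp (a j) u)"
  have "poly (smult \<kappa> q - [:- t, 1:] ^ (card b - 2) * smult C g) s = 0" if s: "s \<noteq> t" for s
  proof -
    have x: "v + s *s u = P + (s - t) *s u" by (simp add: P_def vec_eq_iff algebra_simps)
    have lin: "dotp (a j) (v + s *s u) = (s - t) * dotp (a j) u" if "j \<in> b - {i}" for j
      unfolding x dotp_add dotp_scale using Pj[of j] that by simp
    have "card (b - {i}) = Suc (card b - 2)" using b finb block_card[OF b(1)] by simp
    then have "(\<Prod>j\<in>b - {i}. dotp (a j) (v + s *s u)) = (s - t) ^ Suc (card b - 2) * C"
      by (simp only: prod.cong[OF refl lin] prod.distrib C_def prod_constant)
    then have "bracket (v + s *s u) (F (v + s *s u)) P = (s - t) ^ Suc (card b - 2) * C * poly g s"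
      by (simp only: h(2) g)
    \<comment> \<open>As \<open>bracket P y P = 0\<close>, a factor \<open>s - t\<close> is common
      to both sides and cancels: the \<open>card b - 1\<close> other planes through the point
      contribute the exponent \<open>card b - 2\<close>.\<close>
    moreover have "bracket (P + (s - t) *s u) y P = (s - t) * bracket u y P" for y
      unfolding bracket_add bracket_scale bracket_same by simp
    then have "bracket (v + s *s u) (F (v + s *s u)) P = (s - t) * (\<kappa> * poly q s)"
      unfolding q[symmetric] br[symmetric] x[symmetric] .
    ultimately have "\<kappa> * poly q s = (s - t) ^ (card b - 2) * C * poly g s"
      using s by simp
    then show ?thesis by (simp add: algebra_simps)
  qed
  then have "smult \<kappa> q - [:- t, 1:] ^ (card b - 2) * smult C g = 0"
    by (rule poly_eq_0_of_values)
  then have "smult \<kappa> q = [:- t, 1:] ^ (card b - 2) * smult C g" by simp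
  then have "[:- t, 1:] ^ (card b - 2) dvd smult \<kappa> q" by (metis dvd_triv_left)
  then show ?thesis using \<open>\<kappa> \<noteq> 0\<close> by (simp add: dvd_smult_iff)
qed

text \<open>On an affine line in plane \<open>i\<close> the form applied to \<open>F\<close> becomes
  a polynomial of degree at most \<open>d\<close>. The blocks through \<open>i\<close> are distinct
  points of this line with multiplicity \<open>card b - 2\<close> each, more than \<open>d\<close>
  in total; so it vanishes on the line and, by homogeneity, on the plane.\<close>

lemma (in realization_char_0) deletion_low_degree:
  assumes i: "i \<in> I" and F: "pmap F" "homog_map d F" "preserves (planes - {kernel_plane (a i)}) F"
    and d: "d < (\<Sum>b | b \<in> \<B> \<and> i \<in> b. card b - 2)"
  shows "preserves planes F"
proof -
  define Bi where "Bi = {b \<in> \<B>. i \<in> b}"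
  have finB: "finite Bi" using finite_blocks by (simp add: Bi_def)
  have "Bi \<noteq> {}" using d unfolding Bi_def by (metis sum.empty not_less0)
  then obtain b0 where b0: "b0 \<in> \<B>" "i \<in> b0" by (auto simp: Bi_def)
  obtain j0 where j0: "j0 \<in> b0" "j0 \<noteq> i" using block_other_point[OF b0(1)] .
  have j0I: "j0 \<in> I" using j0 block_subset[OF b0(1)] by blast
  obtain v where v: "v \<noteq> 0" "\<And>j. j \<in> I \<Longrightarrow> dotp (a j) v = 0 \<longleftrightarrow> j \<in> b0"
    using block_point[OF b0(1)] by metis
  have vi: "dotp (a i) v = 0" using v(2) i b0 by blast
  have "\<not> kernel_plane (a i) \<subseteq> kernel_plane (a j)" if "j \<in> I - {i}" for j
    using that i form_nonzero inj_plane kernel_plane_subset_imp_eq[of "a j" "a i"]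
    by (auto simp: inj_on_def)
  moreover have "0 \<in> kernel_plane (a i)" by (simp add: mem_kernel_plane dotp_0)
  \<comment> \<open>A direction in plane \<open>i\<close> that lies on no other plane: no block
    point is at infinity on the line \<open>v + s *s u\<close>.\<close>
  ultimately obtain u where u: "u \<in> kernel_plane (a i)" "(\<Prod>j\<in>I - {i}. dotp (a j) u) \<noteq> 0"
    using prod_dotp_not_vanishing_on[OF _ affine_set_subspace[OF subspace_kernel_plane], of "I -
        {i}" "a i" a]
      finite_points by blast
  have uj: "dotp (a j) u \<noteq> 0" if "j \<in> I - {i}" for j
    using u(2) that finite_points by auto
  have ui: "dotp (a i) u = 0" using u(1) by (simp add: mem_kernel_plane)
  have uj0: "dotp (a j0) u \<noteq> 0" using uj j0I j0 by blast
  have decomp: "\<exists>l m. x = l *s v + m *s u" if x: "dotp (a i) x = 0" for x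
  proof -
    define m where "m = dotp (a j0) x / dotp (a j0) u"
    have c: "cross (a i) (a j0) \<noteq> 0" using cross_nonzero i j0I j0 by blast
    have "dotp (a i) (x - m *s u) = 0" "dotp (a j0) (x - m *s u) = 0"
      using uj0 by (simp_all add: dotp_diff dotp_scale x ui m_def)
    then obtain c1 where c1: "x - m *s u = c1 *s cross (a i) (a j0)"
      using plane_intersection[OF c] by metis
    obtain c2 where c2: "v = c2 *s cross (a i) (a j0)"
      using plane_intersection[OF c vi] v(2) j0 j0I by metis
    have "c2 \<noteq> 0" using c2 v(1) by auto
    then have "c1 *s cross (a i) (a j0) = (c1 / c2) *s v" by (subst c2) simp
    then have "x = (c1 / c2) *s v + m *s u" using c1 by (simp add: algebra_simps)
    then show ?thesis by blast
  qed
  have "\<exists>t. \<forall>j\<in>I. dotp (a j) (v + t *s u) = 0 \<longleftrightarrow> j \<in> b" if b: "b \<in> Bi" for b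
  proof -
    have bB: "b \<in> \<B>" "i \<in> b" using b by (auto simp: Bi_def)
    obtain p where p: "\<And>j. j \<in> I \<Longrightarrow> dotp (a j) p = 0 \<longleftrightarrow> j \<in> b"
      using block_point[OF bB(1)] by metis
    obtain l m where lm: "p = l *s v + m *s u" using decomp[of p] p[OF i] bB by blast
    obtain j where j: "j \<in> b" "j \<noteq> i" using block_other_point[OF bB(1)] .
    have jI: "j \<in> I" using j block_subset[OF bB(1)] by blast
    have "l \<noteq> 0"
    proof
      assume l: "l = 0"
      have "m * dotp (a j) u = 0" using p[OF jI] j by (simp add: lm l dotp_scale)
      then have "p = 0" using uj[of j] jI j by (simp add: lm l)
      then have "I \<subseteq> b" using p by (auto simp: dotp_0)
      then show False using off_block[OF i jI] j bB block_subset[OF bB(1)] by blast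
    qed
    then have pe: "p = l *s (v + (m / l) *s u)"
      by (simp add: lm vec_eq_iff field_simps)
    have "dotp (a j) (v + (m / l) *s u) = 0 \<longleftrightarrow> j \<in> b" if "j \<in> I" for j
      using p[OF that] \<open>l \<noteq> 0\<close> unfolding pe dotp_scale by simp
    then show ?thesis by blast
  qed
  then obtain t where t: "\<And>b j. b \<in> Bi \<Longrightarrow> j \<in> I \<Longrightarrow> dotp (a j) (v + t b *s u) = 0 \<longleftrightarrow> j \<in> b"
    by metis
  have inj_t: "inj_on t Bi"
  proof (rule inj_onI)
    fix b b' assume bb: "b \<in> Bi" "b' \<in> Bi" "t b = t b'"
    then have "\<And>j. j \<in> I \<Longrightarrow> j \<in> b \<longleftrightarrow> j \<in> b'" using t by metis
    then show "b = b'" using bb block_subset by (auto simp: Bi_def)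
  qed
  define f where "f x = dotp (a i) (F x)" for x
  have pf: "pfun f" unfolding f_def[abs_def] by (rule pfun_dotp[OF F(1)])
  have hf: "homog d f" using F(2) by (simp add: homog_def homog_map_def f_def dotp_scale)
  obtain q where q: "\<And>s. f (v + s *s u) = poly q s" using pfun_line[OF pf] by blast
  have "q = 0"
  proof (rule ccontr)
    assume "q \<noteq> 0"
    have "[:- t b, 1:] ^ (card b - 2) dvd q" if b: "b \<in> Bi" for b
      by (rule multiplicity_at_point[OF i _ _ F(1,3) ui uj vi t[OF b] q[unfolded f_def]])
        (use b in \<open>auto simp: Bi_def\<close>)
    then have "(\<Sum>b\<in>Bi. card b - 2) \<le> degree q"
      by (rule sum_order_le_degree_points[OF \<open>q \<noteq> 0\<close> finB inj_t])
    also have "\<dots> \<le> d" by (rule homog_line_degree[OF pf hf q])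
    finally show False using d by (simp add: Bi_def)
  qed
  have "f x = 0" if x: "dotp (a i) x = 0" for x
  proof -
    obtain l m where lm: "x = l *s v + m *s u" using decomp[OF x] by blast
    \<comment> \<open>Points off the direction \<open>u\<close> are multiples of points of the line;
      multiples of \<open>u\<close> are reached through a polynomial that vanishes at every nonzero
      parameter.\<close>
    have nz: "f (m *s u + l *s v) = 0" if "l \<noteq> 0" for l
    proof -
      have "m *s u + l *s v = l *s (v + (m / l) *s u)" using that
          by (simp add: vec_eq_iff field_simps)
      then have "f (m *s u + l *s v) = f (l *s (v + (m / l) *s u))" by (rule arg_cong)
      also have "\<dots> = l ^ d * f (v + (m / l) *s u)" using hf unfolding homog_def by blast
      finally show ?thesis by (simp add: q \<open>q = 0\<close>)
    qed
    obtain r where r: "\<And>s. f (m *s u + s *s v) = poly r s" using pfun_line[OF pf] by blast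
    then have "r = 0" using nz poly_eq_0_of_values[of 0 r] by metis
    then show ?thesis using r[of l] by (simp add: lm add.commute)
  qed
  then have "\<forall>x\<in>kernel_plane (a i). F x \<in> kernel_plane (a i)"
    by (simp add: mem_kernel_plane f_def)
  then show ?thesis using F(3) unfolding preserves_def by blast
qed

text \<open>The number \<open>\<Sum> (card b - 2)\<close> over the blocks through \<open>i\<close> is \<open>|I| - 1\<close> minus the number of
  points on the \<open>i\<close>-th plane.\<close>

theorem (in realization_char_0) not_inductively_free:
  assumes "homogeneous_basis I a F G e"
    and "\<And>i. i \<in> I \<Longrightarrow> e \<le> (\<Sum>b | b \<in> \<B> \<and> i \<in> b. card b - 2)"
  shows "\<not> inductively_free planes"
proof
  interpret homogeneous_basis I a F G e by fact
  have card: "card planes = 2 * e + 1"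
    using card_image[OF inj_plane] card_index by (simp add: planes_def)
  assume "inductively_free planes"
  \<comment> \<open>The member of size \<open>2 * e\<close> of the chain; \<open>e_pos\<close> puts
    this size into the range.\<close>
  then obtain K where K: "K \<subseteq> planes" "card K = 2 * e" "free_arrangement K"
    unfolding inductively_free_def card using e_pos
    by (metis (no_types, lifting) One_nat_def Suc_leI add.commute atLeastAtMost_iff le_add2
        mult_pos_pos plus_1_eq_Suc zero_less_numeral)
  have fin: "finite planes" using finite_index by (simp add: planes_def)
  then have "card (planes - K) = 1"
    using K card by (simp add: card_Diff_subset finite_subset)
  then obtain H where H: "planes - K = {H}" by (auto simp: card_1_singleton_iff)
  then have "K = planes - {H}" "H \<in> planes" using K(1) by auto
  then obtain i where i: "i \<in> I" "K = planes - {kernel_plane (a i)}" by (auto simp: planes_def)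
  have "\<not> free_arrangement (planes - {kernel_plane (a i)})"
    by (rule deletion_not_free[OF i(1)])
      (meson assms(2) deletion_low_degree i(1) order_less_le_trans)
  then show False using K(3) i(2) by simp
qed

section \<open>Isomorphism invariance of realization spaces\<close>

lemma poset_iso_inverse:
  assumes "poset_iso r s f"
  shows "poset_iso s r (inv_into (Field r) f)"
proof -
  have b: "bij_betw f (Field r) (Field s)"
    and o: "\<And>x y. x \<in> Field r \<Longrightarrow> y \<in> Field r \<Longrightarrow> (x, y) \<in> r \<longleftrightarrow> (f x, f y) \<in> s"
    using assms by (auto simp: poset_iso_def)
  have b': "bij_betw (inv_into (Field r) f) (Field s) (Field r)" by (rule bij_betw_inv_into[OF b])
  have "(x, y) \<in> s \<longleftrightarrow> (inv_into (Field r) f x, inv_into (Field r) f y) \<in> r"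
    if "x \<in> Field s" "y \<in> Field s" for x y
    using o[of "inv_into (Field r) f x" "inv_into (Field r) f y"] that
      bij_betw_inv_into_right[OF b] bij_betw_apply[OF b'] by metis
  then show ?thesis using b' by (simp add: poset_iso_def)
qed

lemma poset_iso_comp:
  assumes "poset_iso r s f" "poset_iso s t g"
  shows "poset_iso r t (g \<circ> f)"
proof -
  have "f x \<in> Field s" if "x \<in> Field r" for x
    using assms(1) that by (auto simp: poset_iso_def bij_betw_def)
  then show ?thesis
    using assms bij_betw_trans by (fastforce simp: poset_iso_def)
qed

lemma Chains_subset_Field: "C \<in> Chains r \<Longrightarrow> C \<subseteq> Field r"
  by (auto simp: Chains_def Field_def)

lemma poset_iso_chain_cards:
  assumes iso: "poset_iso r s f" and x: "x \<in> Field r"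
  shows "{card C | C. C \<in> Chains r \<and> C \<subseteq> underS r x} \<subseteq>
    {card C | C. C \<in> Chains s \<and> C \<subseteq> underS s (f x)}"
proof clarify
  fix C assume C: "C \<in> Chains r" "C \<subseteq> underS r x"
  have sub: "C \<subseteq> Field r" using Chains_subset_Field[OF C(1)] .
  have b: "inj_on f (Field r)"
    and o: "\<And>x y. x \<in> Field r \<Longrightarrow> y \<in> Field r \<Longrightarrow> (x, y) \<in> r \<longleftrightarrow> (f x, f y) \<in> s"
    using iso by (auto simp: poset_iso_def bij_betw_def)
  have "f ` C \<in> Chains s"
    using C(1) sub o unfolding Chains_def by blast
  moreover have "f ` C \<subseteq> underS s (f x)"
  proof clarify
    fix z assume z: "z \<in> C"
    then have "z \<noteq> x" "(z, x) \<in> r" "z \<in> Field r" using C(2) sub by (auto simp: underS_def)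
    then show "f z \<in> underS s (f x)" using o x inj_onD[OF b] by (auto simp: underS_def)
  qed
  moreover have "card (f ` C) = card C"
    by (rule card_image) (rule inj_on_subset[OF b sub])
  ultimately show "\<exists>C'. card C = card C' \<and> C' \<in> Chains s \<and> C' \<subseteq> underS s (f x)"
    by metis
qed

lemma poset_iso_rank:
  assumes iso: "poset_iso r s f" and x: "x \<in> Field r"
  shows "poset_rank s (f x) = poset_rank r x"
proof -
  have "f x \<in> Field s" "inv_into (Field r) f (f x) = x"
    using iso x by (auto simp: poset_iso_def bij_betw_def inv_into_f_f)
  then have "{card C | C. C \<in> Chains s \<and> C \<subseteq> underS s (f x)} =
      {card C | C. C \<in> Chains r \<and> C \<subseteq> underS r x}"
    using poset_iso_chain_cards[OF iso x] poset_iso_chain_cards[OF poset_iso_inverse[OF iso], of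
        "f x"]
    by (simp only: subset_antisym)
  then show ?thesis unfolding poset_rank_def by (simp only:)
qed

lemma rank_part_iso:
  assumes iso: "poset_iso r s f"
  shows "rank_part s k = f ` rank_part r k"
proof -
  have "Field s = f ` Field r" using iso by (auto simp: poset_iso_def bij_betw_def)
  then show ?thesis
    using poset_iso_rank[OF iso] unfolding rank_part_def by auto
qed

lemma card_rank_part_iso:
  assumes iso: "poset_iso r s f"
  shows "card (rank_part s k) = card (rank_part r k)"
  unfolding rank_part_iso[OF iso]
  by (rule card_image, rule inj_on_subset[of _ "Field r"])
    (use iso in \<open>auto simp: poset_iso_def bij_betw_def rank_part_def\<close>)

lemma realizations_iso_subset:
  assumes iso: "poset_iso L L' f"
  shows "realizations L \<subseteq> realizations L'"
proof
  fix A assume "A \<in> realizations L"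
  then obtain g where A: "arrangement A" "card A = card (rank_part L 1)"
    "poset_iso (intersection_lattice A) L g" "g ` A = rank_part L 1"
    by (auto simp: realizations_def)
  have "poset_iso (intersection_lattice A) L' (f \<circ> g)"
    by (rule poset_iso_comp[OF A(3) iso])
  moreover have "(f \<circ> g) ` A = rank_part L' 1"
    by (simp only: image_comp[symmetric] A(4) rank_part_iso[OF iso])
  moreover have "card A = card (rank_part L' 1)"
    by (simp only: A(2) card_rank_part_iso[OF iso])
  ultimately show "A \<in> realizations L'"
    using A(1) unfolding realizations_def by blast
qed

lemma realizations_iso:
  assumes "poset_iso L L' f"
  shows "realizations L = realizations L'"
  using realizations_iso_subset[OF assms] realizations_iso_subset[OF poset_iso_inverse[OF assms]]
  by blast

text \<open>A lattice enters the construction only through its number of atoms and its set of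
  realizations. So \<open>L15\<close>, and the intersection lattice of any realization, may be
  replaced by a \<open>block_lattice\<close>.\<close>

lemma moduli_topology_iso:
  assumes "poset_iso L L' f"
  shows "(moduli_topology L :: 'a::field arrangement set topology) = moduli_topology L'"
proof -
  have r: "(realizations L :: 'a arrangement set) = realizations L'"
    by (rule realizations_iso[OF assms])
  then have "(realization_coords L :: (nat \<times> 3 \<Rightarrow> 'a) set) = realization_coords L'"
    by (simp add: realization_coords_def card_rank_part_iso[OF assms])
  then show ?thesis
    by (simp add: moduli_topology_def r card_rank_part_iso[OF assms])
qed

section \<open>Intersection lattices with prescribed blocks\<close>

text \<open>Follows \<open>L13\<close> to the letter, so that \<open>L13_eq\<close> is a
  reflexivity.\<close>

definition flats :: "nat set \<Rightarrow> nat set set \<Rightarrow> nat set set" where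
  "flats I \<B> = {{}, I} \<union> {{i} | i. i \<in> I} \<union> \<B> \<union>
     {P. P \<subseteq> I \<and> card P = 2 \<and> \<not> (\<exists>B\<in>\<B>. P \<subseteq> B)}"

definition block_lattice :: "nat set \<Rightarrow> nat set set \<Rightarrow> nat set rel" where
  "block_lattice I \<B> = relation_of (\<subseteq>) (flats I \<B>)"

lemma Field_relation_of: "(\<And>x. x \<in> S \<Longrightarrow> P x x) \<Longrightarrow> Field (relation_of P S) = S"
  by (auto simp: Field_def relation_of_def)

lemma mem_relation_of: "(x, y) \<in> relation_of P S \<longleftrightarrow> x \<in> S \<and> y \<in> S \<and> P x y"
  by (auto simp: relation_of_def)

lemma Field_block_lattice: "Field (block_lattice I \<B>) = flats I \<B>"
  by (simp add: block_lattice_def Field_relation_of)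

lemma Field_intersection_lattice: "Field (intersection_lattice A) = {\<Inter>B | B. B \<subseteq> A}"
  by (simp add: intersection_lattice_def Field_relation_of)

lemma mem_intersection_lattice:
  "(X, Y) \<in> intersection_lattice A \<longleftrightarrow>
     X \<in> Field (intersection_lattice A) \<and> Y \<in> Field (intersection_lattice A) \<and> Y \<subseteq> X"
  unfolding Field_intersection_lattice by (simp only: intersection_lattice_def mem_relation_of)

lemma mem_block_lattice:
  "(X, Y) \<in> block_lattice I \<B> \<longleftrightarrow> X \<in> flats I \<B> \<and> Y \<in> flats I \<B> \<and> X \<subseteq> Y"
  by (simp only: block_lattice_def mem_relation_of)

lemma dim_kernel_plane:
  fixes a :: "'a::field ^ 3"
  assumes "a \<noteq> 0"
  shows "vec.dim (kernel_plane a) = 2"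
proof -
  obtain w where w: "dotp a w = 1" using ex_dotp_eq_1[OF assms] .
  have s: "vec.span (kernel_plane a) = kernel_plane a"
    using subspace_kernel_plane vec.span_eq_iff by blast
  have "x - dotp a x *s w \<in> kernel_plane a" for x
    by (simp add: mem_kernel_plane dotp_diff dotp_scale w)
  then have "vec.span (insert w (kernel_plane a)) = UNIV"
    unfolding vec.span_insert s by auto
  moreover have "vec.dim (UNIV :: ('a ^ 3) set) = 3"
    by (simp only: vec.dim_UNIV card_cart_basis) simp
  ultimately have "vec.dim (insert w (kernel_plane a)) = 3"
    by (metis vec.dim_span)
  moreover have "w \<notin> vec.span (kernel_plane a)" unfolding s using w by (simp add: mem_kernel_plane)
  ultimately show ?thesis by (simp add: vec.dim_insert)
qed

context block_system
begin

lemma the_block: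
  assumes "b \<in> \<B>" "i \<in> b" "j \<in> b" "i \<noteq> j"
  shows "(THE b. b \<in> \<B> \<and> {i, j} \<subseteq> b) = b"
proof (rule the_equality)
  fix b' assume "b' \<in> \<B> \<and> {i, j} \<subseteq> b'"
  then show "b' = b" using block_eqI[of b' b i j] assms by blast
qed (use assms in blast)

lemma finite_flats: "finite (flats I \<B>)"
proof -
  have "flats I \<B> \<subseteq> Pow I" using block_subset by (auto simp: flats_def)
  then show ?thesis using finite_points by (meson finite_Pow_iff finite_subset)
qed

lemma flat_cases:
  assumes "x \<in> flats I \<B>" "x \<noteq> {}" "x \<notin> {{i} | i. i \<in> I}"
  obtains i j where "i \<in> x" "j \<in> x" "i \<noteq> j" "x \<subseteq> I"
proof -
  have "2 \<le> card x \<and> x \<subseteq> I"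
  proof -
    have "2 \<le> card I"
      using two_points finite_points card_le_Suc0_iff_eq[of I] by fastforce
    then show ?thesis
      using assms block_card block_subset by (fastforce simp: flats_def)
  qed
  moreover from this have "finite x" using finite_points finite_subset by blast
  ultimately show thesis using that card_le_Suc0_iff_eq[of x] by fastforce
qed

text \<open>Only \<open>{}\<close> lies strictly below a singleton, whereas every larger flat has
  the chain \<open>{}\<close>, \<open>{i}\<close> of size two below it.\<close>

lemma rank_part_block_lattice: "rank_part (block_lattice I \<B>) 1 = {{i} | i. i \<in> I}"
proof -
  let ?r = "block_lattice I \<B>"
  have mem: "(x, y) \<in> ?r \<longleftrightarrow> x \<in> flats I \<B> \<and> y \<in> flats I \<B> \<and> x \<subseteq> y" for x y
    by (simp add: block_lattice_def mem_relation_of)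
  have sing: "{i} \<in> flats I \<B>" if "i \<in> I" for i using that by (auto simp: flats_def)
  have empty: "{} \<in> flats I \<B>" by (simp add: flats_def)
  have "I \<noteq> {}" using two_points by blast
  have fin: "finite {card C | C. C \<in> Chains ?r \<and> C \<subseteq> underS ?r x}" for x
  proof -
    have "{card C | C. C \<in> Chains ?r \<and> C \<subseteq> underS ?r x} \<subseteq> card ` Pow (flats I \<B>)"
      using Chains_subset_Field[of _ ?r] by (auto simp: Field_block_lattice)
    then show ?thesis using finite_flats by (meson finite_Pow_iff finite_imageI finite_subset)
  qed
  have rank0: "poset_rank ?r {} = 0"
  proof -
    have "underS ?r {} = {}" by (auto simp: underS_def mem)
    then have "{card C | C. C \<in> Chains ?r \<and> C \<subseteq> underS ?r {}} = {0}"
      by (auto simp: Chains_def)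
    then show ?thesis by (simp add: poset_rank_def)
  qed
  have rank1: "poset_rank ?r {i} = 1" if i: "i \<in> I" for i
  proof -
    have u: "underS ?r {i} = {{}}"
      using i empty sing by (auto simp: underS_def mem)
    have c: "{{}} \<in> Chains ?r" "{} \<in> Chains ?r" using empty by (auto simp: Chains_def mem)
    have "{card C | C. C \<in> Chains ?r \<and> C \<subseteq> {{}}} = {0, 1}"
    proof (rule set_eqI)
      fix n
      show "n \<in> {card C | C. C \<in> Chains ?r \<and> C \<subseteq> {{}}} \<longleftrightarrow> n \<in> {0, 1}"
      proof
        assume "n \<in> {card C | C. C \<in> Chains ?r \<and> C \<subseteq> {{}}}"
        then obtain C :: "nat set set" where "n = card C" "C \<subseteq> {{}}" by auto
        then show "n \<in> {0, 1}" by (auto simp: subset_singleton_iff)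
      next
        assume "n \<in> {0, 1}"
        then have "n = card {} \<or> n = card {{} :: nat set}" by auto
        then show "n \<in> {card C | C. C \<in> Chains ?r \<and> C \<subseteq> {{}}}" using c by blast
      qed
    qed
    then show ?thesis by (simp add: poset_rank_def u)
  qed
  have rank2: "poset_rank ?r x \<noteq> 1" if x: "x \<in> flats I \<B>" "x \<noteq> {}" "x \<notin> {{i} | i. i \<in> I}" for x
  proof -
    obtain i j where ij: "i \<in> x" "j \<in> x" "i \<noteq> j" "x \<subseteq> I" using flat_cases[OF x] .
    have "{{}, {i}} \<in> Chains ?r" "{{}, {i}} \<subseteq> underS ?r x"
      using ij empty sing x by (auto simp: Chains_def mem underS_def)
    moreover have "card {{}, {i}} = 2" by simp
    ultimately have "2 \<in> {card C | C. C \<in> Chains ?r \<and> C \<subseteq> underS ?r x}"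
        by (metis (mono_tags, lifting) mem_Collect_eq)
    then have "2 \<le> poset_rank ?r x" unfolding poset_rank_def by (rule Max_ge[OF fin])
    then show ?thesis by simp
  qed
  show ?thesis
  proof (rule set_eqI)
    fix x
    show "x \<in> rank_part ?r 1 \<longleftrightarrow> x \<in> {{i} | i. i \<in> I}"
    proof
      assume "x \<in> rank_part ?r 1"
      then have "x \<in> flats I \<B>" "poset_rank ?r x = 1"
        by (simp_all add: rank_part_def Field_block_lattice)
      then show "x \<in> {{i} | i. i \<in> I}" using rank0 rank2[of x] by fastforce
    next
      assume "x \<in> {{i} | i. i \<in> I}"
      then show "x \<in> rank_part ?r 1"
        using rank1 sing by (auto simp: rank_part_def Field_block_lattice)
    qed
  qed
qed

lemma card_rank_part_block_lattice: "card (rank_part (block_lattice I \<B>) 1) = card I"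
proof -
  have "{{i} | i. i \<in> I} = (\<lambda>i. {i}) ` I" by blast
  then show ?thesis unfolding rank_part_block_lattice by (simp add: card_image)
qed

end

context realization
begin

abbreviation "plane i \<equiv> kernel_plane (a i)"

definition flat_of :: "('a ^ 3) set \<Rightarrow> nat set" where
  "flat_of X = {i \<in> I. X \<subseteq> plane i}"

lemma plane_not_UNIV: "i \<in> I \<Longrightarrow> \<not> UNIV \<subseteq> plane i"
  using ex_dotp_eq_1[OF form_nonzero] by (metis UNIV_I mem_kernel_plane subsetD zero_neq_one)

lemma flat_of_plane: "i \<in> I \<Longrightarrow> flat_of (plane i) = {i}"
  using kernel_plane_subset_imp_eq[OF form_nonzero form_nonzero] inj_plane
  by (auto simp: flat_of_def inj_on_def)

lemma flat_of_UNIV: "flat_of UNIV = {}"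
  using plane_not_UNIV by (auto simp: flat_of_def)

lemma flat_of_0: "flat_of {0} = I"
  by (auto simp: flat_of_def mem_kernel_plane dotp_0)

lemma mem_plane_inter:
  assumes "i \<in> I" "j \<in> I" "i \<noteq> j"
  shows "plane i \<inter> plane j = {c *s cross (a i) (a j) | c. True}"
proof -
  have "c *s cross (a i) (a j) \<in> plane i \<inter> plane j" for c
    by (simp add: mem_kernel_plane dotp_scale dotp_cross bracket_same)
  moreover have "\<exists>c. x = c *s cross (a i) (a j)" if "x \<in> plane i \<inter> plane j" for x
    using plane_intersection[OF cross_nonzero[OF assms], of x] that
    unfolding Int_iff mem_kernel_plane by metis
  ultimately show ?thesis by blast
qed

lemma plane_inter_subset:
  assumes "i \<in> I" "j \<in> I" "i \<noteq> j"
  shows "plane i \<inter> plane j \<subseteq> plane k \<longleftrightarrow> bracket (a i) (a j) (a k) = 0"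
proof -
  have "bracket (a i) (a j) (a k) = bracket (a k) (a i) (a j)"
    by (simp add: bracket_def algebra_simps)
  then show ?thesis
    unfolding mem_plane_inter[OF assms]
    by (auto simp: mem_kernel_plane dotp_scale dotp_cross)
qed

lemma flat_of_pair:
  assumes "i \<in> I" "j \<in> I" "i \<noteq> j"
  shows "flat_of (plane i \<inter> plane j) = (if \<exists>b\<in>\<B>. {i, j} \<subseteq> b then (THE b. b \<in> \<B> \<and> {i, j} \<subseteq> b) else
      {i, j})"
proof -
  have k: "k \<in> flat_of (plane i \<inter> plane j) \<longleftrightarrow> k \<in> I \<and> (k = i \<or> k = j \<or> (\<exists>b\<in>\<B>. {i, j, k} \<subseteq> b))" for k
  proof (cases "k = i \<or> k = j")
    case True
    then show ?thesis using assms by (auto simp: flat_of_def)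
  next
    case False
    then show ?thesis using bracket_iff[of i j k] plane_inter_subset[OF assms, of k] assms
      by (auto simp: flat_of_def)
  qed
  show ?thesis
  proof (cases "\<exists>b\<in>\<B>. {i, j} \<subseteq> b")
    case True
    then obtain b where b: "b \<in> \<B>" "i \<in> b" "j \<in> b" by blast
    have u: "b' = b" if "b' \<in> \<B>" "{i, j} \<subseteq> b'" for b'
      using block_eqI[of b' b i j] that b assms by blast
    have "(THE b. b \<in> \<B> \<and> {i, j} \<subseteq> b) = b" using the_block b assms by blast
    moreover have "flat_of (plane i \<inter> plane j) = b"
    proof (rule set_eqI)
      fix l
      have "(\<exists>b'\<in>\<B>. {i, j, l} \<subseteq> b') \<longleftrightarrow> l \<in> b"
      proof
        assume "\<exists>b'\<in>\<B>. {i, j, l} \<subseteq> b'"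
        then obtain b' where b': "b' \<in> \<B>" "{i, j, l} \<subseteq> b'" by (elim bexE)
        then have "b' = b" by (intro u) simp_all
        then show "l \<in> b" using b'(2) by simp
      next
        assume "l \<in> b"
        then show "\<exists>b'\<in>\<B>. {i, j, l} \<subseteq> b'" using b by (intro bexI[of _ b]) simp_all
      qed
      then show "l \<in> flat_of (plane i \<inter> plane j) \<longleftrightarrow> l \<in> b"
        using k[of l] b block_subset[OF b(1)] by auto
    qed
    ultimately show ?thesis using True by simp
  next
    case False
    then show ?thesis using k assms by auto
  qed
qed

lemma flat_of_pair_in_flats:
  assumes "i \<in> I" "j \<in> I" "i \<noteq> j"
  shows "flat_of (plane i \<inter> plane j) \<in> flats I \<B>"
proof (cases "\<exists>b\<in>\<B>. {i, j} \<subseteq> b")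
  case True
  then obtain b where b: "b \<in> \<B>" "i \<in> b" "j \<in> b" by blast
  have "(THE b. b \<in> \<B> \<and> {i, j} \<subseteq> b) = b" using the_block b assms by blast
  then have "flat_of (plane i \<inter> plane j) = b"
    by (simp only: flat_of_pair[OF assms] True if_True)
  then show ?thesis using b by (simp add: flats_def)
next
  case False
  then have "flat_of (plane i \<inter> plane j) = {i, j}"
    by (simp only: flat_of_pair[OF assms] False if_False)
  then show ?thesis using False assms by (simp add: flats_def)
qed

lemma Inter_planes_cases:
  assumes "J \<subseteq> I"
  shows "(\<Inter>i\<in>J. plane i) \<in> {UNIV, {0}} \<union> plane ` I \<union>
    {plane i \<inter> plane j | i j. i \<in> I \<and> j \<in> I \<and> i \<noteq> j}"
proof (cases "\<exists>i\<in>J. \<exists>j\<in>J. i \<noteq> j")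
  case True
  then obtain i j where ij: "i \<in> J" "j \<in> J" "i \<noteq> j" by blast
  then have I: "i \<in> I" "j \<in> I" using assms by auto
  show ?thesis
  proof (cases "\<forall>k\<in>J. plane i \<inter> plane j \<subseteq> plane k")
    case True
    then have "(\<Inter>i\<in>J. plane i) = plane i \<inter> plane j" using ij by blast
    then show ?thesis using I ij by blast
  next
    case False
    then obtain k where k: "k \<in> J" "bracket (a i) (a j) (a k) \<noteq> 0"
      using plane_inter_subset I ij by blast
    have "x = 0" if x: "x \<in> (\<Inter>i\<in>J. plane i)" for x
    proof -
      have "x \<in> plane i \<inter> plane j" using x ij by blast
      then obtain c where c: "x = c *s cross (a i) (a j)"
        unfolding mem_plane_inter[OF I ij(3)] by blast
      have "x \<in> plane k" using x k by blast
      then have "c * bracket (a k) (a i) (a j) = 0"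
        by (simp add: c mem_kernel_plane dotp_scale dotp_cross)
      moreover have "bracket (a k) (a i) (a j) = bracket (a i) (a j) (a k)"
        by (simp add: bracket_def algebra_simps)
      ultimately show ?thesis using k c by simp
    qed
    moreover have "0 \<in> (\<Inter>i\<in>J. plane i)" by (simp add: mem_kernel_plane dotp_0)
    ultimately have "(\<Inter>i\<in>J. plane i) = {0}" by blast
    then show ?thesis by simp
  qed
next
  case False
  then have "J = {} \<or> (\<exists>i. J = {i})" by blast
  then show ?thesis using assms by auto
qed

lemma Field_lattice: "Field (intersection_lattice (plane ` I)) = {\<Inter>i\<in>J. plane i | J. J \<subseteq> I}"
  unfolding Field_intersection_lattice by (auto simp: subset_image_iff)

lemma lattice_element:
  assumes "X \<in> Field (intersection_lattice (plane ` I))"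
  shows "X = (\<Inter>i\<in>flat_of X. plane i)"
proof -
  obtain J where J: "J \<subseteq> I" "X = (\<Inter>i\<in>J. plane i)" using assms unfolding Field_lattice by blast
  then have "J \<subseteq> flat_of X" by (auto simp: flat_of_def)
  moreover have "X \<subseteq> (\<Inter>i\<in>flat_of X. plane i)" by (auto simp: flat_of_def)
  ultimately show ?thesis using J by blast
qed

lemma zero_in_lattice: "{0} \<in> Field (intersection_lattice (plane ` I))"
proof -
  obtain i j where ij: "i \<in> I" "j \<in> I" "i \<noteq> j" using two_points by blast
  obtain k where k: "k \<in> I" "k \<noteq> i" "k \<noteq> j" "\<forall>b\<in>\<B>. \<not> {i, j, k} \<subseteq> b"
    using off_block[OF ij] by blast
  have "\<not> plane i \<inter> plane j \<subseteq> plane k"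
    using bracket_iff[of i j k] ij k by (auto simp: plane_inter_subset[OF ij])
  moreover have "(\<Inter>l\<in>I. plane l) \<subseteq> plane i" "(\<Inter>l\<in>I. plane l) \<subseteq> plane j" "(\<Inter>l\<in>I. plane l) \<subseteq> plane k"
    using ij k by auto
  moreover have "0 \<in> plane l" for l by (simp add: mem_kernel_plane dotp_0)
  ultimately have "(\<Inter>i\<in>I. plane i) = {0}"
  proof -
    have "x = 0" if x: "x \<in> (\<Inter>i\<in>I. plane i)" for x
    proof -
      have "x \<in> plane i \<inter> plane j" "x \<in> plane k" using x ij k by auto
      then obtain c where c: "x = c *s cross (a i) (a j)"
        unfolding mem_plane_inter[OF ij] by blast
      have "c * bracket (a k) (a i) (a j) = 0"
        using \<open>x \<in> plane k\<close> by (simp add: c mem_kernel_plane dotp_scale dotp_cross)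
      moreover have "bracket (a k) (a i) (a j) = bracket (a i) (a j) (a k)"
        by (simp add: bracket_def algebra_simps)
      moreover have "bracket (a i) (a j) (a k) \<noteq> 0"
        using \<open>\<not> plane i \<inter> plane j \<subseteq> plane k\<close> plane_inter_subset[OF ij] by blast
      ultimately show ?thesis using c by simp
    qed
    then show ?thesis using \<open>\<And>l. 0 \<in> plane l\<close> by blast
  qed
  then show ?thesis unfolding Field_lattice by blast
qed

text \<open>Every lattice element is the intersection of the planes containing it, which makes
  \<open>flat_of\<close> injective and order reflecting; the vanishing brackets decide which index
  sets occur.\<close>

theorem lattice_iso: "poset_iso (intersection_lattice (plane ` I)) (block_lattice I \<B>) flat_of"
proof -
  let ?F = "Field (intersection_lattice (plane ` I))"
  have "flat_of X \<in> flats I \<B>" if "X \<in> ?F" for X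
  proof -
    obtain J where "J \<subseteq> I" "X = (\<Inter>i\<in>J. plane i)" using \<open>X \<in> ?F\<close> unfolding Field_lattice by blast
    then have "X \<in> {UNIV, {0}} \<union> plane ` I \<union> {plane i \<inter> plane j | i j. i \<in> I \<and> j \<in> I \<and> i \<noteq> j}"
      using Inter_planes_cases by blast
    then show ?thesis
      using flat_of_pair_in_flats
      by (auto simp: flat_of_UNIV flat_of_0 flat_of_plane) (auto simp: flats_def)
  qed
  moreover have "\<exists>X\<in>?F. flat_of X = y" if y: "y \<in> flats I \<B>" for y
  proof -
    have pair: "plane i \<inter> plane j \<in> ?F" if "i \<in> I" "j \<in> I" for i j
      unfolding Field_lattice using that by (intro CollectI exI[of _ "{i, j}"]) auto
    consider "y = {}" | "y = I" | i where "i \<in> I" "y = {i}" | "y \<in> \<B>"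
      | "y \<subseteq> I" "card y = 2" "\<not> (\<exists>B\<in>\<B>. y \<subseteq> B)"
      using y by (auto simp: flats_def)
    then show ?thesis
    proof cases
      case 1
      have "UNIV \<in> ?F" unfolding Field_lattice by (intro CollectI exI[of _ "{}"]) auto
      then show ?thesis using 1 flat_of_UNIV by blast
    next
      case 2
      then show ?thesis using zero_in_lattice flat_of_0 by blast
    next
      case 3
      have "plane i \<in> ?F" unfolding Field_lattice using 3 by (intro CollectI exI[of _ "{i}"]) auto
      then show ?thesis using 3 flat_of_plane by blast
    next
      case 4
      obtain i j where ij: "i \<in> y" "j \<in> y" "i \<noteq> j" using block_two_points[OF 4] .
      then have I: "i \<in> I" "j \<in> I" using block_subset[OF 4] by auto
      have "(THE b. b \<in> \<B> \<and> {i, j} \<subseteq> b) = y"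
        using the_block 4 ij by blast
      then have "flat_of (plane i \<inter> plane j) = y"
        using flat_of_pair[OF I ij(3)] 4 ij by auto
      then show ?thesis using pair I by blast
    next
      case 5
      obtain i j where ij: "y = {i, j}" "i \<noteq> j" using 5(2) by (auto simp: card_2_iff)
      then have I: "i \<in> I" "j \<in> I" using 5(1) by auto
      have "flat_of (plane i \<inter> plane j) = y"
        using 5(3) by (simp only: flat_of_pair[OF I ij(2)] ij(1) if_False)
      then show ?thesis using pair[OF I] by (rule bexI)
    qed
  qed
  ultimately have im: "flat_of ` ?F = flats I \<B>" by blast
  have inj: "inj_on flat_of ?F"
  proof (rule inj_onI)
    fix X Y assume "X \<in> ?F" "Y \<in> ?F" "flat_of X = flat_of Y"
    then show "X = Y" using lattice_element[of X] lattice_element[of Y] by simp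
  qed
  have "(X, Y) \<in> intersection_lattice (plane ` I) \<longleftrightarrow> (flat_of X, flat_of Y) \<in> block_lattice I \<B>"
    if X: "X \<in> ?F" and Y: "Y \<in> ?F" for X Y
  proof -
    have "Y \<subseteq> X \<longleftrightarrow> flat_of X \<subseteq> flat_of Y"
    proof
      assume "Y \<subseteq> X" then show "flat_of X \<subseteq> flat_of Y" by (auto simp: flat_of_def)
    next
      assume "flat_of X \<subseteq> flat_of Y"
      then have "(\<Inter>i\<in>flat_of Y. plane i) \<subseteq> (\<Inter>i\<in>flat_of X. plane i)" by blast
      then show "Y \<subseteq> X" using lattice_element[OF X] lattice_element[OF Y] by simp
    qed
    moreover have "flat_of X \<in> flats I \<B>" "flat_of Y \<in> flats I \<B>"
      using im X Y by auto
    ultimately show ?thesis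
      using X Y by (simp only: mem_intersection_lattice mem_block_lattice simp_thms)
  qed
  then show ?thesis
    using im inj by (simp add: poset_iso_def bij_betw_def Field_block_lattice)
qed

theorem planes_in_realizations: "plane ` I \<in> realizations (block_lattice I \<B>)"
proof -
  have "arrangement (plane ` I)"
    using finite_points subspace_kernel_plane dim_kernel_plane form_nonzero
    by (auto simp: arrangement_def)
  moreover have "card (plane ` I) = card (rank_part (block_lattice I \<B>) 1)"
    unfolding card_rank_part_block_lattice by (rule card_image[OF inj_plane])
  moreover have "flat_of ` plane ` I = rank_part (block_lattice I \<B>) 1"
    unfolding rank_part_block_lattice using flat_of_plane by (auto simp: image_iff)
  ultimately show ?thesis
    using lattice_iso unfolding realizations_def by blast
qed

end

section \<open>From an abstract realization to labelled forms\<close>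

lemma parallel_if_cross_0:
  fixes a b :: "'a::field ^ 3"
  assumes "cross a b = 0" "a \<noteq> 0" "b \<noteq> 0"
  shows "kernel_plane a = kernel_plane b"
proof -
  obtain w where w: "dotp a w = 1" using ex_dotp_eq_1[OF assms(2)] .
  have "dotp w b *s a - dotp w a *s b = 0"
    using assms(1) by (metis cross_cross cross_0(1))
  then have "b = dotp w b *s a" using w by (simp add: dotp_commute[of w a])
  then show ?thesis using kernel_plane_scale assms(3) by (metis vec.scale_zero_left)
qed

text \<open>The isomorphism labels the planes by the atoms. Three planes meet in a line exactly if
  the flat of two of them contains the third label without being the top, and a flat with three
  labels other than the top is a block.\<close>

theorem (in block_system) realizations_obtain:
  fixes A :: "'a::field arrangement"
  assumes A: "A \<in> realizations (block_lattice I \<B>)" and ne: "\<B> \<noteq> {}"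
  obtains a where "realizes I \<B> a" "A = (\<lambda>i. kernel_plane (a i)) ` I"
proof -
  let ?S = "Field (intersection_lattice A)"
  obtain f where arr: "arrangement A"
      and iso: "poset_iso (intersection_lattice A) (block_lattice I \<B>) f"
    and fA: "f ` A = {{i} | i. i \<in> I}"
    using A unfolding realizations_def rank_part_block_lattice by blast
  have inj: "inj_on f ?S" and im: "f ` ?S = flats I \<B>"
    and ord': "\<And>X Y. X \<in> ?S \<Longrightarrow> Y \<in> ?S \<Longrightarrow>
      (X, Y) \<in> intersection_lattice A \<longleftrightarrow> (f X, f Y) \<in> block_lattice I \<B>"
    using iso unfolding poset_iso_def bij_betw_def Field_block_lattice by blast+
  have ord: "Y \<subseteq> X \<longleftrightarrow> f X \<subseteq> f Y" if "X \<in> ?S" "Y \<in> ?S" for X Y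
  proof -
    have "f X \<in> flats I \<B>" "f Y \<in> flats I \<B>" using im that by auto
    then show ?thesis
      using ord'[OF that] that by (simp only: mem_intersection_lattice mem_block_lattice simp_thms)
  qed
  have AS: "A \<subseteq> ?S"
  proof
    fix H assume "H \<in> A"
    then have "H = \<Inter>{H} \<and> {H} \<subseteq> A" by simp
    then show "H \<in> ?S" unfolding Field_intersection_lattice by blast
  qed
  have "\<exists>H\<in>A. f H = {i}" if "i \<in> I" for i
  proof -
    have "{i} \<in> f ` A" unfolding fA using that by blast
    then show ?thesis by (elim imageE) (simp, metis)
  qed
  then obtain H where H: "\<And>i. i \<in> I \<Longrightarrow> H i \<in> A" "\<And>i. i \<in> I \<Longrightarrow> f (H i) = {i}" by metis
  have "\<exists>v. v \<noteq> 0 \<and> H i = kernel_plane v" if "i \<in> I" for i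
    using plane_is_kernel H(1)[OF that] arr unfolding arrangement_def by metis
  then obtain a where a: "\<And>i. i \<in> I \<Longrightarrow> a i \<noteq> 0" "\<And>i. i \<in> I \<Longrightarrow> H i = kernel_plane (a i)"
    by metis
  have AH: "A = H ` I"
  proof
    show "H ` I \<subseteq> A" using H by blast
    show "A \<subseteq> H ` I"
    proof
      fix K assume K: "K \<in> A"
      then have "f K \<in> {{i} | i. i \<in> I}" unfolding fA[symmetric] by (rule imageI)
      then obtain i where i: "i \<in> I" "f K = {i}" by auto
      then have "K = H i" using inj H AS K by (metis inj_onD subsetD)
      then show "K \<in> H ` I" using i by blast
    qed
  qed
  have Hi: "X \<subseteq> H i \<longleftrightarrow> i \<in> f X" if "X \<in> ?S" "i \<in> I" for X i
    using ord[of "H i" X] H that AS by auto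
  have surj: "\<exists>X\<in>?S. f X = y" if "y \<in> flats I \<B>" for y
  proof -
    have "y \<in> f ` ?S" using im that by (simp only:)
    then show ?thesis by (elim imageE) (rule bexI, rule sym)
  qed
  obtain T where T: "T \<in> ?S" "f T = I" using surj[of I] by (auto simp: flats_def)
  have zero: "0 \<in> T"
  proof -
    obtain B where "B \<subseteq> A" "T = \<Inter>B" using T(1) unfolding Field_intersection_lattice by blast
    then show ?thesis using a(2) by (auto simp: AH mem_kernel_plane dotp_0)
  qed
  have blk: "b \<in> flats I \<B>" if "b \<in> \<B>" for b using that by (simp add: flats_def)
  have bI: "\<not> I \<subseteq> b" if "b \<in> \<B>" for b
  proof -
    obtain i j where "i \<in> b" "j \<in> b" "i \<noteq> j" using block_two_points[OF \<open>b \<in> \<B>\<close>] .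
    then show ?thesis using off_block[of i j] block_subset[OF \<open>b \<in> \<B>\<close>] that by blast
  qed
  have cr: "cross (a i) (a j) \<noteq> 0" if ij: "i \<in> I" "j \<in> I" "i \<noteq> j" for i j
  proof
    assume "cross (a i) (a j) = 0"
    then have "H i = H j" using parallel_if_cross_0 a ij by metis
    then show False using H(2) ij by (metis singleton_inject)
  qed
  have "bracket (a i) (a j) (a k) = 0 \<longleftrightarrow> (\<exists>b\<in>\<B>. {i, j, k} \<subseteq> b)"
    if I: "i \<in> I" "j \<in> I" "k \<in> I" and d: "i \<noteq> j" "i \<noteq> k" "j \<noteq> k" for i j k
  proof
    assume "\<exists>b\<in>\<B>. {i, j, k} \<subseteq> b"
    then obtain b where b: "b \<in> \<B>" "i \<in> b" "j \<in> b" "k \<in> b" by blast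
    obtain X where X: "X \<in> ?S" "f X = b" using surj[OF blk[OF b(1)]] by blast
    \<comment> \<open>The block is not the top, so its lattice element is not contained in the least
      intersection \<open>T\<close>, and hence has a nonzero vector.\<close>
    have "\<not> X \<subseteq> T" using ord[OF T(1) X(1)] bI[OF b(1)] X T by simp
    then obtain x where x: "x \<in> X" "x \<noteq> 0" using zero by auto
    have "x \<in> H i" "x \<in> H j" "x \<in> H k" using Hi[OF X(1)] I b X(2) x by auto
    then have "dotp x (a i) = 0" "dotp x (a j) = 0" "dotp x (a k) = 0"
      using a(2) I by (auto simp: mem_kernel_plane dotp_commute[of x])
    then show "bracket (a i) (a j) (a k) = 0" by (rule bracket_eq_0_of_plane[OF x(2)])
  next
    assume br: "bracket (a i) (a j) (a k) = 0"
    have X: "H i \<inter> H j \<in> ?S"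
    proof -
      have "H i \<inter> H j = \<Inter>{H i, H j} \<and> {H i, H j} \<subseteq> A" using H I by simp
      then show ?thesis unfolding Field_intersection_lattice by blast
    qed
    have "H i \<inter> H j \<subseteq> H k"
    proof
      fix x assume "x \<in> H i \<inter> H j"
      then obtain c where "x = c *s cross (a i) (a j)"
        using plane_intersection[OF cr[OF I(1,2) d(1)]] a(2) I by (metis IntE mem_kernel_plane)
      moreover have "bracket (a k) (a i) (a j) = bracket (a i) (a j) (a k)"
        by (simp add: bracket_def algebra_simps)
      ultimately show "x \<in> H k"
        using br a(2) I by (simp add: mem_kernel_plane dotp_scale dotp_cross)
    qed
    then have sub: "{i, j, k} \<subseteq> f (H i \<inter> H j)" using Hi[OF X] I by auto
    have fX: "f (H i \<inter> H j) \<in> flats I \<B>" using im X by blast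
    \<comment> \<open>Otherwise \<open>T\<close> would be a line contained in all planes. The
      element of any block lies in two planes, hence in that line, hence in \<open>T\<close>, and
      the block would contain all of \<open>I\<close>; \<open>ne\<close> supplies a block.\<close>
    have "f (H i \<inter> H j) \<noteq> I"
    proof
      assume eq: "f (H i \<inter> H j) = I"
      have HT: "H i \<inter> H j = T" using inj X T eq by (metis inj_onD)
      obtain b where b: "b \<in> \<B>" using ne by blast
      obtain i' j' where b': "i' \<in> b" "j' \<in> b" "i' \<noteq> j'" using block_two_points[OF b] .
      have I': "i' \<in> I" "j' \<in> I" using b' block_subset[OF b] by auto
      obtain X' where X': "X' \<in> ?S" "f X' = b" using surj[OF blk[OF b]] by blast
      define p where "p = cross (a i) (a j)"
      have p: "p \<noteq> 0" "p \<in> T"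
        unfolding HT[symmetric] p_def using cr I d a(2)
        by (auto simp: mem_kernel_plane dotp_cross bracket_same)
      have "p \<in> H i'" "p \<in> H j'" using Hi[OF T(1)] T(2) I' p by auto
      then obtain c2 where c2: "p = c2 *s cross (a i') (a j')"
        using plane_intersection[OF cr[OF I' b'(3)]] a(2) I' by (metis mem_kernel_plane)
      have "x \<in> T" if "x \<in> X'" for x
      proof -
        have "x \<in> H i'" "x \<in> H j'" using Hi[OF X'(1)] X'(2) I' b' that by auto
        then obtain c1 where c1: "x = c1 *s cross (a i') (a j')"
          using plane_intersection[OF cr[OF I' b'(3)]] a(2) I' by (metis mem_kernel_plane)
        have "c2 \<noteq> 0" using p c2 by auto
        then have "x = (c1 / c2) *s p" by (simp add: c1 c2)
        then show ?thesis
          using p(2) a(2) I unfolding HT[symmetric] by (simp add: mem_kernel_plane dotp_scale)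
      qed
      then have "I \<subseteq> b" using ord[OF T(1) X'(1)] X' T by auto
      then show False using bI[OF b] by blast
    qed
    moreover have "card (f (H i \<inter> H j)) \<noteq> 2"
    proof -
      have "f (H i \<inter> H j) \<subseteq> I" using fX block_subset by (auto simp: flats_def)
      then have "finite (f (H i \<inter> H j))" using finite_points by (rule finite_subset)
      then have "card {i, j, k} \<le> card (f (H i \<inter> H j))" using sub by (rule card_mono)
      then show ?thesis using d by simp
    qed
    moreover have "f (H i \<inter> H j) \<noteq> {}" "f (H i \<inter> H j) \<notin> {{i} | i. i \<in> I}"
      using sub d by auto
    ultimately have "f (H i \<inter> H j) \<in> \<B>" using fX unfolding flats_def by blast
    then show "\<exists>b\<in>\<B>. {i, j, k} \<subseteq> b" using sub by blast
  qed
  then have "realizes I \<B> a" unfolding realizes_def by blast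
  moreover have "A = (\<lambda>i. kernel_plane (a i)) ` I" using AH a(2) by auto
  ultimately show thesis by (rule that)
qed

section \<open>Dimension of spaces with finite proper closed subsets\<close>

text \<open>An irreducible finite set with closed points is a single point, and an infinite space is
  not the union of two finite sets. So the longest chains are a point inside the whole
  space.\<close>

lemma krull_dim_eq_1:
  assumes fin: "\<And>C. closedin X C \<Longrightarrow> C \<noteq> topspace X \<Longrightarrow> finite C"
    and pt: "\<And>x. x \<in> topspace X \<Longrightarrow> closedin X {x}"
    and inf: "infinite (topspace X)"
  shows "krull_dim X = 1"
proof -
  have single: "\<exists>x. Z = {x}" if Z: "irreducible_closedin X Z" "Z \<noteq> topspace X" for Z
  proof -
    have cl: "closedin X Z" and ne: "Z \<noteq> {}"
      and irr: "\<And>C D. closedin X C \<Longrightarrow> closedin X D \<Longrightarrow> Z \<subseteq> C \<union> D \<Longrightarrow> Z \<subseteq> C \<or> Z \<subseteq> D"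
      using Z(1) unfolding irreducible_closedin_def by auto
    have finZ: "finite Z" by (rule fin[OF cl Z(2)])
    have sub: "Z \<subseteq> topspace X" using cl by (rule closedin_subset)
    obtain x where x: "x \<in> Z" using ne by blast
    have "closedin X (\<Union>y\<in>Z - {x}. {y})"
      using finZ sub pt by (intro closedin_Union) auto
    then have "closedin X (Z - {x})" by simp
    moreover have "closedin X {x}" using pt sub x by blast
    moreover have "Z \<subseteq> {x} \<union> (Z - {x})" by blast
    ultimately have "Z \<subseteq> {x} \<or> Z \<subseteq> Z - {x}" by (intro irr)
    then have "Z = {x}" using x by blast
    then show ?thesis by blast
  qed
  have whole: "irreducible_closedin X (topspace X)"
  proof -
    have "C = topspace X \<or> D = topspace X"
      if "closedin X C" "closedin X D" "topspace X \<subseteq> C \<union> D" for C D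
      using fin[OF that(1)] fin[OF that(2)] that(3) inf finite_subset[OF that(3)] by blast
    moreover have "topspace X \<noteq> {}" using inf by auto
    ultimately show ?thesis unfolding irreducible_closedin_def by blast
  qed
  obtain x where x: "x \<in> topspace X" using inf by fastforce
  define S where "S = {ereal (real n) | n. \<exists>Z :: nat \<Rightarrow> 'a set.
            (\<forall>i\<le>n. irreducible_closedin X (Z i)) \<and> (\<forall>i<n. Z i \<subset> Z (Suc i))}"
  have "n \<le> 1" if Z: "\<forall>i\<le>n. irreducible_closedin X (Z i)" "\<forall>i<n. Z i \<subset> Z (Suc i)"
    for n and Z :: "nat \<Rightarrow> 'a set"
  proof (rule ccontr)
    assume "\<not> n \<le> 1"
    then have i: "irreducible_closedin X (Z 0)" "irreducible_closedin X (Z 1)"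
      "irreducible_closedin X (Z 2)" "Z 0 \<subset> Z 1" "Z 1 \<subset> Z 2"
      using Z(1) Z(2)[rule_format, of 0] Z(2)[rule_format, of 1] by (auto simp: numeral_2_eq_2)
    then have "Z 2 \<subseteq> topspace X" by (simp add: irreducible_closedin_def closedin_subset)
    then have "Z 1 \<noteq> topspace X" using i(5) by blast
    then obtain y where "Z 1 = {y}" using single i(2) by blast
    then have "Z 0 = {}" using i(4) by auto
    then show False using i(1) by (simp add: irreducible_closedin_def)
  qed
  then have le: "s \<le> 1" if "s \<in> S" for s
    using that unfolding S_def by force
  have "ereal (real 1) \<in> S"
    unfolding S_def
  proof (intro CollectI exI conjI allI impI)
    let ?Z = "\<lambda>i :: nat. if i = 0 then {x} else topspace X"
    have sx: "irreducible_closedin X {x}"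
      using pt[OF x] by (auto simp: irreducible_closedin_def)
    show "irreducible_closedin X (?Z i)" for i using sx whole by simp
    show "?Z i \<subset> ?Z (Suc i)" if "i < 1" for i
    proof -
      have "topspace X \<noteq> {x}" using inf by auto
      then show ?thesis using that x by auto
    qed
  qed simp
  then have "1 \<in> S" by (simp flip: one_ereal_def)
  then have "Sup S = 1" using le by (intro Sup_eqI) auto
  then show ?thesis by (simp add: krull_dim_def S_def)
qed

section \<open>Linear changes of coordinates\<close>

text \<open>The form \<open>v\<close> composed with \<open>g\<close>, that is, the row
  \<open>v\<close> times the matrix; an invertible \<open>g\<close> carries the plane of
  \<open>pull g v\<close> onto the plane of \<open>v\<close>.\<close>

definition pull :: "'a::field ^ 3 ^ 3 \<Rightarrow> 'a ^ 3 \<Rightarrow> 'a ^ 3" where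
  "pull g v = v $ 1 *s g $ 1 + v $ 2 *s g $ 2 + v $ 3 *s g $ 3"

lemma dotp_pull: "dotp (pull g v) x = dotp v (g *v x)"
  by (simp add: pull_def dotp_3 matrix_vector_mult_def sum_3 algebra_simps)

lemma bracket_pull: "bracket (pull g u) (pull g v) (pull g w) = bracket u v w * bracket (g $ 1) (g
    $ 2) (g $ 3)"
  unfolding pull_def by (rule bracket_linear_combination)

lemma invertible_iff_bracket: "invertible g \<longleftrightarrow> bracket (g $ 1) (g $ 2) (g $ 3) \<noteq> 0"
  for g :: "'a::field ^ 3 ^ 3"
proof -
  have "det g = bracket (g $ 1) (g $ 2) (g $ 3)"
    by (simp add: det_3 bracket_def algebra_simps)
  then show ?thesis by (simp add: invertible_det_nz)
qed

lemma kernel_plane_pull: "x \<in> kernel_plane (pull g v) \<longleftrightarrow> g *v x \<in> kernel_plane v"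
  by (simp add: mem_kernel_plane dotp_pull)

lemma image_kernel_plane_pull:
  assumes "invertible g"
  shows "(*v) g ` kernel_plane (pull g v) = kernel_plane v"
proof -
  obtain h where h: "g ** h = mat 1" using assms unfolding invertible_def by blast
  have "x \<in> (*v) g ` kernel_plane (pull g v)" if "x \<in> kernel_plane v" for x
  proof -
    have "g *v (h *v x) = x" by (simp add: matrix_vector_mul_assoc h)
    then show ?thesis using that
        by (intro image_eqI[of _ _ "h *v x"]) (auto simp: kernel_plane_pull)
  qed
  then show ?thesis by (auto simp: kernel_plane_pull)
qed

lemma kernel_plane_eq_iff:
  fixes a b :: "'a::field ^ 3"
  assumes "a \<noteq> 0"
  shows "kernel_plane b = kernel_plane a \<longleftrightarrow> (\<exists>c. c \<noteq> 0 \<and> b = c *s a)"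
proof
  assume eq: "kernel_plane b = kernel_plane a"
  then obtain c where c: "b = c *s a" using kernel_plane_subset_imp[of a b] assms by blast
  have "b \<noteq> 0"
  proof
    assume "b = 0"
    obtain w where "dotp a w = 1" using ex_dotp_eq_1[OF assms] .
    moreover have "w \<in> kernel_plane b" by (simp add: \<open>b = 0\<close> mem_kernel_plane dotp_0)
    ultimately show False using eq by (simp add: mem_kernel_plane)
  qed
  then show "\<exists>c. c \<noteq> 0 \<and> b = c *s a" using c by auto
qed (auto simp: kernel_plane_scale)

lemma realizes_scale_pull:
  assumes "realizes I \<B> a" "invertible g" "\<And>i. i \<in> I \<Longrightarrow> k i \<noteq> 0 \<and> b i = k i *s pull g (a i)"
  shows "realizes I \<B> b"
  unfolding realizes_def
proof (intro ballI impI)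
  fix i j l assume *: "i \<in> I" "j \<in> I" "l \<in> I" "i \<noteq> j \<and> i \<noteq> l \<and> j \<noteq> l"
  have "bracket (b i) (b j) (b l) = k i * k j * k l * bracket (g $ 1) (g $ 2) (g $ 3) * bracket (a
      i) (a j) (a l)"
    using assms(3) * by (simp add: bracket_scale bracket_pull)
  then have "bracket (b i) (b j) (b l) = 0 \<longleftrightarrow> bracket (a i) (a j) (a l) = 0"
    using assms(2,3) * by (simp add: invertible_iff_bracket)
  then show "bracket (b i) (b j) (b l) = 0 \<longleftrightarrow> (\<exists>b\<in>\<B>. {i, j, l} \<subseteq> b)"
    using assms(1) * unfolding realizes_def by blast
qed

lemma pull_mat_1: "pull (mat 1) v = v"
  unfolding vec_eq_iff forall_3 by (simp add: pull_def mat_def)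

lemma realizes_scale:
  fixes a b :: "nat \<Rightarrow> 'a::field ^ 3"
  assumes "realizes I \<B> a" "\<And>i. i \<in> I \<Longrightarrow> k i \<noteq> 0 \<and> b i = k i *s a i"
  shows "realizes I \<B> b"
  by (rule realizes_scale_pull[where g = "mat 1" and k = k, OF assms(1)])
    (use assms(2) in \<open>auto simp: pull_mat_1 invertible_det_nz\<close>)

lemma proj_equiv_refl: "(A, A) \<in> proj_equiv"
  unfolding proj_equiv_def by (auto intro!: exI[of _ "mat 1"] simp: invertible_det_nz)

lemma proj_equiv_sym:
  assumes "(A, B) \<in> proj_equiv"
  shows "(B, A) \<in> proj_equiv"
proof -
  obtain g where g: "invertible g" "B = (\<lambda>H. (*v) g ` H) ` A"
    using assms by (auto simp: proj_equiv_def)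
  obtain h where h: "g ** h = mat 1" "h ** g = mat 1" using g(1) unfolding invertible_def by blast
  have "(\<lambda>H. (*v) h ` H) ` B = A"
    by (simp add: g(2) image_image matrix_vector_mul_assoc h)
  moreover have "invertible h" using h unfolding invertible_def by blast
  ultimately show ?thesis unfolding proj_equiv_def by blast
qed

lemma proj_equiv_trans:
  assumes "(A, B) \<in> proj_equiv" "(B, C) \<in> proj_equiv"
  shows "(A, C) \<in> proj_equiv"
proof -
  obtain g where g: "invertible g" "B = (\<lambda>H. (*v) g ` H) ` A"
    using assms by (auto simp: proj_equiv_def)
  obtain h where h: "invertible h" "C = (\<lambda>H. (*v) h ` H) ` B"
    using assms by (auto simp: proj_equiv_def)
  have "C = (\<lambda>H. (*v) (h ** g) ` H) ` A"
    by (simp add: g(2) h(2) image_image matrix_vector_mul_assoc)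
  then show ?thesis unfolding proj_equiv_def using invertible_mult[OF h(1) g(1)] by blast
qed

lemma equiv_proj_equiv: "equiv R (Restr proj_equiv R)"
  by (rule equivI) (auto simp: refl_on_def sym_def trans_def
      intro: proj_equiv_refl proj_equiv_sym proj_equiv_trans)

lemma class_eq_iff:
  assumes "A \<in> R" "B \<in> R"
  shows "Restr proj_equiv R `` {A} = Restr proj_equiv R `` {B} \<longleftrightarrow> (A, B) \<in> proj_equiv"
  using eq_equiv_class_iff[OF equiv_proj_equiv assms] assms by blast

section \<open>Zariski topology\<close>

lemma closedin_zariski_zero:
  assumes "polyfn (\<lambda>v c. c v) h"
  shows "closedin zariski_topology {c. h c = (0 :: 'a::field)}"
proof -
  obtain p where p: "h = (\<lambda>c. mpoly_eval p (\<lambda>v. c v))" using assms by (auto simp: polyfn_iff_mpoly)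
  have "openin zariski_topology {c. mpoly_eval p c \<noteq> 0}"
    unfolding zariski_topology_def by (rule topology_generated_by_Basis) simp
  moreover have "topspace zariski_topology - {c. h c = 0} = {c. mpoly_eval p c \<noteq> 0}"
    by (auto simp: p)
  ultimately show ?thesis by (simp add: closedin_def)
qed

lemma closedin_zariski_zeros:
  assumes "\<And>h. h \<in> S \<Longrightarrow> polyfn (\<lambda>v c. c v) h"
  shows "closedin zariski_topology {c. \<forall>h\<in>S. h c = (0 :: 'a::field)}"
proof (cases "S = {}")
  case True
  then show ?thesis using closedin_topspace[of "zariski_topology :: ('b \<Rightarrow> 'a) topology"] by simp
next
  case False
  have "closedin zariski_topology (\<Inter>h\<in>S. {c. h c = 0})"
    using False assms closedin_zariski_zero by (intro closedin_Inter) auto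
  moreover have "(\<Inter>h\<in>S. {c. h c = 0}) = {c. \<forall>h\<in>S. h c = 0}" by blast
  ultimately show ?thesis by simp
qed

text \<open>The preimage of a basic open set is the set of nonroots of a polynomial, thus empty or
  cofinite, and this dichotomy survives finite intersections and arbitrary unions.\<close>

lemma zariski_curve:
  fixes \<gamma> :: "'a::field_char_0 \<Rightarrow> 'v \<Rightarrow> 'a"
  assumes \<gamma>: "\<And>v. \<exists>q. \<forall>t. \<gamma> t v = poly q t" and C: "closedin zariski_topology C"
  shows "finite {t. \<gamma> t \<in> C} \<or> (\<forall>t. \<gamma> t \<in> C)"
proof -
  have pol: "\<exists>q. \<forall>t. mpoly_eval p (\<gamma> t) = poly q t" for p
  proof -
    obtain q where q: "\<And>v t. \<gamma> t v = poly (q v) t" using \<gamma> by metis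
    have "mpoly_eval p (\<gamma> t) = poly (\<Sum>m\<in>Poly_Mapping.keys p. [:Poly_Mapping.lookup p m:] *
        (\<Prod>v\<in>Poly_Mapping.keys m. q v ^ Poly_Mapping.lookup m v)) t" for t
      by (simp add: mpoly_eval_def poly_sum poly_prod q)
    then show ?thesis by blast
  qed
  have "{t. \<gamma> t \<in> W} = {} \<or> finite {t. \<gamma> t \<notin> W}" if "openin zariski_topology W" for W
    using that unfolding zariski_topology_def openin_topology_generated_by_iff
  proof induction
    case Empty
    then show ?case by simp
  next
    case (Int U V)
    have "{t. \<gamma> t \<notin> U \<inter> V} = {t. \<gamma> t \<notin> U} \<union> {t. \<gamma> t \<notin> V}" by blast
    then show ?case using Int.IH by auto
  next
    case (UN K)
    show ?case
    proof (cases "\<exists>W\<in>K. finite {t. \<gamma> t \<notin> W}")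
      case True
      then obtain W where "W \<in> K" "finite {t. \<gamma> t \<notin> W}" by blast
      then have "finite {t. \<gamma> t \<notin> \<Union>K}" by (elim rev_finite_subset) blast
      then show ?thesis by blast
    next
      case False
      then show ?thesis using UN.IH by blast
    qed
  next
    case (Basis W)
    then obtain p where p: "W = {x. mpoly_eval p x \<noteq> 0}" by blast
    obtain q where q: "\<And>t. mpoly_eval p (\<gamma> t) = poly q t" using pol by blast
    have W: "\<gamma> t \<in> W \<longleftrightarrow> poly q t \<noteq> 0" for t by (simp add: p q)
    show ?case by (cases "q = 0") (auto simp: W poly_roots_finite)
  qed
  moreover have "openin zariski_topology (UNIV - C)"
    using C by (simp add: closedin_def)
  ultimately have "{t. \<gamma> t \<in> UNIV - C} = {} \<or> finite {t. \<gamma> t \<notin> UNIV - C}" by blast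
  then show ?thesis by auto
qed

section \<open>Moduli spaces of one-parameter families\<close>

text \<open>The planes \<open>f1, \<dots>, f4\<close> form a projective frame, and the parameter of a realization is
  read off a further plane \<open>m\<close> as the ratio of its second and first coordinates in this frame.\<close>

definition param_num :: "nat \<Rightarrow> nat \<Rightarrow> nat \<Rightarrow> nat \<Rightarrow> nat \<Rightarrow> (nat \<Rightarrow> 'a::comm_ring_1 ^ 3) \<Rightarrow> 'a" where
  "param_num f1 f2 f3 f4 m b = bracket (b f1) (b m) (b f3) * bracket (b f4) (b f2) (b f3)"

definition param_den :: "nat \<Rightarrow> nat \<Rightarrow> nat \<Rightarrow> nat \<Rightarrow> nat \<Rightarrow> (nat \<Rightarrow> 'a::comm_ring_1 ^ 3) \<Rightarrow> 'a" where
  "param_den f1 f2 f3 f4 m b = bracket (b m) (b f2) (b f3) * bracket (b f1) (b f4) (b f3)"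

definition std_frame :: "nat \<Rightarrow> nat \<Rightarrow> nat \<Rightarrow> nat \<Rightarrow> (nat \<Rightarrow> 'a::comm_ring_1 ^ 3) \<Rightarrow> bool" where
  "std_frame f1 f2 f3 f4 b \<longleftrightarrow> b f1 = vector [1, 0, 0] \<and> b f2 = vector [0, 1, 0] \<and>
     b f3 = vector [0, 0, 1] \<and> b f4 = vector [1, 1, 1]"

text \<open>Concurrences are demanded as polynomial identities in the parameter; for the other
  brackets one good parameter (\<open>nonempty\<close>) suffices. \<open>normal_form\<close> says
  that nothing else occurs in the standard frame.\<close>

locale family = block_system I \<B> for I :: "nat set" and \<B> :: "nat set set" +
  fixes p :: "nat \<Rightarrow> 'a::field_char_0 poly ^ 3" and f1 f2 f3 f4 m :: nat
  assumes blocks_nonempty: "\<B> \<noteq> {}"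
    and indices: "{f1, f2, f3, f4, m} \<subseteq> I" "distinct [f1, f2, f3, f4]" "distinct [m, f2, f3]"
    and generic: "\<And>b. b \<in> \<B> \<Longrightarrow> \<not> {f1, f2, f3} \<subseteq> b \<and> \<not> {f1, f2, f4} \<subseteq> b \<and>
        \<not> {f1, f3, f4} \<subseteq> b \<and> \<not> {f2, f3, f4} \<subseteq> b \<and> \<not> {m, f2, f3} \<subseteq> b"
    and frame: "std_frame f1 f2 f3 f4 (\<lambda>i. \<chi> j. poly (p i $ j) t)"
    and param: "poly (p m $ 1) t = 1" "poly (p m $ 2) t = t"
    and concurrent: "b \<in> \<B> \<Longrightarrow> {i, j, k} \<subseteq> b \<Longrightarrow> i \<noteq> j \<Longrightarrow> i \<noteq> k \<Longrightarrow> j \<noteq> k \<Longrightarrow>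
        bracket (p i) (p j) (p k) = 0"
    and nonempty: "\<exists>t. realizes I \<B> (\<lambda>i. \<chi> j. poly (p i $ j) t)"
    and normal_form: "\<And>b. realizes I \<B> b \<Longrightarrow> std_frame f1 f2 f3 f4 b \<Longrightarrow>
        \<exists>t. \<forall>i\<in>I. \<exists>c. b i = c *s (\<chi> j. poly (p i $ j) t)"
begin

abbreviation "n \<equiv> card I"

abbreviation "lat \<equiv> block_lattice I \<B>"

definition form :: "'a \<Rightarrow> nat \<Rightarrow> 'a ^ 3" where
  "form t i = (\<chi> j. poly (p i $ j) t)"

abbreviation "U \<equiv> {t. realizes I \<B> (form t)}"

abbreviation "num \<equiv> param_num f1 f2 f3 f4 m"
abbreviation "den \<equiv> param_den f1 f2 f3 f4 m"

lemma bracket_form: "bracket (form t i) (form t j) (form t k) = poly (bracket (p i) (p j) (p k)) t"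
  by (simp add: form_def bracket_def)

text \<open>An exceptional parameter is a root of one of finitely many brackets, those of triples in
  no block; each is a nonzero polynomial because it does not vanish at the parameter from
  \<open>nonempty\<close>.\<close>

lemma finite_exceptional: "finite (- U)"
proof -
  define T where "T = {(i, j, k). i \<in> I \<and> j \<in> I \<and> k \<in> I \<and> i \<noteq> j \<and> i \<noteq> k \<and> j \<noteq> k \<and>
    \<not> (\<exists>b\<in>\<B>. {i, j, k} \<subseteq> b)}"
  have "T \<subseteq> I \<times> I \<times> I" unfolding T_def by blast
  then have finT: "finite T" using finite_points by (auto intro: finite_subset)
  obtain t0 where t0: "realizes I \<B> (form t0)" using nonempty by (auto simp: form_def[abs_def])
  have nz: "bracket (p i) (p j) (p k) \<noteq> 0" if "(i, j, k) \<in> T" for i j k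
  proof -
    have "bracket (form t0 i) (form t0 j) (form t0 k) \<noteq> 0"
      using t0 that unfolding realizes_def T_def by blast
    then show ?thesis unfolding bracket_form by auto
  qed
  have "- U \<subseteq> (\<Union>(i, j, k)\<in>T. {t. poly (bracket (p i) (p j) (p k)) t = 0})"
  proof
    fix t assume "t \<in> - U"
    then have "\<not> realizes I \<B> (form t)" by simp
    then obtain i j k where ijk: "i \<in> I" "j \<in> I" "k \<in> I" "i \<noteq> j" "i \<noteq> k" "j \<noteq> k"
      "\<not> (bracket (form t i) (form t j) (form t k) = 0 \<longleftrightarrow> (\<exists>b\<in>\<B>. {i, j, k} \<subseteq> b))"
      unfolding realizes_def by blast
    have "\<not> (\<exists>b\<in>\<B>. {i, j, k} \<subseteq> b)"
      using ijk concurrent[of _ i j k] by (auto simp: bracket_form)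
    then have "(i, j, k) \<in> T" "poly (bracket (p i) (p j) (p k)) t = 0"
      using ijk by (auto simp: T_def bracket_form)
    then show "t \<in> (\<Union>(i, j, k)\<in>T. {t. poly (bracket (p i) (p j) (p k)) t = 0})" by blast
  qed
  moreover have "finite (\<Union>(i, j, k)\<in>T. {t. poly (bracket (p i) (p j) (p k)) t = 0})"
    using finT nz by (auto intro!: poly_roots_finite)
  ultimately show ?thesis by (rule finite_subset)
qed

lemma infinite_U: "infinite U"
  using finite_exceptional infinite_UNIV_char_0[where 'a = 'a] by (metis finite_compl)

lemma generic_bracket:
  assumes "realizes I \<B> b"
  shows "bracket (b f1) (b f2) (b f3) \<noteq> 0" "bracket (b f4) (b f2) (b f3) \<noteq> 0"
    "bracket (b f1) (b f4) (b f3) \<noteq> 0" "bracket (b f1) (b f2) (b f4) \<noteq> 0"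
    "bracket (b m) (b f2) (b f3) \<noteq> 0"
proof -
  have I: "f1 \<in> I" "f2 \<in> I" "f3 \<in> I" "f4 \<in> I" "m \<in> I" using indices(1) by auto
  note r = assms[unfolded realizes_def, rule_format]
  show "bracket (b f1) (b f2) (b f3) \<noteq> 0"
    using r[OF I(1,2,3)] indices(2) generic by auto
  show "bracket (b f4) (b f2) (b f3) \<noteq> 0"
    using r[OF I(4,2,3)] indices(2) generic by auto
  show "bracket (b f1) (b f4) (b f3) \<noteq> 0"
    using r[OF I(1,4,3)] indices(2) generic by auto
  show "bracket (b f1) (b f2) (b f4) \<noteq> 0"
    using r[OF I(1,2,4)] indices(2) generic by auto
  show "bracket (b m) (b f2) (b f3) \<noteq> 0"
    using r[OF I(5,2,3)] indices(3) generic by auto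
qed

lemma den_nonzero:
  fixes b :: "nat \<Rightarrow> 'a ^ 3"
  shows "realizes I \<B> b \<Longrightarrow> den b \<noteq> 0"
  using generic_bracket(3,5)[of b] by (simp add: param_den_def)

lemma param_form: "num (form t) = t * den (form t)"
  using frame[of t] param[of t] unfolding std_frame_def
  by (simp add: param_num_def param_den_def form_def[symmetric])
    (simp add: bracket_def form_def)

text \<open>Numerator and denominator contain \<open>f3\<close> twice and each of \<open>f1\<close>,
  \<open>f2\<close>, \<open>f4\<close>, \<open>m\<close> once, so rescalings and coordinate changes
  multiply both by the same factor: the parameter is an invariant of the labelled
  arrangement.\<close>

lemma param_transform:
  assumes "\<And>i. i \<in> I \<Longrightarrow> b i = k i *s pull g (a i)"
  shows "\<exists>c. num b = c * num a \<and> den b = c * den a"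
proof -
  have I: "f1 \<in> I" "f2 \<in> I" "f3 \<in> I" "f4 \<in> I" "m \<in> I" using indices(1) by auto
  let ?d = "bracket (g $ 1) (g $ 2) (g $ 3)"
  show ?thesis
    by (rule exI[of _ "k f1 * k m * k f3 * k f4 * k f2 * k f3 * ?d * ?d"])
      (simp add: param_num_def param_den_def assms[OF I(1)] assms[OF I(2)] assms[OF I(3)]
        assms[OF I(4)] assms[OF I(5)] bracket_scale bracket_pull)
qed

lemma classification:
  assumes b: "realizes I \<B> b"
  obtains t g k where "t \<in> U" "invertible g" "\<And>i. i \<in> I \<Longrightarrow> k i \<noteq> 0 \<and> b i = k i *s pull g (form t i)"
proof -
  note nz = generic_bracket[OF b]
  let ?d = "bracket (b f1) (b f2) (b f3)"
  \<comment> \<open>The coordinates of \<open>b f4\<close> in the basis \<open>b f1\<close>,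
    \<open>b f2\<close>, \<open>b f3\<close>; rows rescaled by them make \<open>pull g\<close> send
    \<open>[1, 1, 1]\<close> to \<open>b f4\<close>.\<close>
  define c1 c2 c3 where c: "c1 = bracket (b f4) (b f2) (b f3) / ?d"
    "c2 = bracket (b f1) (b f4) (b f3) / ?d" "c3 = bracket (b f1) (b f2) (b f4) / ?d"
  have c0: "c1 \<noteq> 0" "c2 \<noteq> 0" "c3 \<noteq> 0" using nz by (simp_all add: c)
  have "?d *s b f4 = bracket (b f4) (b f2) (b f3) *s b f1 + bracket (b f1) (b f4) (b f3) *s b f2 +
      bracket (b f1) (b f2) (b f4) *s b f3"
    by (rule bracket_cramer)
  then have f4: "b f4 = c1 *s b f1 + c2 *s b f2 + c3 *s b f3"
    using nz(1) by (simp add: c vec_eq_iff field_simps)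
  define g :: "'a ^ 3 ^ 3" where "g = vector [c1 *s b f1, c2 *s b f2, c3 *s b f3]"
  have g: "g $ 1 = c1 *s b f1" "g $ 2 = c2 *s b f2" "g $ 3 = c3 *s b f3"
    by (simp_all add: g_def)
  have inv: "invertible g"
    using nz(1) c0 by (simp add: invertible_iff_bracket g bracket_scale)
  \<comment> \<open>Cramer's rule gives the coordinates of the other forms up to a common
    determinant; the frame is set by hand, because \<open>std_frame\<close> asks for equality and
    not just proportionality.\<close>
  define e where "e i = (if i = f1 then vector [1, 0, 0] else if i = f2 then vector [0, 1, 0]
     else if i = f3 then vector [0, 0, 1] else if i = f4 then vector [1, 1, 1] else
     vector [bracket (b i) (g $ 2) (g $ 3), bracket (g $ 1) (b i) (g $ 3),
       bracket (g $ 1) (g $ 2) (b i)] :: 'a ^ 3)" for i :: nat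
  define l where "l i = (if i = f1 then 1 / c1 else if i = f2 then 1 / c2 else if i = f3 then 1 / c3
     else if i = f4 then 1 else 1 / bracket (g $ 1) (g $ 2) (g $ 3))" for i
  have l0: "l i \<noteq> 0" for i using c0 inv by (simp add: l_def invertible_iff_bracket)
  have be: "b i = l i *s pull g (e i)" for i
  proof -
    consider "i = f1" | "i = f2" | "i = f3" | "i = f4" | "i \<notin> {f1, f2, f3, f4}" by blast
    then show ?thesis
    proof cases
      case 5
      have "bracket (g $ 1) (g $ 2) (g $ 3) *s b i = pull g (e i)"
        using 5 bracket_cramer[of "g $ 1" "g $ 2" "g $ 3" "b i"] by (simp add: e_def pull_def)
      then have "l i *s pull g (e i) = (l i * bracket (g $ 1) (g $ 2) (g $ 3)) *s b i"
        by (metis vec.scale_scale)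
      then show ?thesis using 5 inv by (simp add: l_def invertible_iff_bracket)
    qed (use indices(2) c0 f4 in \<open>auto simp: e_def l_def pull_def g\<close>)
  qed
  obtain h where h: "h ** g = mat 1" "g ** h = mat 1" using inv unfolding invertible_def by blast
  have invh: "invertible h" using h unfolding invertible_def by blast
  have pullh: "pull h (pull g v) = v" for v
  proof -
    have "dotp (pull h (pull g v)) x = dotp v x" for x
      by (simp add: dotp_pull matrix_vector_mul_assoc h)
    then have "pull h (pull g v) $ i = v $ i" for i
      using dotp_axis[of _ i 1] by (metis mult.right_neutral)
    then show ?thesis by (simp add: vec_eq_iff)
  qed
  have pscale: "pull h (s *s v) = s *s pull h v" for s v
    by (simp add: pull_def vec_eq_iff algebra_simps)
  have "e i = (1 / l i) *s pull h (b i)" for i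
    using l0[of i] by (simp add: be[of i] pscale pullh)
  then have e_real: "realizes I \<B> e"
    by (intro realizes_scale_pull[OF b invh, of "\<lambda>i. 1 / l i"]) (use l0 in auto)
  moreover have "std_frame f1 f2 f3 f4 e"
    using indices(2) by (auto simp: std_frame_def e_def)
  ultimately obtain t where "\<forall>i\<in>I. \<exists>s. e i = s *s form t i"
    using normal_form[of e] unfolding form_def by blast
  then obtain s where s: "\<And>i. i \<in> I \<Longrightarrow> e i = s i *s form t i" by metis
  interpret E: realization I \<B> e by unfold_locales (rule e_real)
  have s0: "s i \<noteq> 0" if "i \<in> I" for i
    using E.form_nonzero[OF that] s[OF that] by auto
  have "realizes I \<B> (form t)"
    by (rule realizes_scale[OF e_real, of "\<lambda>i. 1 / s i"]) (use s s0 in auto)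
  moreover have "l i * s i \<noteq> 0 \<and> b i = (l i * s i) *s pull g (form t i)" if "i \<in> I" for i
    using be[of i] s[OF that] s0[OF that] l0[of i]
    by (simp add: pull_def vec_eq_iff algebra_simps)
  ultimately show thesis using inv that[of t g "\<lambda>i. l i * s i"] by simp
qed

subsection \<open>Coordinates\<close>

definition enum :: "nat \<Rightarrow> nat" where
  "enum = (SOME e. bij_betw e {..<n} I)"

definition coords :: "'a \<Rightarrow> nat \<times> 3 \<Rightarrow> 'a" where
  "coords t = (\<lambda>(i, j). if i < n then form t (enum i) $ j else 0)"

lemma enum_image: "enum ` {..<n} = I"
proof -
  have "\<exists>e. bij_betw e {..<n} I"
    using ex_bij_betw_nat_finite[OF finite_points] by (simp add: atLeast0LessThan)
  then have "bij_betw enum {..<n} I" unfolding enum_def by (rule someI_ex)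
  then show ?thesis by (simp add: bij_betw_def)
qed

definition forms_at :: "(nat \<Rightarrow> nat) \<Rightarrow> (nat \<times> 3 \<Rightarrow> 'a) \<Rightarrow> nat \<Rightarrow> 'a ^ 3" where
  "forms_at \<pi> c i = (\<chi> j. c (\<pi> i, j))"

text \<open>Extensional functions only, so that there are finitely many labellings.\<close>

definition orderings :: "(nat \<Rightarrow> nat) set" where
  "orderings = {\<pi> \<in> I \<rightarrow>\<^sub>E {..<n}. bij_betw \<pi> I {..<n}}"

definition family_planes :: "'a \<Rightarrow> 'a arrangement" where
  "family_planes t = (\<lambda>i. kernel_plane (form t i)) ` I"

lemma finite_orderings: "finite orderings"
proof (rule finite_subset)
  show "orderings \<subseteq> I \<rightarrow>\<^sub>E {..<n}" by (auto simp: orderings_def)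
qed (simp add: finite_PiE finite_points)

lemma card_atoms: "card (rank_part lat 1) = n"
  unfolding card_rank_part_block_lattice by simp

abbreviation "RC \<equiv> (realization_coords lat :: (nat \<times> 3 \<Rightarrow> 'a) set)"

lemma RC_iff: "c \<in> RC \<longleftrightarrow> (\<forall>i\<ge>n. \<forall>j. c (i, j) = 0) \<and> arrangement_of_coords n c \<in> realizations lat"
  unfolding realization_coords_def card_atoms by simp

lemma arrangement_forms_at:
  assumes "\<pi> \<in> orderings"
  shows "arrangement_of_coords n c = (\<lambda>i. kernel_plane (forms_at \<pi> c i)) ` I"
proof -
  have "\<pi> ` I = {..<n}" using assms by (simp add: orderings_def bij_betw_def)
  then have "arrangement_of_coords n c = (\<lambda>i. kernel_plane (\<chi> j. c (i, j))) ` \<pi> ` I"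
    unfolding arrangement_of_coords_def by simp
  then show ?thesis by (simp add: image_image forms_at_def)
qed

lemma planes_realization:
  assumes "realizes I \<B> b"
  shows "(\<lambda>i. kernel_plane (b i)) ` I \<in> realizations lat"
proof -
  interpret realization I \<B> b by unfold_locales (rule assms)
  show ?thesis by (rule planes_in_realizations)
qed

lemma arrangement_coords: "arrangement_of_coords n (coords t) = family_planes t"
proof -
  have "arrangement_of_coords n (coords t) = (\<lambda>i. kernel_plane (form t (enum i))) ` {..<n}"
    unfolding arrangement_of_coords_def by (rule image_cong) (auto simp: coords_def vec_lambda_eta)
  also have "\<dots> = (\<lambda>i. kernel_plane (form t i)) ` enum ` {..<n}" by (simp add: image_image)
  finally show ?thesis unfolding enum_image family_planes_def .
qed

lemma coords_in_RC: "t \<in> U \<Longrightarrow> coords t \<in> RC"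
  unfolding RC_iff arrangement_coords
  using planes_realization[of "form t"] by (auto simp: coords_def family_planes_def)

lemma align:
  assumes b: "realizes I \<B> b" and eq: "arrangement_of_coords n c = (\<lambda>i. kernel_plane (b i)) ` I"
  obtains \<pi> k where "\<pi> \<in> orderings" "\<And>i. i \<in> I \<Longrightarrow> k i \<noteq> 0 \<and> forms_at \<pi> c i = k i *s b i"
proof -
  interpret realization I \<B> b by unfold_locales (rule b)
  have "\<exists>l<n. kernel_plane (\<chi> j. c (l, j)) = kernel_plane (b i)" if "i \<in> I" for i
  proof -
    have "kernel_plane (b i) \<in> arrangement_of_coords n c" using eq that by blast
    then show ?thesis unfolding arrangement_of_coords_def by auto
  qed
  then obtain r where r: "\<And>i. i \<in> I \<Longrightarrow> r i < n \<and> kernel_plane (\<chi> j. c (r i, j)) = kernel_plane (b i)"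
    by metis
  define \<pi> where "\<pi> = restrict r I"
  have "inj_on \<pi> I"
  proof (rule inj_onI)
    fix i j assume "i \<in> I" "j \<in> I" "\<pi> i = \<pi> j"
    then have "kernel_plane (b i) = kernel_plane (b j)" using r[of i] r[of j] by (simp add: \<pi>_def)
    then show "i = j" using inj_plane \<open>i \<in> I\<close> \<open>j \<in> I\<close> by (auto dest: inj_onD)
  qed
  moreover have sub: "\<pi> ` I \<subseteq> {..<n}" using r by (auto simp: \<pi>_def)
  ultimately have "\<pi> ` I = {..<n}"
    by (intro card_subset_eq) (auto simp: card_image)
  then have "\<pi> \<in> orderings"
    using \<open>inj_on \<pi> I\<close> sub by (auto simp: orderings_def bij_betw_def \<pi>_def)
  moreover have "\<exists>k. k \<noteq> 0 \<and> forms_at \<pi> c i = k *s b i" if i: "i \<in> I" for i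
    using r[OF i] kernel_plane_eq_iff[OF form_nonzero[OF i]] i
    by (simp add: forms_at_def \<pi>_def)
  then obtain k where "\<And>i. i \<in> I \<Longrightarrow> k i \<noteq> 0 \<and> forms_at \<pi> c i = k i *s b i" by metis
  ultimately show thesis by (rule that)
qed

lemma RC_ordering:
  assumes "c \<in> RC"
  obtains \<pi> where "\<pi> \<in> orderings" "realizes I \<B> (forms_at \<pi> c)"
proof -
  have "arrangement_of_coords n c \<in> realizations lat" using assms by (simp add: RC_iff)
  then obtain b where b: "realizes I \<B> b" "arrangement_of_coords n c = (\<lambda>i. kernel_plane (b i)) ` I"
    by (rule realizations_obtain[OF _ blocks_nonempty])
  obtain \<pi> k where k: "\<pi> \<in> orderings" "\<And>i. i \<in> I \<Longrightarrow> k i \<noteq> 0 \<and> forms_at \<pi> c i = k i *s b i"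
    using align[OF b] by blast
  have "realizes I \<B> (forms_at \<pi> c)" by (rule realizes_scale[OF b(1) k(2)])
  then show thesis using that k(1) by blast
qed

text \<open>The number of concurrent triples is fixed, so the vanishing conditions alone force the
  remaining brackets to be nonzero.\<close>

definition concurrences :: "(nat \<times> nat \<times> nat) set" where
  "concurrences = {(i, j, k). (\<exists>b\<in>\<B>. {i, j, k} \<subseteq> b) \<and> i \<noteq> j \<and> i \<noteq> k \<and> j \<noteq> k}"

definition vanishes :: "(nat \<Rightarrow> nat) \<Rightarrow> (nat \<times> 3 \<Rightarrow> 'a) \<Rightarrow> bool" where
  "vanishes \<pi> c \<longleftrightarrow> (\<forall>(i, j, k)\<in>concurrences.
     bracket (forms_at \<pi> c i) (forms_at \<pi> c j) (forms_at \<pi> c k) = 0)"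

lemma vanishes_if_realizes: "realizes I \<B> (forms_at \<pi> c) \<Longrightarrow> vanishes \<pi> c"
  unfolding vanishes_def concurrences_def realizes_def using block_subset by blast

lemma realizes_if_vanishing:
  assumes c: "c \<in> RC" and \<pi>: "\<pi> \<in> orderings" and van: "vanishes \<pi> c"
  shows "realizes I \<B> (forms_at \<pi> c)"
proof -
  obtain \<sigma> where \<sigma>: "\<sigma> \<in> orderings" "realizes I \<B> (forms_at \<sigma> c)" using RC_ordering[OF c] .
  define T where "T = concurrences"
  have T_def: "T = {(i, j, k). i \<in> I \<and> j \<in> I \<and> k \<in> I \<and> i \<noteq> j \<and> i \<noteq> k \<and> j \<noteq> k \<and>
    (\<exists>b\<in>\<B>. {i, j, k} \<subseteq> b)}"
    unfolding T_def concurrences_def using block_subset by blast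
  have van: "bracket (forms_at \<pi> c i) (forms_at \<pi> c j) (forms_at \<pi> c k) = 0"
    if "(i, j, k) \<in> T" for i j k
    using van that unfolding vanishes_def \<open>T = concurrences\<close> by blast
  define v where "v l = (\<chi> j. c (l, j))" for l
  define D where "D = {(i, j, k). i < n \<and> j < n \<and> k < n \<and> i \<noteq> j \<and> i \<noteq> k \<and> j \<noteq> k \<and>
    bracket (v i) (v j) (v k) = 0}"
  define map3 where "map3 f = (\<lambda>(i, j, k). (f i, f j, f k))" for f :: "nat \<Rightarrow> nat"
  have fa: "forms_at \<rho> c i = v (\<rho> i)" for \<rho> i by (simp add: forms_at_def v_def)
  have "T \<subseteq> I \<times> I \<times> I" unfolding T_def by blast
  then have finT: "finite T" using finite_points by (auto intro: finite_subset)
  have bij: "inj_on \<rho> I" "\<rho> ` I = {..<n}" if "\<rho> \<in> orderings" for \<rho>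
    using that unfolding orderings_def bij_betw_def by blast+
  have inj: "inj_on (map3 \<rho>) T" if "\<rho> \<in> orderings" for \<rho>
  proof (rule inj_onI)
    fix x y assume xy: "x \<in> T" "y \<in> T" "map3 \<rho> x = map3 \<rho> y"
    obtain i j k i' j' k' where d: "x = (i, j, k)" "y = (i', j', k')" by (cases x, cases y)
    have t: "(i, j, k) \<in> T" "(i', j', k') \<in> T"
      and e: "map3 \<rho> (i, j, k) = map3 \<rho> (i', j', k')"
      using xy by (simp_all add: d)
    have "i \<in> I" "j \<in> I" "k \<in> I" "i' \<in> I" "j' \<in> I" "k' \<in> I" using t unfolding T_def by blast+
    moreover have "\<rho> i = \<rho> i'" "\<rho> j = \<rho> j'" "\<rho> k = \<rho> k'" using e by (simp_all add: map3_def)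
    ultimately show "x = y"
      using inj_onD[OF bij(1)[OF that]] by (simp add: d)
  qed
  have D: "D = map3 \<sigma> ` T"
  proof
    show "map3 \<sigma> ` T \<subseteq> D"
    proof (rule image_subsetI)
      fix x assume x: "x \<in> T"
      obtain i j k where x': "x = (i, j, k)" by (cases x)
      have t: "(i, j, k) \<in> T" using x by (simp add: x')
      have "bracket (v (\<sigma> i)) (v (\<sigma> j)) (v (\<sigma> k)) = 0"
        using \<sigma>(2) t unfolding realizes_def fa T_def by blast
      moreover have "\<sigma> i < n" "\<sigma> j < n" "\<sigma> k < n" "\<sigma> i \<noteq> \<sigma> j" "\<sigma> i \<noteq> \<sigma> k" "\<sigma> j \<noteq> \<sigma> k"
        using t bij[OF \<sigma>(1)] by (auto simp: T_def inj_on_def)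
      ultimately show "map3 \<sigma> x \<in> D" by (simp add: x' map3_def D_def)
    qed
    show "D \<subseteq> map3 \<sigma> ` T"
    proof
      fix x assume x: "x \<in> D"
      obtain i' j' k' where x': "x = (i', j', k')" by (cases x)
      have d: "(i', j', k') \<in> D" using x by (simp add: x')
      then have "i' \<in> \<sigma> ` I" "j' \<in> \<sigma> ` I" "k' \<in> \<sigma> ` I" using bij[OF \<sigma>(1)] by (auto simp: D_def)
      then obtain i j k where e: "i \<in> I" "j \<in> I" "k \<in> I" "i' = \<sigma> i" "j' = \<sigma> j" "k' = \<sigma> k"
        by blast
      then have "i \<noteq> j" "i \<noteq> k" "j \<noteq> k" using d by (auto simp: D_def)
      then have "(i, j, k) \<in> T"
        using \<sigma>(2) e d unfolding realizes_def fa T_def D_def by blast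
      then have "map3 \<sigma> (i, j, k) \<in> map3 \<sigma> ` T" by (rule imageI)
      then show "x \<in> map3 \<sigma> ` T" using e by (simp add: x' map3_def)
    qed
  qed
  have sub: "map3 \<pi> ` T \<subseteq> D"
  proof (rule image_subsetI)
    fix x assume x: "x \<in> T"
    obtain i j k where x': "x = (i, j, k)" by (cases x)
    have t: "(i, j, k) \<in> T" using x by (simp add: x')
    have "bracket (v (\<pi> i)) (v (\<pi> j)) (v (\<pi> k)) = 0"
      using van[OF t] unfolding fa .
    moreover have "\<pi> i < n" "\<pi> j < n" "\<pi> k < n" "\<pi> i \<noteq> \<pi> j" "\<pi> i \<noteq> \<pi> k" "\<pi> j \<noteq> \<pi> k"
      using t bij[OF \<pi>] by (auto simp: T_def inj_on_def)
    ultimately show "map3 \<pi> x \<in> D" by (simp add: x' map3_def D_def)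
  qed
  have "card D = card T" unfolding D by (rule card_image[OF inj[OF \<sigma>(1)]])
  moreover have "card (map3 \<pi> ` T) = card T" by (rule card_image[OF inj[OF \<pi>]])
  moreover have "finite D" unfolding D using finT by (rule finite_imageI)
  \<comment> \<open>\<open>\<sigma>\<close> matches \<open>T\<close> with all vanishing triples of
    indices, and \<open>\<pi>\<close> embeds \<open>T\<close> into them; equal finite cardinality
    makes this embedding onto, so no further bracket vanishes.\<close>
  ultimately have eq: "map3 \<pi> ` T = D" using sub by (intro card_subset_eq) auto
  show ?thesis
    unfolding realizes_def
  proof (intro ballI impI iffI)
    fix i j k assume I: "i \<in> I" "j \<in> I" "k \<in> I" and d: "i \<noteq> j \<and> i \<noteq> k \<and> j \<noteq> k"
      and 0: "bracket (forms_at \<pi> c i) (forms_at \<pi> c j) (forms_at \<pi> c k) = 0"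
    have "\<pi> i < n" "\<pi> j < n" "\<pi> k < n" "\<pi> i \<noteq> \<pi> j" "\<pi> i \<noteq> \<pi> k" "\<pi> j \<noteq> \<pi> k"
      using I d bij[OF \<pi>] by (auto simp: inj_on_def)
    then have "(\<pi> i, \<pi> j, \<pi> k) \<in> D" using 0 by (simp add: D_def fa)
    then obtain i' j' k' where t: "(i', j', k') \<in> T" "\<pi> i = \<pi> i'" "\<pi> j = \<pi> j'" "\<pi> k = \<pi> k'"
      unfolding eq[symmetric] by (auto simp: map3_def)
    then have "i' = i" "j' = j" "k' = k"
      using bij(1)[OF \<pi>] I by (auto simp: T_def inj_on_def)
    then show "\<exists>b\<in>\<B>. {i, j, k} \<subseteq> b" using t(1) by (simp add: T_def)
  next
    fix i j k assume "i \<in> I" "j \<in> I" "k \<in> I" "i \<noteq> j \<and> i \<noteq> k \<and> j \<noteq> k" "\<exists>b\<in>\<B>. {i, j, k} \<subseteq> b"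
    then have "(i, j, k) \<in> T" unfolding T_def by blast
    then show "bracket (forms_at \<pi> c i) (forms_at \<pi> c j) (forms_at \<pi> c k) = 0" by (rule van)
  qed
qed

lemma proj_equiv_planes:
  assumes "invertible g" "\<And>i. i \<in> I \<Longrightarrow> k i \<noteq> 0 \<and> b i = k i *s pull g (a i)"
  shows "((\<lambda>i. kernel_plane (b i)) ` I, (\<lambda>i. kernel_plane (a i)) ` I) \<in> proj_equiv"
proof -
  have "(\<lambda>H. (*v) g ` H) ` (\<lambda>i. kernel_plane (b i)) ` I = (\<lambda>i. kernel_plane (a i)) ` I"
    unfolding image_image
    by (rule image_cong) (use assms in \<open>auto simp: kernel_plane_scale image_kernel_plane_pull\<close>)
  then show ?thesis unfolding proj_equiv_def
    by (intro CollectI case_prodI exI[of _ g] conjI assms(1)) (rule sym)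
qed

text \<open>This rewrites equivalence as polynomial equations in the coordinates, with a finite
  choice of labelling. For the converse, the vanishing conditions make the labelling a realization,
  equivalent to some member with parameter \<open>t'\<close>; the last equation and the nonzero
  denominator give \<open>t' = t\<close>.\<close>

lemma equivalent_iff:
  assumes c: "c \<in> RC" and t: "t \<in> U"
  shows "(arrangement_of_coords n c, family_planes t) \<in> proj_equiv \<longleftrightarrow>
    (\<exists>\<pi>\<in>orderings. vanishes \<pi> c \<and> num (forms_at \<pi> c) - t * den (forms_at \<pi> c) = 0)"
    (is "?L \<longleftrightarrow> ?R")
proof
  assume ?L
  then obtain g
      where g: "invertible g" "family_planes t = (\<lambda>H. (*v) g ` H) ` arrangement_of_coords n c"
    by (auto simp: proj_equiv_def)
  obtain h where h: "h ** g = mat 1" "g ** h = mat 1" using g(1) unfolding invertible_def by blast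
  have "arrangement_of_coords n c = (\<lambda>H. (*v) h ` H) ` family_planes t"
    by (simp add: g(2) image_image matrix_vector_mul_assoc h)
  also have "\<dots> = (\<lambda>i. kernel_plane (pull g (form t i))) ` I"
    unfolding family_planes_def image_image
  proof (rule image_cong)
    fix i
    have "(*v) h ` kernel_plane (form t i) = (*v) h ` (*v) g ` kernel_plane (pull g (form t i))"
      by (simp only: image_kernel_plane_pull[OF g(1)])
    also have "\<dots> = kernel_plane (pull g (form t i))"
      by (simp add: image_image matrix_vector_mul_assoc h)
    finally show "(*v) h ` kernel_plane (form t i) = kernel_plane (pull g (form t i))" .
  qed simp
  finally have eq: "arrangement_of_coords n c = (\<lambda>i. kernel_plane (pull g (form t i))) ` I" .
  have "realizes I \<B> (\<lambda>i. pull g (form t i))"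
    by (rule realizes_scale_pull[of _ _ "form t" g "\<lambda>_. 1"]) (use t g in auto)
  then obtain \<pi> k where \<pi>: "\<pi> \<in> orderings"
    "\<And>i. i \<in> I \<Longrightarrow> k i \<noteq> 0 \<and> forms_at \<pi> c i = k i *s pull g (form t i)"
    using align[OF _ eq] by blast
  have "realizes I \<B> (forms_at \<pi> c)"
    by (rule realizes_scale_pull[of _ _ "form t" g k]) (use t g \<pi> in auto)
  then have "vanishes \<pi> c" by (rule vanishes_if_realizes)
  moreover have "num (forms_at \<pi> c) - t * den (forms_at \<pi> c) = 0"
  proof -
    obtain s where "num (forms_at \<pi> c) = s * num (form t)" "den (forms_at \<pi> c) = s * den (form t)"
      using param_transform[of "forms_at \<pi> c" k g "form t"] \<pi>(2) by blast
    then show ?thesis by (simp add: param_form)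
  qed
  ultimately show ?R using \<pi>(1) by blast
next
  assume ?R
  then obtain \<pi> where \<pi>: "\<pi> \<in> orderings" "vanishes \<pi> c"
    "num (forms_at \<pi> c) - t * den (forms_at \<pi> c) = 0"
    by blast
  have r: "realizes I \<B> (forms_at \<pi> c)" by (rule realizes_if_vanishing[OF c \<pi>(1,2)])
  obtain t' g k where k: "t' \<in> U" "invertible g"
    "\<And>i. i \<in> I \<Longrightarrow> k i \<noteq> 0 \<and> forms_at \<pi> c i = k i *s pull g (form t' i)"
    using classification[OF r] by blast
  obtain s where s: "num (forms_at \<pi> c) = s * num (form t')"
      "den (forms_at \<pi> c) = s * den (form t')"
    using param_transform[of "forms_at \<pi> c" k g "form t'"] k(3) by blast
  have "s * den (form t') \<noteq> 0" using den_nonzero[OF r] s by simp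
  moreover have "s * den (form t') * t' = s * den (form t') * t"
    using \<pi>(3) by (simp add: s param_form algebra_simps)
  ultimately have "t' = t" by simp
  have "(arrangement_of_coords n c, (\<lambda>i. kernel_plane (form t' i)) ` I) \<in> proj_equiv"
    unfolding arrangement_forms_at[OF \<pi>(1)] by (rule proj_equiv_planes[OF k(2,3)])
  then show ?L by (simp add: \<open>t' = t\<close> family_planes_def)
qed

subsection \<open>The topology of the moduli space\<close>

abbreviation "moduli \<equiv> (moduli_topology lat :: 'a arrangement set topology)"

definition class_of :: "'a arrangement \<Rightarrow> 'a arrangement set" where
  "class_of A = Restr proj_equiv (realizations lat) `` {A}"

lemma moduli_eq: "moduli = quotient_topology (subtopology zariski_topology RC)
    (\<lambda>c. class_of (arrangement_of_coords n c))"
  unfolding moduli_topology_def card_atoms class_of_def by simp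

lemma topspace_moduli: "topspace moduli = (\<lambda>c. class_of (arrangement_of_coords n c)) ` RC"
  unfolding moduli_eq by simp

lemma closedin_moduli: "closedin moduli C \<longleftrightarrow> C \<subseteq> topspace moduli \<and>
    closedin (subtopology zariski_topology RC) {c \<in> RC. class_of (arrangement_of_coords n c) \<in> C}"
  (is "_ \<longleftrightarrow> _ \<and> closedin ?X _")
proof -
  let ?f = "\<lambda>c. class_of (arrangement_of_coords n c)"
  have top: "topspace ?X = RC" by simp
  have eq: "{c \<in> RC. ?f c \<in> topspace moduli - C} = RC - {c \<in> RC. ?f c \<in> C}"
    unfolding topspace_moduli by blast
  have "openin moduli (topspace moduli - C) \<longleftrightarrow> openin ?X {c \<in> RC. ?f c \<in> topspace moduli - C}"
    unfolding moduli_eq openin_quotient_topology top by auto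
  then show ?thesis
    unfolding closedin_def eq top by auto
qed

lemma class_eq:
  "A \<in> realizations lat \<Longrightarrow> B \<in> realizations lat \<Longrightarrow> class_of A = class_of B \<longleftrightarrow> (A, B) \<in> proj_equiv"
  unfolding class_of_def by (rule class_eq_iff)

lemma family_planes_realization: "t \<in> U \<Longrightarrow> family_planes t \<in> realizations lat"
  unfolding family_planes_def by (rule planes_realization) simp

lemma moduli_point:
  assumes "x \<in> topspace moduli"
  obtains t where "t \<in> U" "x = class_of (family_planes t)"
proof -
  obtain c where c: "c \<in> RC" "x = class_of (arrangement_of_coords n c)"
    using assms unfolding topspace_moduli by blast
  obtain \<pi> where \<pi>: "\<pi> \<in> orderings" "realizes I \<B> (forms_at \<pi> c)" using RC_ordering[OF c(1)] .
  obtain t g k where k: "t \<in> U" "invertible g"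
    "\<And>i. i \<in> I \<Longrightarrow> k i \<noteq> 0 \<and> forms_at \<pi> c i = k i *s pull g (form t i)"
    using classification[OF \<pi>(2)] by blast
  have "(arrangement_of_coords n c, family_planes t) \<in> proj_equiv"
    unfolding arrangement_forms_at[OF \<pi>(1)] family_planes_def by (rule proj_equiv_planes[OF k(2,3)])
  then have "x = class_of (family_planes t)"
    using class_eq[of "arrangement_of_coords n c" "family_planes t"] c
      family_planes_realization[OF k(1)] by (simp add: RC_iff)
  then show thesis using k(1) that by blast
qed

lemma family_point: "t \<in> U \<Longrightarrow> class_of (family_planes t) \<in> topspace moduli"
  unfolding topspace_moduli arrangement_coords[symmetric] by (rule imageI) (rule coords_in_RC)

lemma polyfn_forms_at: "polyfn (\<lambda>v c. c v) (\<lambda>c. forms_at \<pi> c i $ j)"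
  unfolding forms_at_def vec_lambda_beta by (rule polyfn_coord)

lemma polyfn_bracket_forms:
  "polyfn (\<lambda>v c. c v) (\<lambda>c. bracket (forms_at \<pi> c i) (forms_at \<pi> c j) (forms_at \<pi> c k))"
  unfolding bracket_def by (intro polyfn_intros polyfn_forms_at)

lemma closedin_point:
  assumes x: "x \<in> topspace moduli"
  shows "closedin moduli {x}"
proof -
  obtain t where t: "t \<in> U" "x = class_of (family_planes t)" using moduli_point[OF x] .
  define S where "S \<pi> = insert (\<lambda>c. num (forms_at \<pi> c) - t * den (forms_at \<pi> c))
      ((\<lambda>(i, j, k) c. bracket (forms_at \<pi> c i) (forms_at \<pi> c j) (forms_at \<pi> c k)) ` concurrences)"
          for \<pi>
  have "polyfn (\<lambda>v c. c v) h" if "h \<in> S \<pi>" for h \<pi>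
    using that unfolding S_def param_num_def param_den_def
    by (auto intro!: polyfn_intros polyfn_bracket_forms)
  then have "closedin zariski_topology {c. \<forall>h\<in>S \<pi>. h c = 0}" for \<pi>
    by (rule closedin_zariski_zeros)
  then have cl: "closedin zariski_topology (\<Union>\<pi>\<in>orderings. {c. \<forall>h\<in>S \<pi>. h c = 0})"
    using finite_orderings by (intro closedin_Union) auto
  have cls: "class_of (arrangement_of_coords n c) = x \<longleftrightarrow> (\<exists>\<pi>\<in>orderings. \<forall>h\<in>S \<pi>. h c = 0)"
    if c: "c \<in> RC" for c
  proof -
    have "class_of (arrangement_of_coords n c) = x \<longleftrightarrow>
        (arrangement_of_coords n c, family_planes t) \<in> proj_equiv"
      unfolding t(2)
      by (rule class_eq) (use c family_planes_realization[OF t(1)] in \<open>auto simp: RC_iff\<close>)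
    also have "\<dots> \<longleftrightarrow> (\<exists>\<pi>\<in>orderings. \<forall>h\<in>S \<pi>. h c = 0)"
      unfolding equivalent_iff[OF c t(1)] S_def vanishes_def
      by (intro bex_cong refl) auto
    finally show ?thesis .
  qed
  have "{c \<in> RC. class_of (arrangement_of_coords n c) \<in> {x}} =
      RC \<inter> (\<Union>\<pi>\<in>orderings. {c. \<forall>h\<in>S \<pi>. h c = 0})"
  proof (rule set_eqI)
    fix c
    show "c \<in> {c \<in> RC. class_of (arrangement_of_coords n c) \<in> {x}} \<longleftrightarrow>
        c \<in> RC \<inter> (\<Union>\<pi>\<in>orderings. {c. \<forall>h\<in>S \<pi>. h c = 0})"
      by (cases "c \<in> RC") (simp_all add: cls)
  qed
  then have "{c \<in> RC. class_of (arrangement_of_coords n c) \<in> {x}} =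
      (\<Union>\<pi>\<in>orderings. {c. \<forall>h\<in>S \<pi>. h c = 0}) \<inter> RC" by (simp only: Int_commute)
  then have "closedin (subtopology zariski_topology RC)
      {c \<in> RC. class_of (arrangement_of_coords n c) \<in> {x}}"
    unfolding closedin_subtopology using cl by blast
  then show ?thesis using x unfolding closedin_moduli by blast
qed

text \<open>The polynomial curve \<open>coords\<close> meets every class, so a closed set of classes
  is governed by the parameters on it: finitely many or all.\<close>

lemma finite_closed:
  assumes C: "closedin moduli C" "C \<noteq> topspace moduli"
  shows "finite C"
proof -
  have sub: "C \<subseteq> topspace moduli" using C(1) by (rule closedin_subset)
  obtain Z where Z: "closedin zariski_topology Z"
    "{c \<in> RC. class_of (arrangement_of_coords n c) \<in> C} = Z \<inter> RC"
    using C(1) unfolding closedin_moduli closedin_subtopology by blast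
  have mem: "coords t \<in> Z \<longleftrightarrow> class_of (family_planes t) \<in> C" if "t \<in> U" for t
  proof -
    have "coords t \<in> Z \<inter> RC \<longleftrightarrow> class_of (family_planes t) \<in> C"
      unfolding Z(2)[symmetric] arrangement_coords[symmetric] using coords_in_RC[OF that] by blast
    then show ?thesis using coords_in_RC[OF that] by blast
  qed
  have "\<exists>q. \<forall>t. coords t v = poly q t" for v
  proof -
    obtain i j where v: "v = (i, j)" by (cases v)
    show ?thesis
      by (rule exI[of _ "if i < n then p (enum i) $ j else 0"]) (simp add: v coords_def form_def)
  qed
  then have "finite {t. coords t \<in> Z} \<or> (\<forall>t. coords t \<in> Z)"
    by (rule zariski_curve[OF _ Z(1)])
  then show ?thesis
  proof
    assume fin: "finite {t. coords t \<in> Z}"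
    have "C \<subseteq> (\<lambda>t. class_of (family_planes t)) ` {t. coords t \<in> Z}"
    proof
      fix x assume "x \<in> C"
      then have "x \<in> topspace moduli" using sub by blast
      then obtain t where "t \<in> U" "x = class_of (family_planes t)" by (rule moduli_point)
      then show "x \<in> (\<lambda>t. class_of (family_planes t)) ` {t. coords t \<in> Z}"
        using mem \<open>x \<in> C\<close> by auto
    qed
    then show ?thesis using fin by (meson finite_imageI finite_subset)
  next
    assume all: "\<forall>t. coords t \<in> Z"
    have "topspace moduli \<subseteq> C"
    proof
      fix x assume "x \<in> topspace moduli"
      then obtain t where "t \<in> U" "x = class_of (family_planes t)" by (rule moduli_point)
      then show "x \<in> C" using mem all by blast
    qed
    then show ?thesis using sub C(2) by blast
  qed
qed

text \<open>The parameters of one class are among the finitely many values read off a single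
  arrangement under all labellings, while infinitely many parameters are admissible.\<close>

lemma infinite_moduli: "infinite (topspace moduli)"
proof
  assume fin: "finite (topspace moduli)"
  have "finite {s \<in> U. class_of (family_planes s) = x}" if x: "x \<in> topspace moduli" for x
  proof -
    obtain t where t: "t \<in> U" "x = class_of (family_planes t)" using moduli_point[OF x] .
    have "{s \<in> U. class_of (family_planes s) = x} \<subseteq>
        (\<lambda>\<pi>. num (forms_at \<pi> (coords t)) / den (forms_at \<pi> (coords t))) ` orderings"
    proof clarify
      fix s assume s: "realizes I \<B> (form s)" "x = class_of (family_planes s)"
      have cRC: "coords t \<in> RC" by (rule coords_in_RC[OF t(1)])
      have "(family_planes t, family_planes s) \<in> proj_equiv"
        using class_eq[OF family_planes_realization[OF t(1)] family_planes_realization[of s]] s t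
            by simp
      then obtain \<pi> where \<pi>: "\<pi> \<in> orderings" "vanishes \<pi> (coords t)"
        "num (forms_at \<pi> (coords t)) - s * den (forms_at \<pi> (coords t)) = 0"
        using equivalent_iff[OF cRC, of s] s(1) unfolding arrangement_coords by blast
      have "den (forms_at \<pi> (coords t)) \<noteq> 0"
        by (rule den_nonzero[OF realizes_if_vanishing[OF cRC \<pi>(1,2)]])
      then have "s = num (forms_at \<pi> (coords t)) / den (forms_at \<pi> (coords t))"
        using \<pi>(3) by (simp add: field_simps)
      then show "s \<in> (\<lambda>\<pi>. num (forms_at \<pi> (coords t)) / den (forms_at \<pi> (coords t))) ` orderings"
        using \<pi>(1) by blast
    qed
    then show ?thesis using finite_orderings by (meson finite_imageI finite_subset)
  qed
  then have "finite (\<Union>x\<in>topspace moduli. {s \<in> U. class_of (family_planes s) = x})"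
    using fin by blast
  moreover have "U \<subseteq> (\<Union>x\<in>topspace moduli. {s \<in> U. class_of (family_planes s) = x})"
    using family_point by blast
  ultimately show False using infinite_U finite_subset by blast
qed

theorem krull_dim_moduli: "krull_dim moduli = 1"
  by (rule krull_dim_eq_1[OF finite_closed closedin_point infinite_moduli])

theorem not_rigid:
  fixes A :: "'a arrangement"
  assumes "A \<in> realizations lat"
  shows "\<not> rigid A"
proof -
  obtain \<phi> where "poset_iso (intersection_lattice A) lat \<phi>"
    using assms unfolding realizations_def by blast
  then have "(moduli_topology (intersection_lattice A) :: 'a arrangement set topology) = moduli"
    by (rule moduli_topology_iso)
  then show ?thesis using krull_dim_moduli by (simp add: rigid_def)
qed

subsection \<open>Freeness\<close>

text \<open>\<open>F\<close> and \<open>G\<close> are conjugated by the coordinate change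
  \<open>g\<close>, which keeps degrees, tangency and the nonzero determinant, so a basis for the
  members of the family suffices.\<close>

lemma realization_free:
  fixes A :: "'a arrangement"
  assumes A: "A \<in> realizations lat"
    and basis: "\<And>t. t \<in> U \<Longrightarrow> \<exists>F G. homogeneous_basis I (form t) F G e"
    and mult: "\<And>i. i \<in> I \<Longrightarrow> e \<le> (\<Sum>b | b \<in> \<B> \<and> i \<in> b. card b - 2)"
  shows "free_arrangement A" "\<not> inductively_free A"
proof -
  obtain b where b: "realizes I \<B> b" "A = (\<lambda>i. kernel_plane (b i)) ` I"
    by (rule realizations_obtain[OF A blocks_nonempty])
  obtain t g k where k: "t \<in> U" "invertible g"
    "\<And>i. i \<in> I \<Longrightarrow> k i \<noteq> 0 \<and> b i = k i *s pull g (form t i)"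
    using classification[OF b(1)] by blast
  obtain F G where "homogeneous_basis I (form t) F G e" using basis[OF k(1)] by blast
  then interpret T: homogeneous_basis I "form t" F G e .
  interpret R: realization_char_0 I \<B> b by unfold_locales (rule b(1))
  obtain h where h: "h ** g = mat 1" "g ** h = mat 1" using k(2) unfolding invertible_def by blast
  define F' where "F' x = h *v F (g *v x)" for x
  define G' where "G' x = h *v G (g *v x)" for x
  have pm: "pmap (\<lambda>x. h *v F1 (g *v x))" if "pmap F1" for F1
    by (intro pmap_matrix pmap_compose[OF that] pmap_id)
  have hom: "homog_map e (\<lambda>x. h *v F1 (g *v x))" if "homog_map e F1" for F1
  proof -
    have "M *v (s *s v) = s *s (M *v v)" for M :: "'a ^ 3 ^ 3" and s v
      by (simp add: matrix_vector_mult_def vec_eq_iff sum_3 algebra_simps)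
    then show ?thesis using that by (simp add: homog_map_def)
  qed
  have pres: "preserves R.planes (\<lambda>x. h *v F1 (g *v x))" if "preserves T.planes F1" for F1
    unfolding R.preserves_iff
  proof (intro ballI allI impI)
    fix i x assume i: "i \<in> I" "dotp (b i) x = 0"
    have k0: "k i \<noteq> 0" and bi: "b i = k i *s pull g (form t i)" using k(3)[OF i(1)] by auto
    have "dotp (form t i) (g *v x) = 0"
      using i(2) k0 by (simp add: bi dotp_scale_left dotp_pull)
    then have "dotp (form t i) (F1 (g *v x)) = 0"
      using that i(1) by (auto simp: T.preserves_iff)
    then show "dotp (b i) (h *v F1 (g *v x)) = 0"
      by (simp add: bi dotp_scale_left dotp_pull matrix_vector_mul_assoc h)
  qed
  have "\<exists>x. bracket x (F' x) (G' x) \<noteq> 0"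
  proof -
    obtain y where y: "bracket y (F y) (G y) \<noteq> 0" using T.det_nonzero by blast
    have hm: "h *v v = v $ 1 *s column 1 h + v $ 2 *s column 2 h + v $ 3 *s column 3 h" for v
      by (simp add: matrix_vector_mult_def vec_eq_iff sum_3 column_def algebra_simps)
    have "bracket (h *v u) (h *v v) (h *v w) =
        bracket u v w * bracket (column 1 h) (column 2 h) (column 3 h)" for u v w
      unfolding hm by (rule bracket_linear_combination)
    moreover have "det h \<noteq> 0"
      using h invertible_det_nz unfolding invertible_def by blast
    then have "bracket (column 1 h) (column 2 h) (column 3 h) \<noteq> 0"
      by (simp add: det_3 bracket_def column_def algebra_simps)
    moreover have "g *v (h *v y) = y" by (simp add: matrix_vector_mul_assoc h)
    ultimately have "bracket (h *v y) (F' (h *v y)) (G' (h *v y)) \<noteq> 0"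
      using y by (simp add: F'_def G'_def)
    then show ?thesis by blast
  qed
  then have hb: "homogeneous_basis I b F' G' e"
    using T.card_index T.e_pos
    by unfold_locales
      (simp_all add: F'_def[abs_def] G'_def[abs_def] pm hom pres T.pmap_FG T.homog_FG
          T.preserves_FG)
  have A': "A = R.planes" by (simp add: b(2) R.planes_def)
  show "free_arrangement A" unfolding A' by (rule homogeneous_basis.free[OF hb])
  show "\<not> inductively_free A" unfolding A' by (rule R.not_inductively_free[OF hb mult])
qed

end

section \<open>Checking incidences of explicit families\<close>

definition vec3 :: "'r \<times> 'r \<times> 'r \<Rightarrow> 'r::comm_ring_1 ^ 3" where
  "vec3 v = (case v of (a, b, c) \<Rightarrow> vector [a, b, c])"

lemma vec3_nth: "vec3 (a, b, c) $ 1 = a" "vec3 (a, b, c) $ 2 = b" "vec3 (a, b, c) $ 3 = c"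
  by (simp_all add: vec3_def)

definition tbracket :: "'r \<times> 'r \<times> 'r \<Rightarrow> 'r \<times> 'r \<times> 'r \<Rightarrow> 'r \<times> 'r \<times> 'r \<Rightarrow> 'r::comm_ring_1" where
  "tbracket u v w = (case (u, v, w) of ((a1, a2, a3), (b1, b2, b3), (c1, c2, c3)) \<Rightarrow>
     a1 * (b2 * c3 - b3 * c2) - a2 * (b1 * c3 - b3 * c1) + a3 * (b1 * c2 - b2 * c1))"

lemma bracket_vec3: "bracket (vec3 u) (vec3 v) (vec3 w) = tbracket u v w"
  by (cases u, cases v, cases w) (simp add: bracket_def tbracket_def vec3_nth)

definition map_triple :: "('r \<Rightarrow> 's) \<Rightarrow> 'r \<times> 'r \<times> 'r \<Rightarrow> 's \<times> 's \<times> 's" where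
  "map_triple h v = (case v of (a, b, c) \<Rightarrow> (h a, h b, h c))"

text \<open>Rows are listed from index 0, planes are numbered from 1.\<close>

definition row_form :: "('r::comm_ring_1 \<times> 'r \<times> 'r) list \<Rightarrow> nat \<Rightarrow> 'r ^ 3" where
  "row_form L i = (if i \<in> {1..length L} then vec3 (L ! (i - 1)) else 0)"

lemma row_form_map:
  assumes "h 0 = 0"
  shows "row_form (map (map_triple h) L) i = (\<chi> j. h (row_form L i $ j))"
proof (cases "i \<in> {1..length L}")
  case True
  then obtain a b c where "L ! (i - 1) = (a, b, c)" by (metis prod_cases3)
  then show ?thesis
    using True unfolding vec_eq_iff forall_3
    by (auto simp: row_form_def map_triple_def vec3_nth)
next
  case False
  then have "row_form L i = 0" "row_form (map (map_triple h) L) i = 0"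
    by (simp_all only: row_form_def length_map if_False)
  then show ?thesis using assms by (simp add: vec_eq_iff)
qed

text \<open>Each triple is tested once, in increasing order. The cross product of the first two
  forms and the blocks through their indices are passed down instead of being recomputed, which
  keeps the evaluation small.\<close>

fun concurrent_tail :: "nat list list \<Rightarrow> int \<times> int \<times> int \<Rightarrow> (nat \<times> int \<times> int \<times> int) list \<Rightarrow> bool" where
  "concurrent_tail BL c [] = True"
| "concurrent_tail BL (c1, c2, c3) ((k, w1, w2, w3) # ps) =
     ((c1 * w1 + c2 * w2 + c3 * w3 = 0) = list_ex (\<lambda>b. List.member b k) BL \<and>
      concurrent_tail BL (c1, c2, c3) ps)"

fun pair_tail :: "nat list list \<Rightarrow> int \<times> int \<times> int \<Rightarrow> (nat \<times> int \<times> int \<times> int) list \<Rightarrow> bool" where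
  "pair_tail BL u [] = True"
| "pair_tail BL (u1, u2, u3) ((j, v1, v2, v3) # ps) =
     (concurrent_tail (filter (\<lambda>b. List.member b j) BL)
       (u2 * v3 - u3 * v2, u3 * v1 - u1 * v3, u1 * v2 - u2 * v1) ps \<and> pair_tail BL (u1, u2, u3) ps)"

fun triple_check :: "nat list list \<Rightarrow> (nat \<times> int \<times> int \<times> int) list \<Rightarrow> bool" where
  "triple_check BL [] = True"
| "triple_check BL ((i, u) # ps) =
     (pair_tail (filter (\<lambda>b. List.member b i) BL) u ps \<and> triple_check BL ps)"

lemma concurrent_tail_nth:
  assumes "concurrent_tail BL (c1, c2, c3) ps" "r < length ps" "ps ! r = (k, w1, w2, w3)"
  shows "c1 * w1 + c2 * w2 + c3 * w3 = 0 \<longleftrightarrow> (\<exists>b\<in>set BL. k \<in> set b)"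
  using assms
proof (induction ps arbitrary: r)
  case (Cons p ps)
  obtain k' x1 x2 x3 where p: "p = (k', x1, x2, x3)" by (metis prod_cases4)
  show ?case
  proof (cases r)
    case 0
    then show ?thesis using Cons.prems by (simp add: p list_ex_iff)
  next
    case (Suc r')
    then show ?thesis using Cons.prems Cons.IH[of r'] by (simp add: p)
  qed
qed simp

lemma pair_tail_nth:
  assumes "pair_tail BL u ps" "q < r" "r < length ps" "ps ! q = (j, v)" "ps ! r = (k, w)"
  shows "tbracket u v w = 0 \<longleftrightarrow> (\<exists>b\<in>set BL. j \<in> set b \<and> k \<in> set b)"
  using assms
proof (induction ps arbitrary: q r)
  case (Cons p ps)
  obtain u1 u2 u3 where u: "u = (u1, u2, u3)" by (metis prod_cases3)
  obtain v1 v2 v3 where v: "v = (v1, v2, v3)" by (metis prod_cases3)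
  obtain w1 w2 w3 where w: "w = (w1, w2, w3)" by (metis prod_cases3)
  obtain j' x1 x2 x3 where p: "p = (j', x1, x2, x3)" by (metis prod_cases4)
  obtain r' where r: "r = Suc r'" using Cons.prems(2) by (cases r) auto
  show ?case
  proof (cases q)
    case 0
    then have "concurrent_tail (filter (\<lambda>b. List.member b j) BL)
       (u2 * v3 - u3 * v2, u3 * v1 - u1 * v3, u1 * v2 - u2 * v1) ps"
      using Cons.prems by (simp add: p u v)
    from concurrent_tail_nth[OF this, of r' k w1 w2 w3]
    have "(u2 * v3 - u3 * v2) * w1 + (u3 * v1 - u1 * v3) * w2 + (u1 * v2 - u2 * v1) * w3 = 0 \<longleftrightarrow>
        (\<exists>b\<in>set BL. j \<in> set b \<and> k \<in> set b)"
      using Cons.prems by (auto simp: r w)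
    moreover have "tbracket u v w =
        (u2 * v3 - u3 * v2) * w1 + (u3 * v1 - u1 * v3) * w2 + (u1 * v2 - u2 * v1) * w3"
      by (simp add: tbracket_def u v w algebra_simps)
    ultimately show ?thesis by simp
  next
    case (Suc q')
    then show ?thesis using Cons.prems Cons.IH[of q' r'] by (simp add: p r u)
  qed
qed simp

lemma triple_check_nth:
  assumes "triple_check BL ps" "p < q" "q < r" "r < length ps"
    "ps ! p = (i, u)" "ps ! q = (j, v)" "ps ! r = (k, w)"
  shows "tbracket u v w = 0 \<longleftrightarrow> (\<exists>b\<in>set BL. i \<in> set b \<and> j \<in> set b \<and> k \<in> set b)"
  using assms
proof (induction ps arbitrary: p q r)
  case (Cons x ps)
  obtain i' u' where x: "x = (i', u')" by (cases x)
  obtain q' where q: "q = Suc q'" using Cons.prems(2) by (cases q) auto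
  obtain r' where r: "r = Suc r'" using Cons.prems(3) by (cases r) auto
  show ?case
  proof (cases p)
    case 0
    then have "pair_tail (filter (\<lambda>b. List.member b i) BL) u ps"
      using Cons.prems by (simp add: x)
    from pair_tail_nth[OF this, of q' r' j v k w] show ?thesis
      using Cons.prems by (auto simp: q r)
  next
    case (Suc p')
    then show ?thesis using Cons.prems Cons.IH[of p' q' r'] by (simp add: x q r)
  qed
qed simp

lemma realizes_if_triple_check:
  assumes check: "triple_check BL (List.enumerate 1 L)" and \<B>: "\<B> = set ` set BL"
  shows "realizes {1..length L} \<B> (row_form L)"
proof -
  let ?I = "{1..length L}"
  have sorted: "bracket (row_form L i) (row_form L j) (row_form L k) = 0 \<longleftrightarrow> (\<exists>b\<in>\<B>. {i, j, k} \<subseteq> b)"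
    if "i \<in> ?I" "j \<in> ?I" "k \<in> ?I" "i < j" "j < k" for i j k
  proof -
    have "List.enumerate 1 L ! (l - 1) = (l, L ! (l - 1))" if "l \<in> ?I" for l
      using that by (subst nth_enumerate_eq) auto
    then have "tbracket (L ! (i - 1)) (L ! (j - 1)) (L ! (k - 1)) = 0 \<longleftrightarrow>
        (\<exists>b\<in>set BL. i \<in> set b \<and> j \<in> set b \<and> k \<in> set b)"
      using that by (intro triple_check_nth[OF check, of "i - 1" "j - 1" "k - 1"]) auto
    then show ?thesis
      using that(1-3) unfolding row_form_def by (simp add: bracket_vec3 \<B>)
  qed
  show ?thesis
    unfolding realizes_def
  proof (intro ballI impI)
    fix i j k assume I: "i \<in> ?I" "j \<in> ?I" "k \<in> ?I" and d: "i \<noteq> j \<and> i \<noteq> k \<and> j \<noteq> k"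
    \<comment> \<open>A permutation of the rows changes at most the sign, so sorted triples
      suffice.\<close>
    have perm: "bracket u w v = - bracket u v w" "bracket v u w = - bracket u v w"
      "bracket v w u = bracket u v w" "bracket w u v = bracket u v w"
          "bracket w v u = - bracket u v w"
      for u v w :: "int ^ 3"
      by (simp_all add: bracket_def algebra_simps)
    consider "i < j \<and> j < k" | "i < k \<and> k < j" | "j < i \<and> i < k" | "j < k \<and> k < i"
      | "k < i \<and> i < j" | "k < j \<and> j < i" using d by linarith
    then show "bracket (row_form L i) (row_form L j) (row_form L k) = 0 \<longleftrightarrow> (\<exists>b\<in>\<B>. {i, j, k} \<subseteq> b)"
    proof cases
      case 1 then show ?thesis using sorted[of i j k] I by simp
    next
      case 2 then show ?thesis
          using sorted[of i k j] I perm(1)[of "row_form L i" "row_form L k" "row_form L j"]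
        by auto
    next
      case 3 then show ?thesis
          using sorted[of j i k] I perm(2)[of "row_form L j" "row_form L i" "row_form L k"]
        by auto
    next
      case 4 then show ?thesis
          using sorted[of j k i] I perm(4)[of "row_form L i" "row_form L j" "row_form L k"]
        perm(3)[of "row_form L i" "row_form L j" "row_form L k"]
        by auto
    next
      case 5 then show ?thesis
          using sorted[of k i j] I perm(4)[of "row_form L i" "row_form L j" "row_form L k"]
        perm(3)[of "row_form L i" "row_form L j" "row_form L k"]
        by auto
    next
      case 6 then show ?thesis
          using sorted[of k j i] I perm(5)[of "row_form L i" "row_form L j" "row_form L k"]
        by auto
    qed
  qed
qed

lemma realizes_of_int:
  fixes b :: "nat \<Rightarrow> 'a::{comm_ring_1, ring_char_0} ^ 3"
  assumes "realizes I \<B> a" "\<And>i. b i = (\<chi> j. of_int (a i $ j))"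
  shows "realizes I \<B> b"
proof -
  have "bracket (b i) (b j) (b k) = of_int (bracket (a i) (a j) (a k))" for i j k
    by (simp add: assms(2) bracket_def)
  then show ?thesis using assms(1) by (simp add: realizes_def)
qed

text \<open>Hypotheses that evaluation can decide. For \<open>off_block\<close>, a point outside the
  block through \<open>i\<close> and \<open>j\<close> works since two blocks share at most one
  point; a pair on no block takes any third point.\<close>

lemma block_systemI:
  assumes "finite I" "\<B> \<noteq> {}" "\<forall>b\<in>\<B>. 3 \<le> card b \<and> b \<subset> I"
    and "\<forall>b\<in>\<B>. \<forall>b'\<in>\<B>. b = b' \<or> card (b \<inter> b') \<le> 1"
  shows "block_system I \<B>"
proof
  show "finite I" by fact
  show "b \<subseteq> I" "3 \<le> card b" if "b \<in> \<B>" for b using assms(3) that by auto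
  have eqI: "b = b'" if "b \<in> \<B>" "b' \<in> \<B>" "i \<in> b" "j \<in> b" "i \<in> b'" "j \<in> b'" "i \<noteq> j" for b b' i j
  proof (rule ccontr)
    assume "b \<noteq> b'"
    then have "card (b \<inter> b') \<le> 1" using assms(4) that by blast
    moreover have "card {i, j} \<le> card (b \<inter> b')"
      using that assms(1,3) by (intro card_mono) (auto intro: finite_subset)
    ultimately show False using that by simp
  qed
  then show "b = b'" if "b \<in> \<B>" "b' \<in> \<B>" "i \<in> b" "j \<in> b" "i \<in> b'" "j \<in> b'" "i \<noteq> j" for b b' i j
    using that .
  obtain b0 where b0: "b0 \<in> \<B>" using assms(2) by blast
  then have "finite b0" "3 \<le> card b0" "b0 \<subseteq> I" using assms(1,3) finite_subset by blast+
  then have "3 \<le> card I" using assms(1) card_mono[of I b0] by linarith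
  then have third: "\<exists>k\<in>I. k \<noteq> i \<and> k \<noteq> j" for i j
  proof -
    have "card {i, j} \<le> 2" by (simp add: card_insert_if)
    then have "\<not> I \<subseteq> {i, j}" using \<open>3 \<le> card I\<close> card_mono[of "{i, j}" I] by fastforce
    then show ?thesis by blast
  qed
  show "\<exists>i\<in>I. \<exists>j\<in>I. i \<noteq> j"
    using third by metis
  show "\<exists>k\<in>I. k \<noteq> i \<and> k \<noteq> j \<and> (\<forall>b\<in>\<B>. \<not> {i, j, k} \<subseteq> b)" if "i \<in> I" "j \<in> I" "i \<noteq> j" for i j
  proof (cases "\<exists>b\<in>\<B>. {i, j} \<subseteq> b")
    case True
    then obtain b where b: "b \<in> \<B>" "i \<in> b" "j \<in> b" by blast
    then obtain k where k: "k \<in> I" "k \<notin> b" using assms(3) by blast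
    have "\<not> {i, j, k} \<subseteq> b'" if b': "b' \<in> \<B>" for b'
    proof
      assume s: "{i, j, k} \<subseteq> b'"
      then have "b = b'" by (intro eqI[OF b(1) b' b(2,3) _ _ \<open>i \<noteq> j\<close>]) simp_all
      then show False using s k(2) by simp
    qed
    moreover have "k \<noteq> i" "k \<noteq> j" using k(2) b by auto
    ultimately show ?thesis using k(1) by metis
  next
    case False
    obtain k where k: "k \<in> I" "k \<noteq> i" "k \<noteq> j" using third[of i j] by blast
    have "\<not> {i, j, k} \<subseteq> b" if "b \<in> \<B>" for b using False that by auto
    then show ?thesis using k by metis
  qed
qed

section \<open>The family with 13 planes\<close>

text \<open>With \<open>\<alpha> = 1\<close>, \<open>\<beta> = t - 1\<close>, \<open>\<gamma> = - t\<close>, so that \<open>\<alpha> + \<beta> + \<gamma> = 0\<close>, each vertex of the coordinate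
  triangle lies on three further planes, the ratios of consecutive coordinates being
  \<open>\<gamma> / \<alpha>\<close>, \<open>\<alpha> / \<beta>\<close> and \<open>\<beta> / \<gamma>\<close> in all three cases.\<close>

definition rows13 :: "'r::comm_ring_1 \<Rightarrow> ('r \<times> 'r \<times> 'r) list" where
  "rows13 t = [(1, t, 0), (0, 1, t), (t, 0, 1), (t - 1, - 1, 0), (0, t - 1, - 1), (- 1, 0, t - 1),
     (- t, 1 - t, 0), (0, - t, 1 - t), (1 - t, 0, - t), (1, 0, 0), (0, 1, 0), (0, 0, 1), (1, 1, 1)]"

definition form13 :: "'r::comm_ring_1 \<Rightarrow> nat \<Rightarrow> 'r ^ 3" where
  "form13 t = row_form (rows13 t)"

text \<open>With each block a common zero of its forms, polynomial in \<open>t\<close>: a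
  certificate that the concurrences hold identically, also over the polynomial ring.\<close>

definition points13 :: "'r::comm_ring_1 \<Rightarrow> (nat set \<times> 'r \<times> 'r \<times> 'r) set" where
  "points13 t = {({1, 6, 8}, t * (t - 1), 1 - t, t), ({2, 4, 9}, t, t * (t - 1), 1 - t),
     ({3, 5, 7}, 1 - t, t, t * (t - 1)), ({1, 5, 9, 13}, - t, 1, t - 1),
     ({2, 6, 7, 13}, t - 1, - t, 1), ({3, 4, 8, 13}, 1, t - 1, - t),
     ({1, 4, 7, 10, 11}, 0, 0, 1), ({2, 5, 8, 11, 12}, 1, 0, 0), ({3, 6, 9, 10, 12}, 0, 1, 0)}"

lemma form13_simps:
  "form13 t 1 = vector [1, t, 0]" "form13 t (Suc 0) = vector [1, t, 0]"
  "form13 t 2 = vector [0, 1, t]" "form13 t 3 = vector [t, 0, 1]"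
  "form13 t 4 = vector [t - 1, - 1, 0]" "form13 t 5 = vector [0, t - 1, - 1]"
  "form13 t 6 = vector [- 1, 0, t - 1]" "form13 t 7 = vector [- t, 1 - t, 0]"
  "form13 t 8 = vector [0, - t, 1 - t]" "form13 t 9 = vector [1 - t, 0, - t]"
  "form13 t 10 = vector [1, 0, 0]" "form13 t 11 = vector [0, 1, 0]"
  "form13 t 12 = vector [0, 0, 1]" "form13 t 13 = vector [1, 1, 1]"
  by (simp_all add: form13_def row_form_def rows13_def vec3_def)

lemma form13_poly: "form13 t i = (\<chi> j. poly (form13 [:0, 1:] i $ j) t)"
proof -
  have "rows13 t = map (map_triple (\<lambda>p. poly p t)) (rows13 [:0, 1:])"
    by (simp add: rows13_def map_triple_def)
  then show ?thesis using row_form_map[of "\<lambda>p. poly p t"] by (simp add: form13_def)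
qed

lemma form13_of_int: "form13 (of_int t :: 'a::comm_ring_1) i = (\<chi> j. of_int (form13 t i $ j))"
proof -
  have "rows13 (of_int t :: 'a) = map (map_triple of_int) (rows13 t)"
    by (simp add: rows13_def map_triple_def)
  then show ?thesis using row_form_map[of "of_int :: int \<Rightarrow> 'a"] by (simp add: form13_def)
qed

lemma blocks13_points: "b \<in> L13_blocks \<Longrightarrow> \<exists>v. (b, v) \<in> points13 t"
proof -
  assume "b \<in> L13_blocks"
  moreover have "L13_blocks = fst ` points13 t" by (simp add: L13_blocks_def points13_def)
  ultimately show ?thesis by (metis imageE prod.collapse)
qed

lemma points13_incident: "(b, v) \<in> points13 t \<Longrightarrow> i \<in> b \<Longrightarrow> dotp (form13 t i) (vec3 v) = 0"
  unfolding points13_def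
  by (elim insertE emptyE Pair_inject; simp; elim disjE)
    (simp_all add: form13_simps dotp_3 vec3_def algebra_simps)

lemma points13_nonzero:
  assumes "(b, v) \<in> points13 ([:0, 1:] :: 'a::idom poly)"
  shows "vec3 v \<noteq> 0"
  using assms unfolding points13_def vec_eq_iff forall_3
  by (elim insertE emptyE Pair_inject) (simp_all add: vec3_def)

lemma block_system13: "block_system {1..13} L13_blocks"
proof (rule block_systemI)
  show "\<forall>b\<in>L13_blocks. 3 \<le> card b \<and> b \<subset> {1..13}"
    unfolding L13_blocks_def by code_simp
  show "\<forall>b\<in>L13_blocks. \<forall>b'\<in>L13_blocks. b = b' \<or> card (b \<inter> b') \<le> 1"
    unfolding L13_blocks_def by code_simp
qed (simp_all add: L13_blocks_def)

text \<open>\<open>t = 5\<close> is a sample parameter for \<open>nonempty\<close>. Integer entries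
  suit evaluation, and \<open>realizes_of_int\<close> carries the result to the complex
  numbers.\<close>

lemma realizes13: "realizes {1..13} L13_blocks (form13 (5 :: int))"
proof -
  let ?BL = "[[1, 6, 8], [2, 4, 9], [3, 5, 7], [1, 5, 9, 13], [2, 6, 7, 13], [3, 4, 8, 13],
    [1, 4, 7, 10, 11], [2, 5, 8, 11, 12], [3, 6, 9, 10, 12]]"
  have "List.enumerate 1 (rows13 5) =
    [(1, 1, 5, 0), (2, 0, 1, 5), (3, 5, 0, 1), (4, 4, - 1, 0), (5, 0, 4, - 1), (6, - 1, 0, 4),
     (7, - 5, - 4, 0), (8, 0, - 5, - 4), (9, - 4, 0, - 5), (10, 1, 0, 0), (11, 0, 1, 0), (12, 0,
         0, 1),
     (13, 1, 1, 1 :: int)]"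
    by (simp add: rows13_def)
  moreover have "triple_check ?BL \<dots>" by code_simp
  ultimately have "triple_check ?BL (List.enumerate 1 (rows13 5))" by simp
  then have "realizes {1..length (rows13 (5 :: int))} L13_blocks (row_form (rows13 (5 :: int)))"
    by (rule realizes_if_triple_check) (simp add: L13_blocks_def)
  moreover have "length (rows13 (5 :: int)) = 13" by (simp add: rows13_def)
  ultimately show ?thesis by (simp only: form13_def)
qed

section \<open>Normal form of the realizations with 13 planes\<close>

lemma L13_eq: "L13 = block_lattice {1..13} L13_blocks"
  unfolding L13_def block_lattice_def flats_def by (rule refl)

text \<open>The ratios \<open>r1\<close>, \<open>r4\<close>, \<open>r7\<close> of the planes through one vertex satisfy
  \<open>r1 (1 + r7) = r7 (1 + r4) = r4 (1 + r1)\<close>, which forces the common value to be \<open>- 1\<close>.\<close>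

lemma cyclic_ratios:
  fixes r1 r4 r7 :: "'a::field"
  assumes e: "r1 * (1 + r7) = r7 * (1 + r4)" "r4 * (1 + r1) = r1 * (1 + r7)"
    and d: "r1 \<noteq> r4" "r1 \<noteq> r7"
  shows "r1 * (1 + r7) = - 1"
proof -
  \<comment> \<open>Each difference of two ratios is a multiple of the next one; going once around
    gives \<open>r1 * r4 * r7 = 1\<close>.\<close>
  have 1: "r1 - r7 = r7 * (r4 - r1)" "r4 - r1 = r1 * (r7 - r4)" "r7 - r4 = r4 * (r1 - r7)"
    using e by (simp_all add: algebra_simps)
  then have "r1 - r7 = r7 * (r1 * (r4 * (r1 - r7)))" by simp
  moreover have "(r1 - r7) * (r1 * r4 * r7 - 1) = r7 * (r1 * (r4 * (r1 - r7))) - (r1 - r7)"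
    by (simp add: algebra_simps)
  ultimately have "(r1 - r7) * (r1 * r4 * r7 - 1) = 0" by simp
  then have p: "r1 * r4 * r7 = 1" using d by simp
  \<comment> \<open>The common value \<open>K\<close> satisfies \<open>(r - 1) * (K + 1) = 0\<close>
    for \<open>r1\<close> and for \<open>r4\<close>; distinct ratios cannot both be 1.\<close>
  define K where "K = r1 * (1 + r7)"
  have "(r1 - 1) * (K + 1) = r1 * r4 * r7 - 1 + r1 * (K - r7 * (1 + r4)) - (K - r1 * (1 + r7))"
    by (simp add: algebra_simps)
  also have "\<dots> = 0" using p e(1) by (simp add: K_def)
  finally have a: "(r1 - 1) * (K + 1) = 0" .
  have "(r4 - 1) * (K + 1) = r1 * r4 * r7 - 1 + r4 * (K - r1 * (1 + r7)) - (K - r4 * (1 + r1))"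
    by (simp add: algebra_simps)
  also have "\<dots> = 0" using p e(2) by (simp add: K_def)
  finally have "(r4 - 1) * (K + 1) = 0" .
  then have "K + 1 = 0" using a d(1) by (metis diff_eq_eq mult_eq_0_iff add_0)
  then show ?thesis by (simp add: K_def eq_neg_iff_add_eq_0)
qed

lemma realizes_bracket:
  "realizes I \<B> b \<Longrightarrow> i \<in> I \<Longrightarrow> j \<in> I \<Longrightarrow> k \<in> I \<Longrightarrow> i \<noteq> j \<Longrightarrow> i \<noteq> k \<Longrightarrow> j \<noteq> k \<Longrightarrow>
     bracket (b i) (b j) (b k) = 0 \<longleftrightarrow> (\<exists>B\<in>\<B>. {i, j, k} \<subseteq> B)"
  unfolding realizes_def by blast

text \<open>In the frame, planes 1 to 9 pass through the coordinate vertices, three through each,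
  and are described by one ratio \<open>u i\<close> each. The six concurrent triples with one plane
  from every vertex say that products of ratios are 1, plane 13 gives three relations
  \<open>v * (1 + u) = - 1\<close>, and eliminating all but \<open>u 1\<close>, \<open>u 4\<close>,
  \<open>u 7\<close> leaves the cyclic relations.\<close>

lemma normal_form13:
  fixes b :: "nat \<Rightarrow> 'a::field ^ 3"
  assumes r: "realizes {1..13} L13_blocks b" and frame: "std_frame 10 11 12 13 b"
  shows "\<exists>t. \<forall>i\<in>{1..13}. \<exists>c. b i = c *s form13 t i"
proof -
  have f: "b 10 = vector [1, 0, 0]" "b 11 = vector [0, 1, 0]" "b 12 = vector [0, 0, 1]"
    "b 13 = vector [1, 1, 1]"
    using frame by (simp_all add: std_frame_def)
  note R = realizes_bracket[OF r]
  define X where "X s = (vector [1, - s, 0] :: 'a ^ 3)" for s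
  define Y where "Y s = (vector [0, 1, - s] :: 'a ^ 3)" for s
  define Z where "Z s = (vector [- s, 0, 1] :: 'a ^ 3)" for s
  have bxyz: "bracket (X u) (Y v) (Z w) = 1 - u * v * w" for u v w
    by (simp add: bracket_def X_def Y_def Z_def algebra_simps)
  have bxy: "bracket (X u) (vector [1, 1, 1]) (Y v) = - (v * (1 + u) + 1)" for u v
    by (simp add: bracket_def X_def Y_def algebra_simps)
  have bxx: "bracket (X u) (X v) (vector [0, 0, 1]) = u - v" for u v
    by (simp add: bracket_def X_def algebra_simps)
  have X: "\<exists>c u. c \<noteq> 0 \<and> u \<noteq> 0 \<and> b i = c *s X u" if "i \<in> {1, 4, 7}" for i
  proof -
    have "b i $ 3 = 0" "b i $ 1 \<noteq> 0" "b i $ 2 \<noteq> 0"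
      using that R[of 10 11 i] R[of 11 12 i] R[of 10 12 i]
      by (auto simp: f L13_blocks_def bracket_def)
    then show ?thesis
      by (intro exI[of _ "b i $ 1"] exI[of _ "- (b i $ 2 / b i $ 1)"])
        (simp add: X_def vec_eq_iff forall_3)
  qed
  have Y: "\<exists>c u. c \<noteq> 0 \<and> u \<noteq> 0 \<and> b i = c *s Y u" if "i \<in> {2, 5, 8}" for i
  proof -
    have "b i $ 1 = 0" "b i $ 2 \<noteq> 0" "b i $ 3 \<noteq> 0"
      using that R[of 11 12 i] R[of 10 12 i] R[of 10 11 i]
      by (auto simp: f L13_blocks_def bracket_def)
    then show ?thesis
      by (intro exI[of _ "b i $ 2"] exI[of _ "- (b i $ 3 / b i $ 2)"])
        (simp add: Y_def vec_eq_iff forall_3)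
  qed
  have Z: "\<exists>c u. c \<noteq> 0 \<and> u \<noteq> 0 \<and> b i = c *s Z u" if "i \<in> {3, 6, 9}" for i
  proof -
    have "b i $ 2 = 0" "b i $ 3 \<noteq> 0" "b i $ 1 \<noteq> 0"
      using that R[of 10 12 i] R[of 10 11 i] R[of 11 12 i]
      by (auto simp: f L13_blocks_def bracket_def)
    then show ?thesis
      by (intro exI[of _ "b i $ 3"] exI[of _ "- (b i $ 1 / b i $ 3)"])
        (simp add: Z_def vec_eq_iff forall_3)
  qed
  obtain c u :: "nat \<Rightarrow> 'a" where c: "\<And>i. i \<in> {1..9} \<Longrightarrow> c i \<noteq> 0" and u: "\<And>i. i \<in> {1..9} \<Longrightarrow> u i \<noteq> 0"
    and b: "b 1 = c 1 *s X (u 1)" "b 4 = c 4 *s X (u 4)" "b 7 = c 7 *s X (u 7)"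
      "b 2 = c 2 *s Y (u 2)" "b 5 = c 5 *s Y (u 5)" "b 8 = c 8 *s Y (u 8)"
      "b 3 = c 3 *s Z (u 3)" "b 6 = c 6 *s Z (u 6)" "b 9 = c 9 *s Z (u 9)"
  proof -
    have "\<exists>c u. c \<noteq> 0 \<and> u \<noteq> 0 \<and> (i \<in> {1, 4, 7} \<longrightarrow> b i = c *s X u) \<and>
       (i \<in> {2, 5, 8} \<longrightarrow> b i = c *s Y u) \<and> (i \<in> {3, 6, 9} \<longrightarrow> b i = c *s Z u)" for i
    proof -
      consider "i \<in> {1, 4, 7}" | "i \<in> {2, 5, 8}" | "i \<in> {3, 6, 9}"
          | "i \<notin> {1, 2, 3, 4, 5, 6, 7, 8, 9}"
        by blast
      then show ?thesis
      proof cases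
        case 1
        moreover from this have "i \<notin> {2, 5, 8}" "i \<notin> {3, 6, 9}" by auto
        ultimately show ?thesis using X[of i] by blast
      next
        case 2
        moreover from this have "i \<notin> {1, 4, 7}" "i \<notin> {3, 6, 9}" by auto
        ultimately show ?thesis using Y[of i] by blast
      next
        case 3
        moreover from this have "i \<notin> {1, 4, 7}" "i \<notin> {2, 5, 8}" by auto
        ultimately show ?thesis using Z[of i] by blast
      next
        case 4 then show ?thesis by (intro exI[of _ 1]) auto
      qed
    qed
    then obtain c u where *: "\<And>i. c i \<noteq> 0 \<and> u i \<noteq> 0 \<and> (i \<in> {1, 4, 7} \<longrightarrow> b i = c i *s X (u i)) \<and>
       (i \<in> {2, 5, 8} \<longrightarrow> b i = c i *s Y (u i)) \<and> (i \<in> {3, 6, 9} \<longrightarrow> b i = c i *s Z (u i))"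
      by metis
    show thesis
      by (rule that[of c u]) (use * in auto)
  qed
  have b1: "b (Suc 0) = c (Suc 0) *s X (u (Suc 0))" using b(1) by simp
  have t: "u 1 * u 8 * u 6 = 1" "u 4 * u 2 * u 9 = 1" "u 7 * u 5 * u 3 = 1"
    "u 1 * u 5 * u 9 = 1" "u 7 * u 2 * u 6 = 1" "u 4 * u 8 * u 3 = 1"
    using R[of 1 8 6] R[of 4 2 9] R[of 7 5 3] R[of 1 5 9] R[of 7 2 6] R[of 4 8 3] c
    by (simp_all add: L13_blocks_def b b1 bracket_scale bxyz)
  have s: "- (u 5 * (1 + u 1)) = 1" "- (u 2 * (1 + u 7)) = 1" "- (u 8 * (1 + u 4)) = 1"
    using R[of 1 13 5] R[of 7 13 2] R[of 4 13 8] c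
    by (simp_all add: L13_blocks_def b b1 f bracket_scale bxy)
  have d: "u 1 \<noteq> u 4" "u 1 \<noteq> u 7"
    using R[of 1 4 12] R[of 1 7 12] c
    by (simp_all add: L13_blocks_def b b1 f bracket_scale bxx)
  have nz: "u 1 \<noteq> 0" "u 2 \<noteq> 0" "u 4 \<noteq> 0" "u 5 \<noteq> 0" "u 7 \<noteq> 0" "u 8 \<noteq> 0" using u by simp_all
  have s': "u 5 * (1 + u 1) = - 1" "u 2 * (1 + u 7) = - 1" "u 8 * (1 + u 4) = - 1"
    using s by (metis minus_minus)+
  \<comment> \<open>Two triples that share their \<open>Z\<close> plane have equal products of the
    other two ratios.\<close>
  have e: "u 1 * u 8 = u 7 * u 2" "u 4 * u 2 = u 1 * u 5" "u 7 * u 5 = u 4 * u 8"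
  proof -
    have "u 6 \<noteq> 0" "u 9 \<noteq> 0" "u 3 \<noteq> 0" using u by simp_all
    then show "u 1 * u 8 = u 7 * u 2" "u 4 * u 2 = u 1 * u 5" "u 7 * u 5 = u 4 * u 8"
      using t by (metis mult_right_cancel)+
  qed
  have k1: "u 1 * (1 + u 7) = u 7 * (1 + u 4)"
  proof -
    have "u 8 * u 2 * (u 1 * (1 + u 7)) = u 1 * u 8 * (u 2 * (1 + u 7))"
        by (simp add: algebra_simps)
    also have "\<dots> = u 7 * u 2 * (u 8 * (1 + u 4))" by (simp only: e s')
    also have "\<dots> = u 8 * u 2 * (u 7 * (1 + u 4))" by (simp add: algebra_simps)
    finally show ?thesis using nz by simp
  qed
  have k2: "u 4 * (1 + u 1) = u 1 * (1 + u 7)"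
  proof -
    have "u 2 * u 5 * (u 4 * (1 + u 1)) = u 4 * u 2 * (u 5 * (1 + u 1))"
        by (simp add: algebra_simps)
    also have "\<dots> = u 1 * u 5 * (u 2 * (1 + u 7))" by (simp only: e s')
    also have "\<dots> = u 2 * u 5 * (u 1 * (1 + u 7))" by (simp add: algebra_simps)
    finally show ?thesis using nz by simp
  qed
  have K: "u 1 * (1 + u 7) = - 1" by (rule cyclic_ratios[OF k1 k2 d])
  define t where "t = - u 1"
  have K4: "u 4 * (1 + u 1) = - 1" by (simp only: k2 K)
  then have "1 + u 1 \<noteq> 0" by (metis mult_zero_right neg_equal_0_iff_equal zero_neq_one)
  then have "1 - t \<noteq> 0" by (simp add: t_def)
  then have t0: "t \<noteq> 0" "t \<noteq> 1" using nz(1)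
      by (auto simp only: t_def neg_equal_0_iff_equal right_minus_eq)
  have u1: "u (Suc 0) = - t" by (simp add: t_def)
  have "t * (1 + u 7) = - (u 1 * (1 + u 7))" by (simp add: t_def)
  then have "t * (1 + u 7) = 1" unfolding K by simp
  then have u7: "u 7 = (1 - t) / t" using t0 by (simp add: field_simps)
  have "(t - 1) * u 4 = - (u 4 * (1 + u 1))" by (simp add: t_def algebra_simps)
  then have "(t - 1) * u 4 = 1" unfolding K4 by simp
  then have u4: "u 4 = 1 / (t - 1)" using t0 by (simp add: field_simps)
  have "(t - 1) * u 5 = - (u 5 * (1 + u 1))" by (simp add: t_def algebra_simps)
  then have "(t - 1) * u 5 = 1" unfolding s' by simp
  then have u5: "u 5 = 1 / (t - 1)" using t0 by (simp add: field_simps)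
  have u2: "u 2 = - t" using s'(2) t0 by (simp add: u7 field_simps)
  have u8: "u 8 = (1 - t) / t" using s'(3) t0 by (simp add: u4 field_simps)
  have uniq: "v = w" if "x * v = 1" "x * w = 1" for x v w :: 'a
    using that by (metis mult.commute mult.left_commute mult_1)
  have u6: "u 6 = 1 / (t - 1)"
    by (rule uniq[OF t(1)]) (use t0 in \<open>simp add: u1 u8 divide_simps algebra_simps\<close>)
  have u9: "u 9 = (1 - t) / t"
    by (rule uniq[OF t(2)]) (use t0 in \<open>simp add: u4 u2 divide_simps algebra_simps\<close>)
  have u3: "u 3 = - t"
    by (rule uniq[OF t(3)]) (use t0 in \<open>simp add: u7 u5 divide_simps algebra_simps\<close>)
  have "b 1 = c 1 *s form13 t 1" "b 2 = c 2 *s form13 t 2" "b 3 = c 3 *s form13 t 3"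
    "b 4 = (c 4 / (t - 1)) *s form13 t 4" "b 5 = (c 5 / (t - 1)) *s form13 t 5"
    "b 6 = (c 6 / (t - 1)) *s form13 t 6" "b 7 = (c 7 / - t) *s form13 t 7"
    "b 8 = (c 8 / - t) *s form13 t 8" "b 9 = (c 9 / - t) *s form13 t 9"
    unfolding b using t0
    by (simp_all add: X_def Y_def Z_def form13_simps vec_eq_iff forall_3 u1 u2 u3 u4 u5 u6 u7 u8 u9
        field_simps)
  moreover have "b 10 = 1 *s form13 t 10" "b 11 = 1 *s form13 t 11" "b 12 = 1 *s form13 t 12"
    "b 13 = 1 *s form13 t 13"
    by (simp_all add: f form13_simps)
  moreover have "{1..13 :: nat} = {1, 2, 3, 4, 5, 6, 7, 8, 9, 10, 11, 12, 13}" by code_simp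
  ultimately have "\<forall>i\<in>{1..13}. \<exists>c. b i = c *s form13 t i"
    by (simp only: ball_simps) blast
  then show ?thesis by blast
qed

interpretation family13: family "{1..13}" L13_blocks "form13 ([:0, 1:] :: complex poly)"
    10 11 12 13 1
proof -
  interpret block_system "{1..13}" L13_blocks by (rule block_system13)
  have generic: "\<forall>b\<in>L13_blocks. \<not> {10, 11, 12} \<subseteq> b \<and> \<not> {10, 11, 13} \<subseteq> b \<and>
      \<not> {10, 12, 13} \<subseteq> b \<and> \<not> {11, 12, 13} \<subseteq> b \<and> \<not> {1, 11, 12} \<subseteq> b"
    unfolding L13_blocks_def by code_simp
  show "family {1..13} L13_blocks (form13 ([:0, 1:] :: complex poly)) 10 11 12 13 1"
  proof
    show "L13_blocks \<noteq> {}" by (simp add: L13_blocks_def)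
    show "{10, 11, 12, 13, 1} \<subseteq> {1..13 :: nat}" "distinct [10, 11, 12, 13 :: nat]"
      "distinct [1, 11, 12 :: nat]" by simp_all
    show "\<not> {10, 11, 12} \<subseteq> b \<and> \<not> {10, 11, 13} \<subseteq> b \<and> \<not> {10, 12, 13} \<subseteq> b \<and>
        \<not> {11, 12, 13} \<subseteq> b \<and> \<not> {1, 11, 12} \<subseteq> b" if "b \<in> L13_blocks" for b
      using generic that by (rule bspec)
    show "std_frame 10 11 12 13 (\<lambda>i. \<chi> j. poly (form13 [:0, 1:] i $ j) t)" for t :: complex
      by (simp add: std_frame_def form13_simps flip: form13_poly)
    show "poly (form13 [:0, 1:] 1 $ 1) t = 1" "poly (form13 [:0, 1:] 1 $ 2) t = t" for t :: complex
      by (simp_all add: form13_simps)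
    show "bracket (form13 [:0, 1:] i) (form13 [:0, 1:] j) (form13 ([:0, 1:] :: complex poly) k) = 0"
      if b: "b \<in> L13_blocks" "{i, j, k} \<subseteq> b" for b i j k
    proof -
      obtain v where v: "(b, v) \<in> points13 ([:0, 1:] :: complex poly)"
        using blocks13_points[OF b(1)] by blast
      show ?thesis
        using b(2)
            by (intro bracket_eq_0_of_point[OF points13_nonzero[OF v]] points13_incident[OF v]) auto
    qed
    show "\<exists>t :: complex. realizes {1..13} L13_blocks (\<lambda>i. \<chi> j. poly (form13 [:0, 1:] i $ j) t)"
      unfolding form13_poly[symmetric]
      by (rule exI, rule realizes_of_int[OF realizes13 form13_of_int])
    show "\<exists>t. \<forall>i\<in>{1..13}. \<exists>c. b i = c *s (\<chi> j. poly (form13 [:0, 1:] i $ j) t)"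
      if "realizes {1..13} L13_blocks b" "std_frame 10 11 12 13 b" for b :: "nat \<Rightarrow> complex ^ 3"
      unfolding form13_poly[symmetric] by (rule normal_form13[OF that])
  qed
qed

section \<open>A basis of derivations for 13 planes\<close>

lemma pmap_vector3: "pfun a \<Longrightarrow> pfun b \<Longrightarrow> pfun c \<Longrightarrow> pmap (\<lambda>x :: 'a::comm_ring_1 ^ 'n. vector [a x, b
    x, c x] :: 'a ^ 3)"
  unfolding pmap_def forall_3 by simp

text \<open>The product of the forms of the three planes through a vertex is, up to a factor, the cubic
  \<open>x\<^sup>3 - p x\<^sup>2 y - (3 + p) x y\<^sup>2 - y\<^sup>3\<close>.\<close>

definition cubic :: "'a::comm_ring_1 \<Rightarrow> 'a \<Rightarrow> 'a \<Rightarrow> 'a" where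
  "cubic p x y = x ^ 3 - p * x ^ 2 * y - (3 + p) * x * y ^ 2 - y ^ 3"

text \<open>\<open>u\<close>, \<open>v\<close>, \<open>w\<close> are the coefficients of a quadratic
  syzygy of the cubics in \<open>(x, y)\<close>, \<open>(y, z)\<close>, \<open>(z, x)\<close>; the
  suffix distinguishes two of them. Degree two makes the derivation one of degree
  \<open>1 + 3 + 2 = 6\<close>, and both syzygies also respect the plane
  \<open>x + y + z = 0\<close> (\<open>last_plane1\<close>, \<open>last_plane2\<close>).\<close>

definition syz_u1 :: "'a::comm_ring_1 \<Rightarrow> 'a \<Rightarrow> 'a \<Rightarrow> 'a \<Rightarrow> 'a" where
  "syz_u1 p x y z = y * y - x * x - (4 + p) * x * z + (1 - p) * y * z - (3 + 2 * p) * z * z"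
definition syz_v1 :: "'a::comm_ring_1 \<Rightarrow> 'a \<Rightarrow> 'a \<Rightarrow> 'a \<Rightarrow> 'a" where
  "syz_v1 p x y z = (p - 1) * x * x + (3 + p) * x * y - x * z + y * y + y * z"
definition syz_w1 :: "'a::comm_ring_1 \<Rightarrow> 'a \<Rightarrow> 'a \<Rightarrow> 'a \<Rightarrow> 'a" where
  "syz_w1 p x y z = p * x * y - x * x - x * z + (4 + p) * y * y + y * z"
definition syz_u2 :: "'a::comm_ring_1 \<Rightarrow> 'a \<Rightarrow> 'a \<Rightarrow> 'a \<Rightarrow> 'a" where
  "syz_u2 p x y z = (3 + p) * x * x - x * y + (13 + 7 * p + p * p) * x * z - (4 + p) * y * y
     + (p * p + 3 * p - 3) * y * z + (13 + 10 * p + 2 * p * p) * z * z"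
definition syz_v2 :: "'a::comm_ring_1 \<Rightarrow> 'a \<Rightarrow> 'a \<Rightarrow> 'a \<Rightarrow> 'a" where
  "syz_v2 p x y z = 4 * x * z - (4 * p + p * p) * x * x - (13 + 7 * p + p * p) * x * y - (4 + p) *
      y * y
     - (3 + p) * y * z + z * z"
definition syz_w2 :: "'a::comm_ring_1 \<Rightarrow> 'a \<Rightarrow> 'a \<Rightarrow> 'a \<Rightarrow> 'a" where
  "syz_w2 p x y z = (3 + p) * x * x - (1 + 3 * p + p * p) * x * y + (4 + p) * x * z
     - (13 + 6 * p + p * p) * y * y + z * z"

lemma syzygy1: "syz_u1 p x y z * cubic p x y + syz_v1 p x y z * cubic p y z + syz_w1 p x y z *
    cubic p z x = 0"
  by (simp add: syz_u1_def syz_v1_def syz_w1_def cubic_def algebra_simps power2_eq_square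
      power3_eq_cube)

lemma syzygy2: "syz_u2 p x y z * cubic p x y + syz_v2 p x y z * cubic p y z + syz_w2 p x y z *
    cubic p z x = 0"
  by (simp add: syz_u2_def syz_v2_def syz_w2_def cubic_def algebra_simps power2_eq_square
      power3_eq_cube)

lemma last_plane1:
  assumes "x + y + z = 0"
  shows "y * cubic p y z * syz_v1 p x y z - x * cubic p z x * syz_w1 p x y z = 0"
proof -
  have z: "z = - x - y" using assms by (simp add: eq_neg_iff_add_eq_0 algebra_simps)
  show ?thesis
    unfolding z
        by (simp add: syz_v1_def syz_w1_def cubic_def algebra_simps power2_eq_square power3_eq_cube)
qed

lemma last_plane2:
  assumes "x + y + z = 0"
  shows "y * cubic p y z * syz_v2 p x y z - x * cubic p z x * syz_w2 p x y z = 0"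
proof -
  have z: "z = - x - y" using assms by (simp add: eq_neg_iff_add_eq_0 algebra_simps)
  show ?thesis
    unfolding z
        by (simp add: syz_v2_def syz_w2_def cubic_def algebra_simps power2_eq_square power3_eq_cube)
qed

text \<open>Up to sign, what remains of the determinant of the identity and the two derivations once
  \<open>x y z\<close> and two cubics are taken out. The constant factor \<open>2 * p + 3\<close>
  has to be shown nonzero.\<close>

lemma minor13: "syz_w1 p x y z * syz_v2 p x y z - syz_v1 p x y z * syz_w2 p x y z =
    (2 * p + 3) * (x + y + z) * cubic p x y"
  by (simp add: syz_v1_def syz_w1_def syz_v2_def syz_w2_def cubic_def algebra_simps
      power2_eq_square power3_eq_cube)

text \<open>Modulo the Euler derivation, a derivation tangent to the planes through the vertices is a
  syzygy of the three cubics.\<close>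

definition der13 ::
  "'a \<Rightarrow> ('a \<Rightarrow> 'a \<Rightarrow> 'a \<Rightarrow> 'a) \<Rightarrow> ('a \<Rightarrow> 'a \<Rightarrow> 'a \<Rightarrow> 'a) \<Rightarrow> 'a::comm_ring_1 ^ 3 \<Rightarrow> 'a ^ 3"
  where
  "der13 p v w x = vector [- (x $ 1 * cubic p (x $ 3) (x $ 1) * w (x $ 1) (x $ 2) (x $ 3)),
     x $ 2 * cubic p (x $ 2) (x $ 3) * v (x $ 1) (x $ 2) (x $ 3), 0]"

lemma pmap_der13:
  assumes "pfun (\<lambda>x :: 'a::comm_ring_1 ^ 3. v (x $ 1) (x $ 2) (x $ 3))"
    "pfun (\<lambda>x :: 'a ^ 3. w (x $ 1) (x $ 2) (x $ 3))"
  shows "pmap (der13 p v w)"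
  unfolding der13_def[abs_def] cubic_def
  by (intro pmap_vector3 polyfn_intros pfun_coord assms)

lemma homog_der13:
  assumes "\<And>s x y z. v (s * x) (s * y) (s * z) = s ^ 2 * v x y z"
    "\<And>s x y z. w (s * x) (s * y) (s * z) = s ^ 2 * w x y z"
  shows "homog_map 6 (der13 p v w)"
proof -
  have "cubic p (s * x) (s * y) = s ^ 3 * cubic p x y" for s x y
    by (simp add: cubic_def algebra_simps power2_eq_square power3_eq_cube)
  then show ?thesis
    unfolding homog_map_def vec_eq_iff forall_3 vector_smult_component der13_def
    by (simp add: assms eval_nat_numeral mult_ac)
qed

lemma preserves_der13:
  fixes t :: "'a::field_char_0"
  assumes t: "t \<noteq> 0" "t \<noteq> 1" and p: "p = - t + 1 / (t - 1) + (1 - t) / t"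
    and syz: "\<And>x y z. u x y z * cubic p x y + v x y z * cubic p y z + w x y z * cubic p z x = 0"
    and last: "\<And>x y z. x + y + z = 0 \<Longrightarrow> y * cubic p y z * v x y z - x * cubic p z x * w x y z = 0"
    and i: "i \<in> {1..13}" and x: "dotp (form13 t i) x = 0"
  shows "dotp (form13 t i) (der13 p v w x) = 0"
proof -
  define c1 c2 c3 where c: "c1 = x $ 1" "c2 = x $ 2" "c3 = x $ 3"
  \<comment> \<open>The roots \<open>- t\<close>, \<open>1 / (t - 1)\<close>,
    \<open>(1 - t) / t\<close> have sum \<open>p\<close> and product 1, and their second symmetric
    function is \<open>- (3 + p)\<close>; hence the single coefficient \<open>p\<close>.\<close>
  have fac: "t * (t - 1) * cubic p r s = (r + t * s) * ((t - 1) * r - s) * (t * r - (1 - t) * s)"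
      for r s
  proof -
    have "t * (t - 1) * p = - (t * t * (t - 1)) + t - (1 - t) * (1 - t)"
      using t by (simp add: p field_simps)
    then have "t * (t - 1) * cubic p r s = t * (t - 1) * r ^ 3 - (- (t * t * (t - 1)) + t - (1 -
        t) * (1 - t)) * r ^ 2 * s
        - (3 * (t * (t - 1)) + (- (t * t * (t - 1)) + t - (1 - t) * (1 - t))) * r * s ^ 2 - t * (t
            - 1) * s ^ 3"
      by (simp add: cubic_def right_diff_distrib distrib_left flip: mult.assoc)
    then show ?thesis by (simp add: algebra_simps power2_eq_square power3_eq_cube)
  qed
  have cub: "cubic p r s = 0" if "r + t * s = 0 \<or> (t - 1) * r - s = 0 \<or> t * r - (1 - t) * s = 0"
      for r s
    using fac[of r s] that t by auto
  have syz0: "cubic p c3 c1 * w c1 c2 c3 = - (cubic p c2 c3 * v c1 c2 c3)" if "cubic p c1 c2 = 0"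
    using syz[of c1 c2 c3] that by (simp add: algebra_simps eq_neg_iff_add_eq_0)
  define A where "A = cubic p c3 c1 * w c1 c2 c3"
  define B where "B = cubic p c2 c3 * v c1 c2 c3"
  have dot: "dotp a (der13 p v w x) = a $ 2 * (c2 * B) - a $ 1 * (c1 * A)" for a
    by (simp add: dotp_3 der13_def A_def B_def c algebra_simps)
  \<comment> \<open>Planes through the vertex \<open>(0, 0, 1)\<close>: where the first cubic
    vanishes the syzygy leaves \<open>A = - B\<close>, and the derivation scales the first two
    coordinates by the same factor.\<close>
  have pencil: "a $ 2 * (c2 * B) - a $ 1 * (c1 * A) = 0"
    if "a $ 1 * c1 + a $ 2 * c2 = 0" "cubic p c1 c2 = 0" for a :: "'a ^ 3"
  proof -
    have "A = - B" using syz0[OF that(2)] by (simp add: A_def B_def)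
    then have "a $ 2 * (c2 * B) - a $ 1 * (c1 * A) = (a $ 1 * c1 + a $ 2 * c2) * B"
      by (simp add: algebra_simps)
    then show ?thesis using that(1) by simp
  qed
  have "{1..13 :: nat} = {1, 2, 3, 4, 5, 6, 7, 8, 9, 10, 11, 12, 13}" by code_simp
  with i have "i \<in> {1, 2, 3, 4, 5, 6, 7, 8, 9, 10, 11, 12, 13}" by (simp only:)
  then consider "i = 1" | "i = 2" | "i = 3" | "i = 4" | "i = 5" | "i = 6" | "i = 7" | "i = 8"
    | "i = 9" | "i = 10" | "i = 11" | "i = 12" | "i = 13" by blast
  then show ?thesis
  proof cases
    case 1
    have "c1 + t * c2 = 0" using x by (simp add: 1 form13_simps dotp_3 c)
    then show ?thesis unfolding dot
      by (intro pencil cub)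
        (simp_all add: 1 form13_simps)
  next
    case 4
    have e: "(t - 1) * c1 - c2 = 0" using x by (simp add: 4 form13_simps dotp_3 c)
    show ?thesis unfolding dot
      by (intro pencil cub)
        (use e in \<open>simp_all add: 4 form13_simps\<close>)
  next
    case 7
    have e: "t * c1 - (1 - t) * c2 = 0"
      using x by (simp add: 7 form13_simps dotp_3 c add_eq_0_iff)
    show ?thesis unfolding dot
      by (intro pencil cub)
        (use e in \<open>simp_all add: 7 form13_simps\<close>)
  next
    case 2
    have "c2 + t * c3 = 0" using x by (simp add: 2 form13_simps dotp_3 c)
    then have "cubic p c2 c3 = 0" by (intro cub) simp
    then show ?thesis unfolding dot by (simp add: B_def 2 form13_simps)
  next
    case 5
    have "(t - 1) * c2 - c3 = 0" using x by (simp add: 5 form13_simps dotp_3 c)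
    then have "cubic p c2 c3 = 0" by (intro cub) simp
    then show ?thesis unfolding dot by (simp add: B_def 5 form13_simps)
  next
    case 8
    have "t * c2 - (1 - t) * c3 = 0" using x by (simp add: 8 form13_simps dotp_3 c add_eq_0_iff)
    then have "cubic p c2 c3 = 0" by (intro cub) simp
    then show ?thesis unfolding dot by (simp add: B_def 8 form13_simps)
  next
    case 3
    have "c3 + t * c1 = 0" using x by (simp add: 3 form13_simps dotp_3 c add.commute)
    then have "cubic p c3 c1 = 0" by (intro cub) simp
    then show ?thesis unfolding dot by (simp add: A_def 3 form13_simps)
  next
    case 6
    have "(t - 1) * c3 - c1 = 0" using x by (simp add: 6 form13_simps dotp_3 c)
    then have "cubic p c3 c1 = 0" by (intro cub) simp
    then show ?thesis unfolding dot by (simp add: A_def 6 form13_simps)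
  next
    case 9
    have "t * c3 - (1 - t) * c1 = 0" using x by (simp add: 9 form13_simps dotp_3 c)
    then have "cubic p c3 c1 = 0" by (intro cub) simp
    then show ?thesis unfolding dot by (simp add: A_def 9 form13_simps)
  next
    case 10
    then show ?thesis using x unfolding dot by (simp add: form13_simps dotp_3 c)
  next
    case 11
    then show ?thesis using x unfolding dot by (simp add: form13_simps dotp_3 c)
  next
    case 12
    then show ?thesis unfolding dot by (simp add: form13_simps)
  next
    case 13
    have "c1 + c2 + c3 = 0" using x by (simp add: 13 form13_simps dotp_3 c)
    from last[OF this] show ?thesis
      unfolding dot by (simp add: 13 form13_simps A_def B_def mult.assoc)
  qed
qed

lemma basis13:
  fixes t :: "'a::field_char_0"
  assumes r: "realizes {1..13} L13_blocks (form13 t)"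
  shows "\<exists>F G. homogeneous_basis {1..13} (form13 t) F G 6"
proof -
  interpret block_system "{1..13}" L13_blocks by (rule block_system13)
  interpret realization_char_0 "{1..13}" L13_blocks "form13 t" by unfold_locales (rule r)
  note R = realizes_bracket[OF r]
  have t: "t \<noteq> 0" "t \<noteq> 1"
    using R[of 1 10 12] R[of 4 11 12] by (auto simp: L13_blocks_def form13_simps bracket_def)
  \<comment> \<open>The factors of \<open>2 * p + 3\<close>; they are nonzero because planes 1, 2,
    3, planes 4, 5, 6 and planes 7, 8, 9 are not concurrent.\<close>
  have t': "t + 1 \<noteq> 0" "2 * t - 1 \<noteq> 0" "t - 2 \<noteq> 0"
  proof -
    have "1 + t * (t * t) \<noteq> 0" using R[of 1 2 3]
        by (simp add: L13_blocks_def form13_simps bracket_def)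
    moreover have "1 + t * (t * t) = (t + 1) * (t * t - t + 1)" by (simp add: algebra_simps)
    ultimately show "t + 1 \<noteq> 0" by auto
    have "(t - 1) * ((t - 1) * (t - 1)) - 1 \<noteq> 0"
      using R[of 4 5 6] by (simp add: L13_blocks_def form13_simps bracket_def)
    moreover have "(t - 1) * ((t - 1) * (t - 1)) - 1 = (t - 2) * (t * t - t + 1)"
        by (simp add: algebra_simps)
    ultimately show "t - 2 \<noteq> 0" by auto
    have "bracket (form13 t 7) (form13 t 8) (form13 t 9) \<noteq> 0"
      using R[of 7 8 9] by (simp add: L13_blocks_def)
    moreover have "bracket (form13 t 7) (form13 t 8) (form13 t 9) = - ((2 * t - 1) * (t * t - t +
        1))"
      by (simp add: form13_simps bracket_def algebra_simps)
    ultimately show "2 * t - 1 \<noteq> 0" by auto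
  qed
  define p where "p = - t + 1 / (t - 1) + (1 - t) / t"
  have "t * (t - 1) * (2 * p + 3) = - ((t + 1) * (2 * t - 1) * (t - 2))"
    using t by (simp add: p_def field_simps)
  then have p3: "2 * p + 3 \<noteq> 0" using t' by auto
  let ?F = "der13 p (syz_v1 p) (syz_w1 p)" and ?G = "der13 p (syz_v2 p) (syz_w2 p)"
  have pm: "pmap ?F" "pmap ?G"
    by (intro pmap_der13; unfold syz_v1_def syz_w1_def syz_v2_def syz_w2_def; intro polyfn_intros
        pfun_coord)+
  have hom: "homog_map 6 ?F" "homog_map 6 ?G"
    by (intro homog_der13; simp add: syz_v1_def syz_w1_def syz_v2_def syz_w2_def algebra_simps
        power2_eq_square)+
  have pres: "preserves planes ?F" "preserves planes ?G"
    unfolding preserves_iff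
    using preserves_der13[OF t p_def syzygy1 last_plane1] preserves_der13[OF t p_def syzygy2
        last_plane2]
    by blast+
  have det: "bracket x (?F x) (?G x) = - ((2 * p + 3) * x $ 1 * x $ 2 * x $ 3 * (x $ 1 + x $ 2 + x
      $ 3) *
      cubic p (x $ 1) (x $ 2) * cubic p (x $ 2) (x $ 3) * cubic p (x $ 3) (x $ 1))" for x
  proof -
    have "bracket x (?F x) (?G x) = - (x $ 1 * x $ 2 * x $ 3 * cubic p (x $ 2) (x $ 3) * cubic p
        (x $ 3) (x $ 1) *
       (syz_w1 p (x $ 1) (x $ 2) (x $ 3) * syz_v2 p (x $ 1) (x $ 2) (x $ 3) -
        syz_v1 p (x $ 1) (x $ 2) (x $ 3) * syz_w2 p (x $ 1) (x $ 2) (x $ 3)))"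
      by (simp add: bracket_def der13_def algebra_simps)
    then show ?thesis unfolding minor13 by (simp add: mult_ac)
  qed
  have ex: "\<exists>x. bracket x (?F x) (?G x) \<noteq> 0"
  proof -
    have c: "pfun (\<lambda>x :: 'a ^ 3. cubic p (x $ i) (x $ j))" for i j
      unfolding cubic_def by (intro polyfn_intros pfun_coord)
    have nz: "\<exists>x. f x * g x \<noteq> 0" if "pfun f" "pfun g" "f x \<noteq> 0" "g y \<noteq> 0" for f g :: "'a ^ 3 \<Rightarrow> 'a"
        and x y
      using pfun_mult_eq_0_on[OF affine_set_UNIV that(1,2) _ _ that(3)] that(4) by blast
    let ?c = "\<lambda>i j (x :: 'a ^ 3). cubic p (x $ i) (x $ j)"
    have c1: "?c i j (axis i 1) \<noteq> 0" if "i \<noteq> j" for i j :: 3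
      using that by (simp add: cubic_def axis_def)
    obtain x1 where x1: "?c 1 2 x1 * ?c 2 3 x1 \<noteq> 0" using nz[OF c c c1 c1, of 1 2 2 3] by auto
    obtain x2 where x2: "(?c 1 2 x2 * ?c 2 3 x2) * ?c 3 1 x2 \<noteq> 0"
      using nz[OF polyfn_mult[OF c c] c x1 c1, of 3 1] by auto
    let ?m = "\<lambda>x :: 'a ^ 3. x $ 1 * x $ 2 * x $ 3 * (x $ 1 + x $ 2 + x $ 3)"
    have "?m (vector [1, 1, 1]) \<noteq> 0" by simp
    moreover have "pfun ?m" by (intro polyfn_intros pfun_coord)
    ultimately obtain x where "?m x * ((?c 1 2 x * ?c 2 3 x) * ?c 3 1 x) \<noteq> 0"
      using nz[OF _ polyfn_mult[OF polyfn_mult[OF c c] c] _ x2] by blast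
    then have "bracket x (?F x) (?G x) \<noteq> 0" unfolding det using p3 by auto
    then show ?thesis by blast
  qed
  have "homogeneous_basis {1..13} (form13 t) ?F ?G 6"
    by unfold_locales (rule pm hom pres ex | simp)+
  then show ?thesis by blast
qed

section \<open>The family with 15 planes\<close>

text \<open>The 15 planes join the pairs among the six points \<open>(0, -1, t)\<close>, \<open>(0, 1, t)\<close>, \<open>(1, 0, -1)\<close>,
  \<open>(1, 0, 1)\<close>, \<open>(1, -1, 0)\<close>, \<open>(1, 1, 0)\<close>, two on each side of the coordinate triangle.
  They are numbered in the order in which \<open>L15_forms\<close> lists the planes.\<close>

definition blocks15 :: "nat set set" where
  "blocks15 =
     {{1, 2, 6}, {3, 10, 13}, {4, 10, 15}, {5, 7, 12}, {6, 8, 9}, {7, 11, 14},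
      {1, 4, 7, 9, 13}, {1, 5, 8, 10, 14}, {2, 3, 7, 8, 15}, {2, 9, 10, 11, 12},
      {3, 4, 5, 6, 11}, {6, 12, 13, 14, 15}}"

definition rows15 :: "'r::comm_ring_1 \<Rightarrow> ('r \<times> 'r \<times> 'r) list" where
  "rows15 t = [(1, t, 1), (- 1, - t, 1), (- t, - t, 1), (t, t, 1), (1, 1, 1), (0, 0, 1), (1, 0, 0),
     (1, - t, 1), (- 1, t, 1), (0, 1, 0), (1, 1, - 1), (1, - 1, - 1), (- t, t, 1), (1, - 1, 1),
     (t, - t, 1)]"

definition form15 :: "'r::comm_ring_1 \<Rightarrow> nat \<Rightarrow> 'r ^ 3" where
  "form15 t = row_form (rows15 t)"

definition points15 :: "'r::comm_ring_1 \<Rightarrow> (nat set \<times> 'r \<times> 'r \<times> 'r) set" where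
  "points15 t = {({1, 2, 6}, t, - 1, 0), ({3, 10, 13}, 1, 0, t), ({4, 10, 15}, - 1, 0, t),
     ({5, 7, 12}, 0, 1, - 1), ({6, 8, 9}, t, 1, 0), ({7, 11, 14}, 0, 1, 1),
     ({1, 4, 7, 9, 13}, 0, 1, - t), ({1, 5, 8, 10, 14}, 1, 0, - 1), ({2, 3, 7, 8, 15}, 0, 1, t),
     ({2, 9, 10, 11, 12}, 1, 0, 1), ({3, 4, 5, 6, 11}, 1, - 1, 0), ({6, 12, 13, 14, 15}, 1, 1, 0)}"

lemma form15_simps:
  "form15 t 1 = vector [1, t, 1]" "form15 t (Suc 0) = vector [1, t, 1]"
  "form15 t 2 = vector [- 1, - t, 1]" "form15 t 3 = vector [- t, - t, 1]"
  "form15 t 4 = vector [t, t, 1]" "form15 t 5 = vector [1, 1, 1]"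
  "form15 t 6 = vector [0, 0, 1]" "form15 t 7 = vector [1, 0, 0]"
  "form15 t 8 = vector [1, - t, 1]" "form15 t 9 = vector [- 1, t, 1]"
  "form15 t 10 = vector [0, 1, 0]" "form15 t 11 = vector [1, 1, - 1]"
  "form15 t 12 = vector [1, - 1, - 1]" "form15 t 13 = vector [- t, t, 1]"
  "form15 t 14 = vector [1, - 1, 1]" "form15 t 15 = vector [t, - t, 1]"
  by (simp_all add: form15_def row_form_def rows15_def vec3_def)

lemma form15_poly: "form15 t i = (\<chi> j. poly (form15 [:0, 1:] i $ j) t)"
proof -
  have "rows15 t = map (map_triple (\<lambda>p. poly p t)) (rows15 [:0, 1:])"
    by (simp add: rows15_def map_triple_def)
  then show ?thesis using row_form_map[of "\<lambda>p. poly p t"] by (simp add: form15_def)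
qed

lemma form15_of_int: "form15 (of_int t :: 'a::comm_ring_1) i = (\<chi> j. of_int (form15 t i $ j))"
proof -
  have "rows15 (of_int t :: 'a) = map (map_triple of_int) (rows15 t)"
    by (simp add: rows15_def map_triple_def)
  then show ?thesis using row_form_map[of "of_int :: int \<Rightarrow> 'a"] by (simp add: form15_def)
qed

lemma blocks15_points: "b \<in> blocks15 \<Longrightarrow> \<exists>v. (b, v) \<in> points15 t"
proof -
  assume "b \<in> blocks15"
  moreover have "blocks15 = fst ` points15 t" by (simp add: blocks15_def points15_def)
  ultimately show ?thesis by (metis imageE prod.collapse)
qed

lemma points15_incident: "(b, v) \<in> points15 t \<Longrightarrow> i \<in> b \<Longrightarrow> dotp (form15 t i) (vec3 v) = 0"
  unfolding points15_def
  by (elim insertE emptyE Pair_inject; simp; elim disjE)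
    (simp_all add: form15_simps dotp_3 vec3_def algebra_simps)

lemma points15_nonzero:
  assumes "(b, v) \<in> points15 t"
  shows "vec3 v \<noteq> 0"
  using assms unfolding points15_def vec_eq_iff forall_3
  by (elim insertE emptyE Pair_inject) (simp_all add: vec3_def)

lemma block_system15: "block_system {1..15} blocks15"
proof (rule block_systemI)
  show "\<forall>b\<in>blocks15. 3 \<le> card b \<and> b \<subset> {1..15}"
    unfolding blocks15_def by code_simp
  show "\<forall>b\<in>blocks15. \<forall>b'\<in>blocks15. b = b' \<or> card (b \<inter> b') \<le> 1"
    unfolding blocks15_def by code_simp
qed (simp_all add: blocks15_def)

definition block_list15 :: "nat list list" where
  "block_list15 = [[1, 2, 6], [3, 10, 13], [4, 10, 15], [5, 7, 12], [6, 8, 9], [7, 11, 14],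
     [1, 4, 7, 9, 13], [1, 5, 8, 10, 14], [2, 3, 7, 8, 15], [2, 9, 10, 11, 12],
     [3, 4, 5, 6, 11], [6, 12, 13, 14, 15]]"

lemma blocks15_list: "blocks15 = set ` set block_list15"
  by (simp add: blocks15_def block_list15_def)

lemma realizes15: "realizes {1..15} blocks15 (form15 (5 :: int))"
proof -
  have "List.enumerate 1 (rows15 5) =
    [(1, 1, 5, 1), (2, - 1, - 5, 1), (3, - 5, - 5, 1), (4, 5, 5, 1), (5, 1, 1, 1), (6, 0, 0, 1),
     (7, 1, 0, 0), (8, 1, - 5, 1), (9, - 1, 5, 1), (10, 0, 1, 0), (11, 1, 1, - 1), (12, 1, - 1, -
         1),
     (13, - 5, 5, 1), (14, 1, - 1, 1), (15, 5, - 5, 1 :: int)]"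
    by (simp add: rows15_def)
  moreover have "triple_check block_list15 \<dots>" by code_simp
  ultimately have "triple_check block_list15 (List.enumerate 1 (rows15 5))" by simp
  then have "realizes {1..length (rows15 (5 :: int))} blocks15 (row_form (rows15 (5 :: int)))"
    by (rule realizes_if_triple_check) (rule blocks15_list)
  moreover have "length (rows15 (5 :: int)) = 15" by (simp add: rows15_def)
  ultimately show ?thesis by (simp only: form15_def)
qed

text \<open>The blocks through 5 and 10, and through 5 and 6, reduce planes 1, 8, 14 and 3, 4, 11 to
  one coefficient each. Those of 14 and 11 are equal, have product 1 and differ from 1, hence are
  \<open>- 1\<close>; that of plane 1 is the free parameter, and planes 2, 9, 12, 13, 15 are each
  fixed by two blocks.\<close>

lemma normal_form15:
  fixes b :: "nat \<Rightarrow> 'a::field ^ 3"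
  assumes r: "realizes {1..15} blocks15 b" and frame: "std_frame 7 10 6 5 b"
  shows "\<exists>t. \<forall>i\<in>{1..15}. \<exists>c. b i = c *s form15 t i"
proof -
  have f: "b 7 = vector [1, 0, 0]" "b 10 = vector [0, 1, 0]" "b 6 = vector [0, 0, 1]"
    "b 5 = vector [1, 1, 1]"
    using frame by (simp_all add: std_frame_def)
  note R = realizes_bracket[OF r]
  define c where "c i = b i $ 1" for i
  have c0: "c i \<noteq> 0" if "i \<in> {1, 2, 3, 4, 8, 9, 11, 12, 13, 14, 15}" for i
  proof -
    have "bracket (b i) (b 10) (b 6) \<noteq> 0"
      using that R[of i 10 6] by (elim insertE emptyE) (simp_all add: blocks15_def)
    then show ?thesis by (simp add: f c_def bracket_def)
  qed
  have "\<exists>v. b i = c i *s vector [1, v, 1]" if "i \<in> {1, 8, 14}" for i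
  proof -
    have "bracket (b 5) (b 10) (b i) = 0"
      using that R[of 5 10 i] by (elim insertE emptyE) (simp_all add: blocks15_def)
    then have "b i $ 3 = b i $ 1" by (simp add: f bracket_def)
    then show ?thesis using c0[of i] that
      by (intro exI[of _ "b i $ 2 / b i $ 1"]) (auto simp: vec_eq_iff forall_3 c_def)
  qed
  then obtain v where v: "b 1 = c 1 *s vector [1, v 1, 1]" "b 8 = c 8 *s vector [1, v 8, 1]"
    "b 14 = c 14 *s vector [1, v (14 :: nat), 1]" by (metis insertCI)
  have "\<exists>w. b i = c i *s vector [1, 1, w]" if "i \<in> {3, 4, 11}" for i
  proof -
    have "bracket (b 5) (b 6) (b i) = 0"
      using that R[of 5 6 i] by (elim insertE emptyE) (simp_all add: blocks15_def)
    then have "b i $ 2 = b i $ 1" by (simp add: f bracket_def)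
    then show ?thesis using c0[of i] that
      by (intro exI[of _ "b i $ 3 / b i $ 1"]) (auto simp: vec_eq_iff forall_3 c_def)
  qed
  then obtain w where w: "b 3 = c 3 *s vector [1, 1, w 3]" "b 4 = c 4 *s vector [1, 1, w 4]"
    "b 11 = c 11 *s vector [1, 1, w (11 :: nat)]" by (metis insertCI)
  have v1: "b (Suc 0) = c (Suc 0) *s vector [1, v (Suc 0), 1]" using v(1) by simp
  note nz = c0[of 1, simplified] c0[of 8, simplified] c0[of 14, simplified] c0[of 3, simplified]
    c0[of 4, simplified] c0[of 11, simplified]
  have "w 11 * v 14 = 1"
    using R[of 7 11 14] nz by (simp add: blocks15_def f v w bracket_scale) (simp add: bracket_def)
  moreover have d12: "b 12 = c 12 *s vector [1, v 14, w 11]"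
  proof -
    have "bracket (b 10) (b 11) (b 12) = 0" using R[of 10 11 12] by (simp add: blocks15_def)
    then have 3: "b 12 $ 3 = w 11 * c 12"
      using nz by (simp add: f w bracket_scale) (simp add: bracket_def c_def algebra_simps)
    have "bracket (b 6) (b 14) (b 12) = 0" using R[of 6 14 12] by (simp add: blocks15_def)
    then have "b 12 $ 2 = v 14 * c 12"
      using nz by (simp add: f v bracket_scale) (simp add: bracket_def c_def algebra_simps)
    then show ?thesis using 3 by (simp add: vec_eq_iff forall_3 c_def mult.commute)
  qed
  moreover have "w 11 = v 14"
    using R[of 7 5 12] c0[of 12]
        by (simp add: blocks15_def f d12 bracket_scale) (simp add: bracket_def)
  moreover have "v 14 \<noteq> 1"
    using R[of 5 14 6] nz by (simp add: blocks15_def f v bracket_scale) (simp add: bracket_def)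
  ultimately have m: "v 14 = - 1" "w 11 = - 1"
    using square_eq_1_iff[of "v 14"] by (auto simp: power2_eq_square)
  have "v 1 * w 4 = 1"
    using R[of 7 1 4] nz by (simp add: blocks15_def f v v1 w bracket_scale) (simp add: bracket_def)
  have "v 8 * w 3 = 1"
    using R[of 7 8 3] nz by (simp add: blocks15_def f v w bracket_scale) (simp add: bracket_def)
  have d2: "b 2 = c 2 *s vector [1, - v 8, - 1]"
  proof -
    have "bracket (b 10) (b 11) (b 2) = 0" using R[of 10 11 2] by (simp add: blocks15_def)
    then have 3: "b 2 $ 3 = - c 2"
      using nz by (simp add: f w m bracket_scale) (simp add: bracket_def c_def algebra_simps
          add_eq_0_iff)
    have "bracket (b 7) (b 8) (b 2) = 0" using R[of 7 8 2] by (simp add: blocks15_def)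
    then have "b 2 $ 2 = v 8 * b 2 $ 3"
      using nz by (simp add: f v bracket_scale) (simp add: bracket_def algebra_simps)
    then show ?thesis using 3 by (simp add: vec_eq_iff forall_3 c_def mult.commute)
  qed
  define t where "t = v 1"
  have v8: "v 8 = - t"
  proof -
    have "bracket (b 1) (b 2) (b 6) = 0" using R[of 1 2 6] by (simp add: blocks15_def)
    then have "- v 8 - v 1 = 0"
      using nz c0[of 2] unfolding v(1) d2 f bracket_scale by (simp add: bracket_def)
    then have "- v 8 = v 1" by simp
    then show ?thesis unfolding t_def by (metis minus_minus)
  qed
  have d9: "b 9 = c 9 *s vector [1, - t, - 1]"
  proof -
    have "bracket (b 10) (b 11) (b 9) = 0" using R[of 10 11 9] by (simp add: blocks15_def)
    then have 3: "b 9 $ 3 = - c 9"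
      using nz by (simp add: f w m bracket_scale) (simp add: bracket_def c_def algebra_simps
          add_eq_0_iff)
    have "bracket (b 7) (b 1) (b 9) = 0" using R[of 7 1 9] by (simp add: blocks15_def)
    then have "b 9 $ 2 = t * b 9 $ 3"
      using nz unfolding v(1) f bracket_scale by (simp add: bracket_def t_def algebra_simps)
    then show ?thesis using 3 by (simp add: vec_eq_iff forall_3 c_def mult.commute)
  qed
  have t0: "t \<noteq> 0" using \<open>v 1 * w 4 = 1\<close> by (auto simp: t_def)
  have d13: "b 13 = c 13 *s vector [1, - 1, - 1 / t]"
  proof -
    have "bracket (b 6) (b 14) (b 13) = 0" using R[of 6 14 13] by (simp add: blocks15_def)
    then have 2: "b 13 $ 2 = - c 13"
      using nz by (simp add: f v m bracket_scale) (simp add: bracket_def c_def algebra_simps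
          add_eq_0_iff)
    have "bracket (b 7) (b 1) (b 13) = 0" using R[of 7 1 13] by (simp add: blocks15_def)
    then have "b 13 $ 2 = t * b 13 $ 3"
      using nz unfolding v(1) f bracket_scale by (simp add: bracket_def t_def algebra_simps)
    then show ?thesis using 2 t0 by (simp add: vec_eq_iff forall_3 c_def field_simps)
  qed
  have d15: "b 15 = c 15 *s vector [1, - 1, 1 / t]"
  proof -
    have "bracket (b 6) (b 14) (b 15) = 0" using R[of 6 14 15] by (simp add: blocks15_def)
    then have 2: "b 15 $ 2 = - c 15"
      using nz by (simp add: f v m bracket_scale) (simp add: bracket_def c_def algebra_simps
          add_eq_0_iff)
    have "bracket (b 7) (b 8) (b 15) = 0" using R[of 7 8 15] by (simp add: blocks15_def)
    then have "b 15 $ 2 = - t * b 15 $ 3"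
      using nz by (simp add: f v v8 bracket_scale) (simp add: bracket_def algebra_simps
          add_eq_0_iff)
    then show ?thesis using 2 t0 by (simp add: vec_eq_iff forall_3 c_def field_simps)
  qed
  have w4: "w 4 = 1 / t" using \<open>v 1 * w 4 = 1\<close> t0 by (simp add: t_def field_simps)
  have w3: "w 3 = - 1 / t"
    using \<open>v 8 * w 3 = 1\<close> t0 by (simp add: v8 field_simps) (metis minus_minus)
  have "b 1 = c 1 *s form15 t 1" "b 2 = (- c 2) *s form15 t 2" "b 3 = (- c 3 / t) *s form15 t 3"
    "b 4 = (c 4 / t) *s form15 t 4" "b 8 = c 8 *s form15 t 8" "b 9 = (- c 9) *s form15 t 9"
    "b 11 = c 11 *s form15 t 11" "b 12 = c 12 *s form15 t 12" "b 13 = (- c 13 / t) *s form15 t 13"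
    "b 14 = c 14 *s form15 t 14" "b 15 = (c 15 / t) *s form15 t 15"
    unfolding v w d2 d9 d12 d13 d15 using t0
    by (simp_all add: form15_simps vec_eq_iff forall_3 v8 m w3 w4 t_def[symmetric])
      (simp add: t_def)
  moreover have "b 5 = 1 *s form15 t 5" "b 6 = 1 *s form15 t 6" "b 7 = 1 *s form15 t 7"
    "b 10 = 1 *s form15 t 10"
    by (simp_all add: f form15_simps)
  moreover have "{1..15 :: nat} = {1, 2, 3, 4, 5, 6, 7, 8, 9, 10, 11, 12, 13, 14, 15}" by code_simp
  ultimately have "\<forall>i\<in>{1..15}. \<exists>c. b i = c *s form15 t i"
    by (simp only: ball_simps) blast
  then show ?thesis by blast
qed

interpretation family15: family "{1..15}" blocks15 "form15 ([:0, 1:] :: complex poly)" 7 10 6 5 1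
proof -
  interpret block_system "{1..15}" blocks15 by (rule block_system15)
  have generic: "\<forall>b\<in>blocks15. \<not> {7, 10, 6} \<subseteq> b \<and> \<not> {7, 10, 5} \<subseteq> b \<and>
      \<not> {7, 6, 5} \<subseteq> b \<and> \<not> {10, 6, 5} \<subseteq> b \<and> \<not> {1, 10, 6} \<subseteq> b"
    unfolding blocks15_def by code_simp
  show "family {1..15} blocks15 (form15 ([:0, 1:] :: complex poly)) 7 10 6 5 1"
  proof
    show "blocks15 \<noteq> {}" by (simp add: blocks15_def)
    show "{7, 10, 6, 5, 1} \<subseteq> {1..15 :: nat}" "distinct [7, 10, 6, 5 :: nat]"
      "distinct [1, 10, 6 :: nat]" by simp_all
    show "\<not> {7, 10, 6} \<subseteq> b \<and> \<not> {7, 10, 5} \<subseteq> b \<and> \<not> {7, 6, 5} \<subseteq> b \<and>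
        \<not> {10, 6, 5} \<subseteq> b \<and> \<not> {1, 10, 6} \<subseteq> b" if "b \<in> blocks15" for b
      using generic that by (rule bspec)
    show "std_frame 7 10 6 5 (\<lambda>i. \<chi> j. poly (form15 [:0, 1:] i $ j) t)" for t :: complex
      by (simp add: std_frame_def form15_simps flip: form15_poly)
    show "poly (form15 [:0, 1:] 1 $ 1) t = 1" "poly (form15 [:0, 1:] 1 $ 2) t = t" for t :: complex
      by (simp_all add: form15_simps)
    show "bracket (form15 [:0, 1:] i) (form15 [:0, 1:] j) (form15 ([:0, 1:] :: complex poly) k) = 0"
      if b: "b \<in> blocks15" "{i, j, k} \<subseteq> b" for b i j k
    proof -
      obtain v where v: "(b, v) \<in> points15 ([:0, 1:] :: complex poly)"
        using blocks15_points[OF b(1)] by blast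
      show ?thesis
        using b(2)
            by (intro bracket_eq_0_of_point[OF points15_nonzero[OF v]] points15_incident[OF v]) auto
    qed
    show "\<exists>t :: complex. realizes {1..15} blocks15 (\<lambda>i. \<chi> j. poly (form15 [:0, 1:] i $ j) t)"
      unfolding form15_poly[symmetric]
      by (rule exI, rule realizes_of_int[OF realizes15 form15_of_int])
    show "\<exists>t. \<forall>i\<in>{1..15}. \<exists>c. b i = c *s (\<chi> j. poly (form15 [:0, 1:] i $ j) t)"
      if "realizes {1..15} blocks15 b" "std_frame 7 10 6 5 b" for b :: "nat \<Rightarrow> complex ^ 3"
      unfolding form15_poly[symmetric] by (rule normal_form15[OF that])
  qed
qed

text \<open>Sign changes of the coordinates permute the planes \<open>\<plusminus> x \<plusminus> t y + z = 0\<close>, the planes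
  \<open>\<plusminus> t x \<plusminus> t y + z = 0\<close> and the planes \<open>\<plusminus> x \<plusminus> y + z = 0\<close>. Hence a derivation \<open>(x f, y g, 0)\<close> with
  cubic forms \<open>f\<close>, \<open>g\<close> in the squares of the coordinates has to be tested on one plane of each type
  only. The two solutions below, with \<open>u = t\<^sup>2\<close>, come from solving these linear conditions for the
  coefficients of \<open>f\<close> and \<open>g\<close>.\<close>

definition coeff_x1 :: "'a::comm_ring_1 \<Rightarrow> 'a \<Rightarrow> 'a \<Rightarrow> 'a \<Rightarrow> 'a" where
  "coeff_x1 u X Y Z =
    (3 * u - 6 * u ^ 2 + 19 * u ^ 3) * X ^ 3
    + (10 * u + 23 * u ^ 2 - 44 * u ^ 3 - 5 * u ^ 4) * X ^ 2 * Y
    + (- 3 + 4 * u - 31 * u ^ 2 - 18 * u ^ 3) * X ^ 2 * Z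
    + (- 5 * u - 20 * u ^ 2 + 7 * u ^ 3 + 2 * u ^ 4) * X * Y ^ 2
    + (1 - 6 * u - 82 * u ^ 2 + 50 * u ^ 3 + 5 * u ^ 4) * X * Y * Z
    + (2 + 11 * u + 36 * u ^ 2 - u ^ 3) * X * Z ^ 2
    + (11 * u ^ 2 - 22 * u ^ 3 + 27 * u ^ 4) * Y ^ 3
    + (6 * u - 23 * u ^ 2 - 20 * u ^ 3 - 11 * u ^ 4) * Y ^ 2 * Z
    + (- 1 - 4 * u + 59 * u ^ 2 - 6 * u ^ 3) * Y * Z ^ 2 + (1 - 18 * u + u ^ 2) * Z ^ 3"

definition coeff_y1 :: "'a::comm_ring_1 \<Rightarrow> 'a \<Rightarrow> 'a \<Rightarrow> 'a \<Rightarrow> 'a" where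
  "coeff_y1 u X Y Z =
    (10 * u - 4 * u ^ 2 + 26 * u ^ 3) * X ^ 3
    + (20 * u ^ 2 - 72 * u ^ 3 - 12 * u ^ 4) * X ^ 2 * Y
    + (- 4 - 8 * u - 68 * u ^ 2 + 16 * u ^ 3) * X ^ 2 * Z
    + (- 2 * u - 16 * u ^ 2 + 22 * u ^ 3 + 28 * u ^ 4) * X * Y ^ 2
    + (2 + 20 * u - 76 * u ^ 2 - 12 * u ^ 3 + 2 * u ^ 4) * X * Y * Z
    + (- 4 + 54 * u - 16 * u ^ 2 - 2 * u ^ 3) * X * Z ^ 2
    + (8 * u ^ 2 - 16 * u ^ 3 + 8 * u ^ 4) * Y ^ 3
    + (- 8 * u + 8 * u ^ 2 + 8 * u ^ 3 - 8 * u ^ 4) * Y ^ 2 * Z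
    + (8 * u - 16 * u ^ 2 + 8 * u ^ 3) * Y * Z ^ 2"

definition coeff_x2 :: "'a::comm_ring_1 \<Rightarrow> 'a \<Rightarrow> 'a \<Rightarrow> 'a \<Rightarrow> 'a" where
  "coeff_x2 u X Y Z =
    (3 * u + 4 * u ^ 2 + 15 * u ^ 3 + 26 * u ^ 4) * X ^ 3
    + (10 * u + 67 * u ^ 2 - 58 * u ^ 3 - 61 * u ^ 4 - 6 * u ^ 5) * X ^ 2 * Y
    + (- 3 - 6 * u - 55 * u ^ 2 - 52 * u ^ 3 - 28 * u ^ 4) * X ^ 2 * Z
    + (- 5 * u - 26 * u ^ 2 - 65 * u ^ 3 + 52 * u ^ 4 - 4 * u ^ 5) * X * Y ^ 2
    + (1 - 8 * u - 150 * u ^ 2 - 26 * u ^ 3 + 81 * u ^ 4 + 6 * u ^ 5) * X * Y * Z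
    + (2 + 39 * u + 62 * u ^ 2 + 39 * u ^ 3 + 2 * u ^ 4) * X * Z ^ 2
    + (11 * u ^ 2 - 12 * u ^ 3 + 23 * u ^ 4 + 26 * u ^ 5) * Y ^ 3
    + (6 * u - 3 * u ^ 2 - 118 * u ^ 3 - 19 * u ^ 4 - 10 * u ^ 5) * Y ^ 2 * Z
    + (- 1 - 2 * u + 83 * u ^ 2 + 84 * u ^ 3 - 20 * u ^ 4) * Y * Z ^ 2
    + (1 - 36 * u - 11 * u ^ 2 - 2 * u ^ 3) * Z ^ 3"

definition coeff_y2 :: "'a::comm_ring_1 \<Rightarrow> 'a \<Rightarrow> 'a \<Rightarrow> 'a \<Rightarrow> 'a" where
  "coeff_y2 u X Y Z =
    (10 * u + 32 * u ^ 2 + 18 * u ^ 3 + 36 * u ^ 4) * X ^ 3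
    + (36 * u ^ 2 - 120 * u ^ 3 - 92 * u ^ 4 - 16 * u ^ 5) * X ^ 2 * Y
    + (- 4 - 24 * u - 148 * u ^ 2 - 32 * u ^ 3 + 16 * u ^ 4) * X ^ 2 * Z
    + (- 2 * u - 20 * u ^ 2 - 10 * u ^ 3 + 104 * u ^ 4 + 24 * u ^ 5) * X * Y ^ 2
    + (2 + 24 * u - 68 * u ^ 2 - 164 * u ^ 3 + 10 * u ^ 4 + 4 * u ^ 5) * X * Y * Z
    + (- 4 + 78 * u + 60 * u ^ 2 - 34 * u ^ 3 - 4 * u ^ 4) * X * Z ^ 2
    + (8 * u ^ 2 - 8 * u ^ 3 - 8 * u ^ 4 + 8 * u ^ 5) * Y ^ 3
    + (- 8 * u + 8 * u ^ 2 + 8 * u ^ 4 - 8 * u ^ 5) * Y ^ 2 * Z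
    + (8 * u - 16 * u ^ 2 + 8 * u ^ 3) * Z ^ 3"

text \<open>On the plane \<open>x + t y + z = 0\<close> the square of \<open>z\<close> is
  \<open>(x + t * y) ^ 2\<close>, so this is tangency to that plane written in two variables; the
  following identities treat the two further types and the second solution in the same way.\<close>

lemma tangent_family1:
  fixes x :: "'a::field_char_0"
  shows "x * coeff_x1 (t ^ 2) (x ^ 2) (y ^ 2) ((x + t * y) ^ 2) +
    t * y * coeff_y1 (t ^ 2) (x ^ 2) (y ^ 2) ((x + t * y) ^ 2) = 0"
  unfolding coeff_x1_def coeff_y1_def by algebra

lemma tangent_diagonal1:
  fixes x :: "'a::field_char_0"
  shows "x * coeff_x1 (t ^ 2) (x ^ 2) (y ^ 2) ((t * x + t * y) ^ 2) +
    y * coeff_y1 (t ^ 2) (x ^ 2) (y ^ 2) ((t * x + t * y) ^ 2) = 0"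
  unfolding coeff_x1_def coeff_y1_def by algebra

lemma tangent_constant1:
  fixes x :: "'a::field_char_0"
  shows "x * coeff_x1 u (x ^ 2) (y ^ 2) ((x + y) ^ 2) +
    y * coeff_y1 u (x ^ 2) (y ^ 2) ((x + y) ^ 2) = 0"
  unfolding coeff_x1_def coeff_y1_def by algebra

lemma tangent_family2:
  fixes x :: "'a::field_char_0"
  shows "x * coeff_x2 (t ^ 2) (x ^ 2) (y ^ 2) ((x + t * y) ^ 2) +
    t * y * coeff_y2 (t ^ 2) (x ^ 2) (y ^ 2) ((x + t * y) ^ 2) = 0"
  unfolding coeff_x2_def coeff_y2_def by algebra

lemma tangent_diagonal2:
  fixes x :: "'a::field_char_0"
  shows "x * coeff_x2 (t ^ 2) (x ^ 2) (y ^ 2) ((t * x + t * y) ^ 2) +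
    y * coeff_y2 (t ^ 2) (x ^ 2) (y ^ 2) ((t * x + t * y) ^ 2) = 0"
  unfolding coeff_x2_def coeff_y2_def by algebra

lemma tangent_constant2:
  fixes x :: "'a::field_char_0"
  shows "x * coeff_x2 u (x ^ 2) (y ^ 2) ((x + y) ^ 2) +
    y * coeff_y2 u (x ^ 2) (y ^ 2) ((x + y) ^ 2) = 0"
  unfolding coeff_x2_def coeff_y2_def by algebra

definition der15 ::
  "('a \<Rightarrow> 'a \<Rightarrow> 'a \<Rightarrow> 'a) \<Rightarrow> ('a \<Rightarrow> 'a \<Rightarrow> 'a \<Rightarrow> 'a) \<Rightarrow> 'a::comm_ring_1 ^ 3 \<Rightarrow> 'a ^ 3"
  where
  "der15 f g x = vector [x $ 1 * f ((x $ 1) ^ 2) ((x $ 2) ^ 2) ((x $ 3) ^ 2),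
     x $ 2 * g ((x $ 1) ^ 2) ((x $ 2) ^ 2) ((x $ 3) ^ 2), 0]"

lemma pmap_der15:
  assumes "pfun (\<lambda>x :: 'a::comm_ring_1 ^ 3. f ((x $ 1) ^ 2) ((x $ 2) ^ 2) ((x $ 3) ^ 2))"
    "pfun (\<lambda>x :: 'a ^ 3. g ((x $ 1) ^ 2) ((x $ 2) ^ 2) ((x $ 3) ^ 2))"
  shows "pmap (der15 f g)"
  unfolding der15_def[abs_def]
  by (intro pmap_vector3 polyfn_intros pfun_coord assms)

lemma homog_der15:
  assumes "\<And>s x y z. f (s * x) (s * y) (s * z) = s ^ 3 * f x y z"
    "\<And>s x y z. g (s * x) (s * y) (s * z) = s ^ 3 * g x y z"
  shows "homog_map 7 (der15 f g)"
  unfolding homog_map_def vec_eq_iff forall_3 vector_smult_component der15_def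
  by (simp add: assms power_mult_distrib flip: power_mult) (simp add: eval_nat_numeral mult_ac)

lemma preserves_der15:
  fixes t :: "'a::field_char_0"
  assumes family: "\<And>x y. x * f (x ^ 2) (y ^ 2) ((x + t * y) ^ 2) + t * y * g (x ^ 2) (y ^ 2) ((x +
      t * y) ^ 2) = 0"
    and diagonal: "\<And>x y. x * f (x ^ 2) (y ^ 2) ((t * x + t * y) ^ 2) + y * g (x ^ 2) (y ^ 2) ((t *
        x + t * y) ^ 2) = 0"
    and const: "\<And>x y. x * f (x ^ 2) (y ^ 2) ((x + y) ^ 2) + y * g (x ^ 2) (y ^ 2) ((x + y) ^ 2) = 0"
    and i: "i \<in> {1..15}" and x: "dotp (form15 t i) x = 0"
  shows "dotp (form15 t i) (der15 f g x) = 0"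
proof -
  define c1 c2 c3 where c: "c1 = x $ 1" "c2 = x $ 2" "c3 = x $ 3"
  define A where "A = c1 * f (c1 ^ 2) (c2 ^ 2) (c3 ^ 2)"
  define B where "B = c2 * g (c1 ^ 2) (c2 ^ 2) (c3 ^ 2)"
  have dot: "dotp a (der15 f g x) = a $ 1 * A + a $ 2 * B" for a
    by (simp add: dotp_3 der15_def A_def B_def c)
  have F: "A + t * B = 0" if "c3 = c1 + t * c2 \<or> c3 = - (c1 + t * c2)"
  proof -
    have "c3 ^ 2 = (c1 + t * c2) ^ 2" unfolding power2_eq_iff using that by simp
    then show ?thesis using family[of c1 c2] by (simp add: A_def B_def mult.assoc)
  qed
  \<comment> \<open>Replacing \<open>c2\<close> by its negative keeps the squares and changes the
    sign of \<open>B\<close>.\<close>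
  have F': "A - t * B = 0" if "c3 = c1 - t * c2 \<or> c3 = t * c2 - c1"
  proof -
    have "c3 ^ 2 = (c1 + t * (- c2)) ^ 2" unfolding power2_eq_iff using that by simp
    then show ?thesis using family[of c1 "- c2"] by (simp add: A_def B_def mult.assoc)
  qed
  have D: "A + B = 0" if "c3 = t * c1 + t * c2 \<or> c3 = - (t * c1 + t * c2)"
  proof -
    have "c3 ^ 2 = (t * c1 + t * c2) ^ 2" unfolding power2_eq_iff using that by simp
    then show ?thesis using diagonal[of c1 c2] by (simp add: A_def B_def)
  qed
  have D': "A - B = 0" if "c3 = t * c1 - t * c2 \<or> c3 = t * c2 - t * c1"
  proof -
    have "c3 ^ 2 = (t * c1 + t * (- c2)) ^ 2" unfolding power2_eq_iff using that by simp
    then show ?thesis using diagonal[of c1 "- c2"] by (simp add: A_def B_def)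
  qed
  have C: "A + B = 0" if "c3 = c1 + c2 \<or> c3 = - (c1 + c2)"
  proof -
    have "c3 ^ 2 = (c1 + c2) ^ 2" unfolding power2_eq_iff using that by simp
    then show ?thesis using const[of c1 c2] by (simp add: A_def B_def)
  qed
  have C': "A - B = 0" if "c3 = c1 - c2 \<or> c3 = c2 - c1"
  proof -
    have "c3 ^ 2 = (c1 + (- c2)) ^ 2" unfolding power2_eq_iff using that by simp
    then show ?thesis using const[of c1 "- c2"] by (simp add: A_def B_def)
  qed
  have "{1..15 :: nat} = {1, 2, 3, 4, 5, 6, 7, 8, 9, 10, 11, 12, 13, 14, 15}" by code_simp
  with i have "i \<in> {1, 2, 3, 4, 5, 6, 7, 8, 9, 10, 11, 12, 13, 14, 15}" by (simp only:)
  then consider "i = 1" | "i = 2" | "i = 3" | "i = 4" | "i = 5" | "i = 6" | "i = 7" | "i = 8"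
    | "i = 9" | "i = 10" | "i = 11" | "i = 12" | "i = 13" | "i = 14" | "i = 15" by blast
  then show ?thesis
  proof cases
    case 1
    have "c3 = - (c1 + t * c2)"
      using x unfolding 1 form15_simps dotp_3 c vector_3 by algebra
    then have "A + t * B = 0" by (intro F) simp
    then show ?thesis unfolding dot by (simp add: 1 form15_simps)
  next
    case 2
    have "c3 = c1 + t * c2"
      using x unfolding 2 form15_simps dotp_3 c vector_3 by algebra
    then have "A + t * B = 0" by (intro F) simp
    then have "- (A + t * B) = 0" by simp
    then show ?thesis unfolding dot by (simp add: 2 form15_simps algebra_simps)
  next
    case 3
    have "c3 = t * c1 + t * c2"
      using x unfolding 3 form15_simps dotp_3 c vector_3 by algebra
    then have "A + B = 0" by (intro D) simp
    then have "(- t) * (A + B) = 0" by simp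
    then show ?thesis unfolding dot by (simp add: 3 form15_simps algebra_simps)
  next
    case 4
    have "c3 = - (t * c1 + t * c2)"
      using x unfolding 4 form15_simps dotp_3 c vector_3 by algebra
    then have "A + B = 0" by (intro D) simp
    then have "t * (A + B) = 0" by simp
    then show ?thesis unfolding dot by (simp add: 4 form15_simps algebra_simps)
  next
    case 5
    have "c3 = - (c1 + c2)"
      using x unfolding 5 form15_simps dotp_3 c vector_3 by algebra
    then have "A + B = 0" by (intro C) simp
    then show ?thesis unfolding dot by (simp add: 5 form15_simps)
  next
    case 6
    then show ?thesis unfolding dot by (simp add: form15_simps)
  next
    case 7
    then show ?thesis using x unfolding dot by (simp add: form15_simps dotp_3 c A_def)
  next
    case 8
    have "c3 = t * c2 - c1"
      using x unfolding 8 form15_simps dotp_3 c vector_3 by algebra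
    then have "A - t * B = 0" by (intro F') simp
    then show ?thesis unfolding dot by (simp add: 8 form15_simps)
  next
    case 9
    have "c3 = c1 - t * c2"
      using x unfolding 9 form15_simps dotp_3 c vector_3 by algebra
    then have "A - t * B = 0" by (intro F') simp
    then have "- (A - t * B) = 0" by simp
    then show ?thesis unfolding dot by (simp add: 9 form15_simps algebra_simps)
  next
    case 10
    then show ?thesis using x unfolding dot by (simp add: form15_simps dotp_3 c B_def)
  next
    case 11
    have "c3 = c1 + c2"
      using x unfolding 11 form15_simps dotp_3 c vector_3 by algebra
    then have "A + B = 0" by (intro C) simp
    then show ?thesis unfolding dot by (simp add: 11 form15_simps)
  next
    case 12
    have "c3 = c1 - c2"
      using x unfolding 12 form15_simps dotp_3 c vector_3 by algebra
    then have "A - B = 0" by (intro C') simp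
    then show ?thesis unfolding dot by (simp add: 12 form15_simps)
  next
    case 13
    have "c3 = t * c1 - t * c2"
      using x unfolding 13 form15_simps dotp_3 c vector_3 by algebra
    then have "A - B = 0" by (intro D') simp
    then have "(- t) * (A - B) = 0" by simp
    then show ?thesis unfolding dot by (simp add: 13 form15_simps algebra_simps)
  next
    case 14
    have "c3 = c2 - c1"
      using x unfolding 14 form15_simps dotp_3 c vector_3 by algebra
    then have "A - B = 0" by (intro C') simp
    then show ?thesis unfolding dot by (simp add: 14 form15_simps)
  next
    case 15
    have "c3 = t * c2 - t * c1"
      using x unfolding 15 form15_simps dotp_3 c vector_3 by algebra
    then have "A - B = 0" by (intro D') simp
    then have "t * (A - B) = 0" by simp
    then show ?thesis unfolding dot by (simp add: 15 form15_simps algebra_simps)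
  qed
qed

lemma basis15:
  fixes t :: "'a::field_char_0"
  assumes r: "realizes {1..15} blocks15 (form15 t)"
  shows "\<exists>F G. homogeneous_basis {1..15} (form15 t) F G 7"
proof -
  interpret block_system "{1..15}" blocks15 by (rule block_system15)
  interpret realization_char_0 "{1..15}" blocks15 "form15 t" by unfold_locales (rule r)
  note R = realizes_bracket[OF r]
  \<comment> \<open>The first three brackets exclude \<open>t\<close> equal to 0, 1 and -1, the last
    two are the factors of \<open>1 - 18 * u + u ^ 2\<close>; together they control the value of
    \<open>m\<close> at \<open>(0, 0, 1)\<close>.\<close>
  have "bracket (form15 t 1) (form15 t 7) (form15 t 6) \<noteq> 0"
      "bracket (form15 t 1) (form15 t 5) (form15 t 6) \<noteq> 0"
    "bracket (form15 t 1) (form15 t 14) (form15 t 6) \<noteq> 0"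
    "bracket (form15 t 1) (form15 t 3) (form15 t 12) \<noteq> 0"
    "bracket (form15 t 1) (form15 t 11) (form15 t 15) \<noteq> 0"
    using R[of 1 7 6] R[of 1 5 6] R[of 1 14 6] R[of 1 3 12] R[of 1 11 15]
    by (simp_all add: blocks15_def)
  then have t: "t \<noteq> 0" "t - 1 \<noteq> 0" "t + 1 \<noteq> 0"
      and t': "1 + 4 * t - t ^ 2 \<noteq> 0" "1 - 4 * t - t ^ 2 \<noteq> 0"
    by (auto simp: form15_simps bracket_def algebra_simps power2_eq_square add_eq_0_iff)
  define u where "u = t ^ 2"
  have "1 - u = - ((t - 1) * (t + 1))" by (simp add: u_def power2_eq_square algebra_simps)
  moreover have "1 - 18 * u + u ^ 2 = (1 + 4 * t - t ^ 2) * (1 - 4 * t - t ^ 2)"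
    by (simp add: u_def power2_eq_square algebra_simps)
  ultimately have u: "u \<noteq> 0" "1 - u \<noteq> 0" "1 - 18 * u + u ^ 2 \<noteq> 0"
    using t t' by (auto simp: u_def)
  let ?F = "der15 (coeff_x1 u) (coeff_y1 u)" and ?G = "der15 (coeff_x2 u) (coeff_y2 u)"
  have pf: "pfun (\<lambda>x :: 'a ^ 3. coeff_x1 u ((x $ 1) ^ 2) ((x $ 2) ^ 2) ((x $ 3) ^ 2))"
    "pfun (\<lambda>x :: 'a ^ 3. coeff_y1 u ((x $ 1) ^ 2) ((x $ 2) ^ 2) ((x $ 3) ^ 2))"
    "pfun (\<lambda>x :: 'a ^ 3. coeff_x2 u ((x $ 1) ^ 2) ((x $ 2) ^ 2) ((x $ 3) ^ 2))"
    "pfun (\<lambda>x :: 'a ^ 3. coeff_y2 u ((x $ 1) ^ 2) ((x $ 2) ^ 2) ((x $ 3) ^ 2))"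
    unfolding coeff_x1_def coeff_y1_def coeff_x2_def coeff_y2_def
        by (intro polyfn_intros pfun_coord)+
  have pm: "pmap ?F" "pmap ?G" by (intro pmap_der15 pf)+
  have hom: "homog_map 7 ?F" "homog_map 7 ?G"
    by (intro homog_der15; unfold coeff_x1_def coeff_y1_def coeff_x2_def coeff_y2_def;
        simp only: power_mult_distrib distrib_left; simp add: mult_ac eval_nat_numeral)+
  have pres: "preserves planes ?F" "preserves planes ?G"
    unfolding preserves_iff u_def
    using preserves_der15[OF tangent_family1 tangent_diagonal1 tangent_constant1]
      preserves_der15[OF tangent_family2 tangent_diagonal2 tangent_constant2]
    by blast+
  define m where "m x = coeff_x1 u ((x $ 1) ^ 2) ((x $ 2) ^ 2) ((x $ 3) ^ 2) * coeff_y2 u ((x $ 1)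
      ^ 2) ((x $ 2) ^ 2) ((x $ 3) ^ 2)
      - coeff_y1 u ((x $ 1) ^ 2) ((x $ 2) ^ 2) ((x $ 3) ^ 2) * coeff_x2 u ((x $ 1) ^ 2) ((x $ 2) ^
          2) ((x $ 3) ^ 2)" for x :: "'a ^ 3"
  have det: "bracket x (?F x) (?G x) = (x $ 1 * x $ 2 * x $ 3) * m x" for x
    by (simp add: bracket_def der15_def m_def algebra_simps)
  have ex: "\<exists>x. bracket x (?F x) (?G x) \<noteq> 0"
  proof -
    \<comment> \<open>At \<open>(0, 0, 1)\<close> only the coefficients of \<open>Z ^ 3\<close>
      count, and \<open>coeff_y1\<close> has none, so the minor reduces to one product.\<close>
    have "m (axis 3 1) = (1 - 18 * u + u ^ 2) * (8 * u - 16 * u ^ 2 + 8 * u ^ 3)"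
      by (simp add: m_def coeff_x1_def coeff_y1_def coeff_y2_def axis_def)
    also have "8 * u - 16 * u ^ 2 + 8 * u ^ 3 = 8 * u * (1 - u) ^ 2"
      by (simp add: algebra_simps power2_eq_square power3_eq_cube)
    finally have "m (axis 3 1) \<noteq> 0" using u by simp
    moreover have "pfun m" unfolding m_def[abs_def] by (intro polyfn_intros pf)
    moreover have "pfun (\<lambda>x :: 'a ^ 3. x $ 1 * x $ 2 * x $ 3)" by (intro polyfn_intros pfun_coord)
    moreover have "(vector [1, 1, 1] :: 'a ^ 3) $ 1 * (vector [1, 1, 1] :: 'a ^ 3) $ 2 * (vector
        [1, 1, 1] :: 'a ^ 3) $ 3 \<noteq> 0" by simp
    ultimately have "\<exists>x. (x $ 1 * x $ 2 * x $ 3) * m x \<noteq> 0"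
      using pfun_mult_eq_0_on[OF affine_set_UNIV, of "\<lambda>x. x $ 1 * x $ 2 * x $ 3" m] by blast
    then show ?thesis unfolding det .
  qed
  have "homogeneous_basis {1..15} (form15 t) ?F ?G 7"
    by unfold_locales (rule pm hom pres ex | simp)+
  then show ?thesis by blast
qed

section \<open>The lattice of 15 planes\<close>

definition rows_L15 :: "'r::comm_ring_1 \<Rightarrow> ('r \<times> 'r \<times> 'r) list" where
  "rows_L15 t = [(1, 0, 0), (1, 1, 0), (1, 0, 1), (1, 1, 1), (1, t, 1), (0, 1, 0), (2, 1, 1),
     (t + 1, t, 1), (t + 1, 1, 1), (2 * t, t, 1), (1, - t + 1, 1),
     (- 3 * t + 1, t ^ 2 - 3 * t + 1, - t), (3 * t - 1, t, t), (- 3 * t + 1, - (t ^ 2), - t),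
     (3 * t - 1, 2 * t - 1, t)]"

definition form_L15 :: "'r::comm_ring_1 \<Rightarrow> nat \<Rightarrow> 'r ^ 3" where
  "form_L15 t = row_form (rows_L15 t)"

lemma form_L15_simps:
  "form_L15 t 1 = vector [1, 0, 0]" "form_L15 t (Suc 0) = vector [1, 0, 0]"
  "form_L15 t 2 = vector [1, 1, 0]" "form_L15 t 3 = vector [1, 0, 1]"
  "form_L15 t 4 = vector [1, 1, 1]" "form_L15 t 5 = vector [1, t, 1]"
  "form_L15 t 6 = vector [0, 1, 0]" "form_L15 t 7 = vector [2, 1, 1]"
  "form_L15 t 8 = vector [t + 1, t, 1]" "form_L15 t 9 = vector [t + 1, 1, 1]"
  "form_L15 t 10 = vector [2 * t, t, 1]" "form_L15 t 11 = vector [1, - t + 1, 1]"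
  "form_L15 t 12 = vector [- 3 * t + 1, t ^ 2 - 3 * t + 1, - t]"
  "form_L15 t 13 = vector [3 * t - 1, t, t]"
  "form_L15 t 14 = vector [- 3 * t + 1, - (t ^ 2), - t]"
  "form_L15 t 15 = vector [3 * t - 1, 2 * t - 1, t]"
  by (simp_all add: form_L15_def row_form_def rows_L15_def vec3_def)

text \<open>Stated for a bare ring homomorphism because three are used: the embedding of polynomials
  into fractions, evaluation at 5, and the map from the integers.\<close>

lemma form_L15_hom:
  assumes h: "h 0 = 0" "h 1 = 1" "\<And>a b. h (a + b) = h a + h b" "\<And>a. h (- a) = - h a"
    "\<And>a b. h (a * b) = h a * h b"
  shows "form_L15 (h t) i = (\<chi> j. h (form_L15 t i $ j))"
proof -
  have d: "h (a - b) = h a - h b" for a b using h(3)[of a "- b"] h(4)[of b] by simp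
  have "h 2 = 2" using h(3)[of 1 1] h(2) by simp
  moreover from this have "h 3 = 3" using h(3)[of 1 2] h(2) by simp
  ultimately have "rows_L15 (h t) = map (map_triple h) (rows_L15 t)"
    by (simp add: rows_L15_def map_triple_def h d power2_eq_square)
  then show ?thesis using row_form_map[of h, OF h(1)] by (simp add: form_L15_def)
qed

definition points_L15 :: "'r::comm_ring_1 \<Rightarrow> (nat set \<times> 'r \<times> 'r \<times> 'r) set" where
  "points_L15 t = {({1, 2, 6}, 0, 0, 1), ({3, 10, 13}, - t, 2 * t - 1, t),
     ({4, 10, 15}, 1 - t, 2 * t - 1, - t), ({5, 7, 12}, t - 1, 1, 1 - 2 * t),
     ({6, 8, 9}, 1, 0, - 1 - t), ({7, 11, 14}, t, - 1, 1 - 2 * t),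
     ({1, 4, 7, 9, 13}, 0, - 1, 1), ({1, 5, 8, 10, 14}, 0, - 1, t),
     ({2, 3, 7, 8, 15}, 1, - 1, - 1), ({2, 9, 10, 11, 12}, 1, - 1, - t),
     ({3, 4, 5, 6, 11}, - 1, 0, 1), ({6, 12, 13, 14, 15}, - t, 0, 3 * t - 1)}"

lemma points_L15_incident: "(b, v) \<in> points_L15 t \<Longrightarrow> i \<in> b \<Longrightarrow> dotp (form_L15 t i) (vec3 v) = 0"
  unfolding points_L15_def
  by (elim insertE emptyE Pair_inject; simp; elim disjE)
    (simp_all add: form_L15_simps dotp_3 vec3_def algebra_simps power2_eq_square)

lemma points_L15_nonzero: "(b, v) \<in> points_L15 ([:0, 1:] :: 'a::idom poly) \<Longrightarrow> vec3 v \<noteq> 0"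
  unfolding points_L15_def vec_eq_iff forall_3
  by (elim insertE emptyE Pair_inject) (simp_all add: vec3_def)

lemma realizes_L15_at_5: "realizes {1..15} blocks15 (form_L15 (5 :: int))"
proof -
  have "List.enumerate 1 (rows_L15 5) =
    [(1, 1, 0, 0), (2, 1, 1, 0), (3, 1, 0, 1), (4, 1, 1, 1), (5, 1, 5, 1), (6, 0, 1, 0), (7, 2, 1,
        1),
     (8, 6, 5, 1), (9, 6, 1, 1), (10, 10, 5, 1), (11, 1, - 4, 1), (12, - 14, 11, - 5), (13, 14, 5,
         5),
     (14, - 14, - 25, - 5), (15, 14, 9, 5 :: int)]"
    by (simp add: rows_L15_def)
  moreover have "triple_check block_list15 \<dots>" by code_simp
  ultimately have "triple_check block_list15 (List.enumerate 1 (rows_L15 5))" by simp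
  then have "realizes {1..length (rows_L15 (5 :: int))} blocks15 (row_form (rows_L15 (5 :: int)))"
    by (rule realizes_if_triple_check) (rule blocks15_list)
  moreover have "length (rows_L15 (5 :: int)) = 15" by (simp add: rows_L15_def)
  ultimately show ?thesis by (simp only: form_L15_def)
qed

text \<open>The concurrences hold over the polynomial ring; the other brackets do not vanish there because
  they do not vanish at \<open>t = 5\<close>.\<close>

lemma realizes_L15: "realizes {1..15} blocks15 (form_L15 indet)"
proof -
  let ?q = "form_L15 ([:0, 1:] :: rat poly)"
  let ?h = "\<lambda>p :: rat poly. Fract p 1"
  have emb: "form_L15 indet i = (\<chi> j. ?h (?q i $ j))" for i
    unfolding indet_def
    by (rule form_L15_hom) (simp_all add: Zero_fract_def One_fract_def)
  have "form_L15 (of_int 5 :: rat) i = (\<chi> j. of_int (form_L15 (5 :: int) i $ j))" for i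
    by (rule form_L15_hom) simp_all
  then have at5: "realizes {1..15} blocks15 (form_L15 (of_int 5 :: rat))"
    by (rule realizes_of_int[OF realizes_L15_at_5])
  have "form_L15 (poly [:0, 1:] (of_int 5 :: rat)) i = (\<chi> j. poly (?q i $ j) (of_int 5))" for i
    by (rule form_L15_hom) simp_all
  then have eval: "form_L15 (of_int 5 :: rat) i = (\<chi> j. poly (?q i $ j) (of_int 5))" for i by simp
  show ?thesis
    unfolding realizes_def
  proof (intro ballI impI)
    fix i j k :: nat
    assume I: "i \<in> {1..15}" "j \<in> {1..15}" "k \<in> {1..15}" and d: "i \<noteq> j \<and> i \<noteq> k \<and> j \<noteq> k"
    have br: "bracket (form_L15 indet i) (form_L15 indet j) (form_L15 indet k) =
        ?h (bracket (?q i) (?q j) (?q k))"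
      by (simp add: emb bracket_def)
    show "bracket (form_L15 indet i) (form_L15 indet j) (form_L15 indet k) = 0 \<longleftrightarrow>
        (\<exists>b\<in>blocks15. {i, j, k} \<subseteq> b)"
    proof
      assume "bracket (form_L15 indet i) (form_L15 indet j) (form_L15 indet k) = 0"
      then have "bracket (?q i) (?q j) (?q k) = 0" by (simp add: br Zero_fract_def eq_fract)
      moreover have "bracket (form_L15 (of_int 5 :: rat) i) (form_L15 (of_int 5) j) (form_L15
          (of_int 5) k) =
          poly (bracket (?q i) (?q j) (?q k)) (of_int 5)"
        unfolding eval by (simp add: bracket_def)
      ultimately have "bracket (form_L15 (of_int 5 :: rat) i) (form_L15 (of_int 5) j) (form_L15
          (of_int 5) k) = 0"
        by simp
      then show "\<exists>b\<in>blocks15. {i, j, k} \<subseteq> b"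
        using at5 I d unfolding realizes_def by blast
    next
      assume "\<exists>b\<in>blocks15. {i, j, k} \<subseteq> b"
      then obtain b where b: "b \<in> blocks15" "{i, j, k} \<subseteq> b" by blast
      moreover have "blocks15 = fst ` points_L15 ([:0, 1:] :: rat poly)"
        by (simp add: blocks15_def points_L15_def)
      ultimately obtain v where v: "(b, v) \<in> points_L15 ([:0, 1:] :: rat poly)"
        by (metis imageE prod.collapse)
      have "bracket (?q i) (?q j) (?q k) = 0"
        using b(2)
            by (intro bracket_eq_0_of_point[OF points_L15_nonzero[OF v]] points_L15_incident[OF
                v]) auto
      then show "bracket (form_L15 indet i) (form_L15 indet j) (form_L15 indet k) = 0"
        by (simp add: br Zero_fract_def)
    qed
  qed
qed

text \<open>The forms defining \<open>L15\<close> and the family \<open>rows15\<close> use different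
  coordinates but realize the same blocks with the same numbering.\<close>

lemma L15_iso: "\<exists>\<phi>. poset_iso L15 (block_lattice {1..15} blocks15) \<phi>"
proof -
  interpret block_system "{1..15}" blocks15 by (rule block_system15)
  interpret realization "{1..15}" blocks15 "form_L15 indet" by unfold_locales (rule realizes_L15)
  have "{1..15 :: nat} = {1, 2, 3, 4, 5, 6, 7, 8, 9, 10, 11, 12, 13, 14, 15}" by code_simp
  then have "L15_forms indet = form_L15 indet ` {1..15}"
    by (simp only: L15_forms_def image_insert image_empty form_L15_simps)
  then have "L15 = intersection_lattice (plane ` {1..15})"
    by (simp add: L15_def image_image)
  then show ?thesis using lattice_iso by metis
qed

section \<open>Both lattices together\<close>

lemma mem_realizations_of_moduli: "X \<in> moduli_space L \<Longrightarrow> A \<in> X \<Longrightarrow> A \<in> realizations L"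
  unfolding moduli_space_def by (auto elim!: quotientE)

lemma realization13:
  assumes A: "A \<in> (realizations L13 :: complex arrangement set)"
  shows "\<not> rigid A" "free_arrangement A" "\<not> inductively_free A"
proof -
  have form: "family13.form t = form13 t" for t
    by (rule ext) (simp only: family13.form_def form13_poly[symmetric])
  have A': "A \<in> realizations (block_lattice {1..13} L13_blocks)" using A by (simp only: L13_eq)
  then show "\<not> rigid A" by (rule family13.not_rigid)
  \<comment> \<open>Every plane attains exactly 6 here, so each carries \<open>12 - 6\<close> points
    of intersection.\<close>
  have mult: "\<forall>i\<in>{1..13}. 6 \<le> (\<Sum>b | b \<in> L13_blocks \<and> i \<in> b. card b - 2)"
    unfolding L13_blocks_def by code_simp
  have basis: "\<exists>F G. homogeneous_basis {1..13} (family13.form t) F G 6"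
    if "t \<in> {t. realizes {1..13} L13_blocks (family13.form t)}" for t
    using that basis13[of t] by (simp only: form mem_Collect_eq)
  show "free_arrangement A" "\<not> inductively_free A"
    by (rule family13.realization_free[OF A' basis bspec[OF mult]]; assumption)+
qed

lemma realization15:
  assumes A: "A \<in> (realizations (block_lattice {1..15} blocks15) :: complex arrangement set)"
  shows "\<not> rigid A" "free_arrangement A" "\<not> inductively_free A"
proof -
  have form: "family15.form t = form15 t" for t
    by (rule ext) (simp only: family15.form_def form15_poly[symmetric])
  show "\<not> rigid A" by (rule family15.not_rigid[OF A])
  have mult: "\<forall>i\<in>{1..15}. 7 \<le> (\<Sum>b | b \<in> blocks15 \<and> i \<in> b. card b - 2)"
    unfolding blocks15_def by code_simp
  have basis: "\<exists>F G. homogeneous_basis {1..15} (family15.form t) F G 7"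
    if "t \<in> {t. realizes {1..15} blocks15 (family15.form t)}" for t
    using that basis15[of t] by (simp only: form mem_Collect_eq)
  show "free_arrangement A" "\<not> inductively_free A"
    by (rule family15.realization_free[OF A basis bspec[OF mult]]; assumption)+
qed

theorem theorem1p7:
  shows
    "(krull_dim (moduli_topology L13 :: complex arrangement set topology) = 1 \<and>
      (\<forall>X \<in> (moduli_space L13 :: complex arrangement set set). \<forall>A\<in>X.
         \<not> rigid A \<and> free_arrangement A \<and> \<not> inductively_free A)) \<and>
     (krull_dim (moduli_topology L15 :: complex arrangement set topology) = 1 \<and>
      (\<forall>X \<in> (moduli_space L15 :: complex arrangement set set). \<forall>A\<in>X.
         \<not> rigid A \<and> free_arrangement A \<and> \<not> inductively_free A)) \<and>
     \<not> ({A :: complex arrangement. arrangement A \<and> free_arrangement A} \<subseteq>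
          {A. arrangement A \<and> inductively_free A} \<union> {A. arrangement A \<and> rigid A})"
proof (intro conjI ballI)
  show "krull_dim (moduli_topology L13 :: complex arrangement set topology) = 1"
    unfolding L13_eq by (rule family13.krull_dim_moduli)
  show "\<not> rigid A" "free_arrangement A" "\<not> inductively_free A"
    if "X \<in> moduli_space L13" "A \<in> X" for X and A :: "complex arrangement"
    using realization13[OF mem_realizations_of_moduli[OF that]] .
  obtain \<phi> where iso: "poset_iso L15 (block_lattice {1..15} blocks15) \<phi>" using L15_iso by blast
  show "krull_dim (moduli_topology L15 :: complex arrangement set topology) = 1"
    unfolding moduli_topology_iso[OF iso] by (rule family15.krull_dim_moduli)
  show "\<not> rigid A" "free_arrangement A" "\<not> inductively_free A"
    if "X \<in> moduli_space L15" "A \<in> X" for X and A :: "complex arrangement"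
    using realization15 mem_realizations_of_moduli[OF that] unfolding realizations_iso[OF iso]
        by blast+
  \<comment> \<open>Any admissible parameter gives a counterexample to the inclusion.\<close>
  obtain t where "realizes {1..13} L13_blocks (family13.form t)"
    using family13.infinite_U not_finite_existsD by auto
  then have "family13.family_planes t \<in> realizations L13"
    unfolding L13_eq by (intro family13.family_planes_realization) simp
  moreover from this have "arrangement (family13.family_planes t)" by (simp add: realizations_def)
  ultimately show "\<not> ({A :: complex arrangement. arrangement A \<and> free_arrangement A} \<subseteq>
      {A. arrangement A \<and> inductively_free A} \<union> {A. arrangement A \<and> rigid A})"
    using realization13 by blast
qed

end
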